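(* For $X\ge 2$ and $t\ge 0$ let $$f_X(t)=-\sum_{n<X}\frac{\Lambda(n)\sin(t\log n)}{\sqrt{n}\,\log n}+\frac{\Delta(X)\sin(t\log X)}{\sqrt{X}\,\log X}+\int_{1}^{X}\frac{\sin(t\log y)}{\sqrt{y}\,\log y}\,dy .$$ Let $E\subset[0,\infty)$ be a discrete set and let $f:[0,\infty)\to\mathbb{R}$ be continuous on $[0,\infty)\setminus E$, with $f(t)=\lim_{X\to\infty}f_X(t)$ and $f_X(t)=O(\log t)$ for $t\in[0,\infty)\setminus E$, the implied constant being independent of $X$. Then the Riemann hypothesis holds.
   Context: $\Lambda$ is the von Mangoldt function, $\psi(x)=\sum_{n<x}\Lambda(n)$ and $\Delta(x)=\psi(x)-x$. The Riemann hypothesis asserts that all nontrivial zeros of $\zeta$ have real part $\frac12$. *)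

theory Defs
  imports "HOL-Complex_Analysis.Complex_Analysis" "HOL-Number_Theory.Number_Theory"
begin

definition chebyshev_psi :: "real \<Rightarrow> real" where
  "chebyshev_psi x = (\<Sum>n | 1 \<le> n \<and> real n < x. mangoldt n)"

definition chebyshev_delta :: "real \<Rightarrow> real" where
  "chebyshev_delta x = chebyshev_psi x - x"

(* The summand n = 1 is 0 / 0 = 0, in accordance with mangoldt 1 = 0. The integrand is likewise
   0 at y = 1 (its limit there is t), which does not affect the integral. *)
definition f_trunc :: "real \<Rightarrow> real \<Rightarrow> real" where
  "f_trunc X t =
     - (\<Sum>n | 1 \<le> n \<and> real n < X. mangoldt n * sin (t * ln (real n)) / (sqrt (real n) * ln (real n)))
     + chebyshev_delta X * sin (t * ln X) / (sqrt X * ln X)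
     + integral {1..X} (\<lambda>y. sin (t * ln y) / (sqrt y * ln y))"

(* The analytic continuation of the Dirichlet series to the plane without 1. The value 0 at the
   pole is a convention that makes the function unique. *)
definition riemann_zeta :: "complex \<Rightarrow> complex" where
  "riemann_zeta = (THE Z. Z holomorphic_on - {1} \<and>
      (\<forall>s. Re s > 1 \<longrightarrow> (\<lambda>n. 1 / of_nat (Suc n) powr s) sums Z s) \<and> Z 1 = 0)"

(* The trivial zeros are -2, -4, -6, ...; the point 1 is excluded because it is the pole. *)
definition nontrivial_zeta_zero :: "complex \<Rightarrow> bool" where
  "nontrivial_zeta_zero s \<longleftrightarrow>
     s \<noteq> 1 \<and> riemann_zeta s = 0 \<and> \<not> (\<exists>k::nat. k \<ge> 1 \<and> s = - 2 * of_nat k)"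

definition riemann_hypothesis :: bool where
  "riemann_hypothesis \<longleftrightarrow> (\<forall>s. nontrivial_zeta_zero s \<longrightarrow> Re s = 1 / 2)"

end

theory Submission
  imports Defs
begin

text \<open>
  Fix \<open>t\<close> such that \<open>f_X(t)\<close> converges as \<open>X\<close> tends to infinity; then \<open>b(u) = f_X(t)\<close> with
  \<open>X = e\<^sup>u\<close> is bounded, so \<open>V(z) = \<integral> b(u) (z u\<^sup>2 - 2 u) e\<^sup>-\<^sup>z\<^sup>u du\<close> over \<open>u \<ge> 0\<close> is holomorphic for
  \<open>Re z > 0\<close>. Partial summation gives \<open>b' = \<Delta>(e\<^sup>u) H'(u)\<close> with \<open>H(u) = e\<^sup>-\<^sup>u\<^sup>/\<^sup>2 sin(t u) / u\<close>, and the
  factor \<open>u\<^sup>2\<close> cancels the denominators of \<open>H'\<close>. Hence \<open>V\<close> is a linear combination of \<open>M\<close> and \<open>M'\<close> at the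
  points \<open>z + 1/2 \<plusminus> it\<close>, where \<open>M(w) = - \<zeta>'(w) / (w \<zeta>(w)) - 1 / (w - 1)\<close> is the Mellin transform of \<open>\<Delta>\<close>.
  A zero \<open>\<rho>\<close> with \<open>Re \<rho> > 1/2\<close> would give \<open>V\<close> a double pole at \<open>\<rho> - 1/2 + it\<close>, unless it is cancelled by a
  zero or pole of \<open>\<zeta>\<close> at \<open>\<rho> + 2it\<close>. The latter happens for countably many \<open>t\<close> only, and the
  discrete set \<open>E\<close> is countable as well, so a suitable \<open>t\<close> exists. The functional equation
  excludes nontrivial zeros to the left of the critical line.

  The continuation of \<open>\<zeta>\<close> to \<open>Re s > -1\<close> is the trapezoidal rule for \<open>\<Sum> n\<^sup>-\<^sup>s\<close>. For \<open>-1 < s < 0\<close> its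
  remainder is an integral of positive functions, which Tonelli's theorem and the partial fractions
  of the hyperbolic cotangent turn into \<open>\<zeta>(1 - s)\<close>; this is the functional equation.
\<close>

section \<open>Analytic continuation and functional equation of the zeta function\<close>

text \<open>The Laplace transform of \<open>b\<close> alone would contain logarithms: a denominator
  \<open>u\<close> amounts to an integration in \<open>z\<close>, so a zero of \<zeta> would appear
  as a branch point. Two factors \<open>u\<close> undo this, and the kernel is chosen as the
  derivative of \<open>- u\<^sup>2 exp (- z u)\<close>, so that integration by parts leaves
  \<open>b'\<close> times \<open>u\<^sup>2\<close>. The derivative of M enters through the part of
  H' that has a single \<open>u\<close> in the denominator. Its coefficients are t/2 + i/4 and t/2 -
  i/4, where i/4 stems from differentiating exp (- u / 2). They vanish for no real t, so the double
  pole is really present. The formula for V is proved for large Re z and then continued. Nothing is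
  known there about the position of the zeros of \<zeta>; it suffices that they are countable,
  because a connected open set in the plane stays connected when a countable set is removed. As
  \<open>riemann_zeta\<close> is described as the unique continuation to the whole punctured plane,
  it has no usable property before such a continuation is built. To the left of Re s = 0 the
  functional equation itself provides it.\<close>

text \<open>A local form of the Weierstrass M-test. The majorant may vary with the disc, because the
  bounds for the trapezoid errors degenerate towards Re s = -1 and those for the pieces of the
  Laplace integral towards Re z = 0.\<close>

lemma holomorphic_on_suminf_locally_dominated:
  fixes f :: "nat \<Rightarrow> complex \<Rightarrow> complex"
  assumes "open S" and hol: "\<And>n. f n holomorphic_on S"
    and dom: "\<And>z. z \<in> S \<Longrightarrow> \<exists>d>0. \<exists>M. cball z d \<subseteq> S \<and> summable M \<and>
                 (\<forall>n. \<forall>w\<in>cball z d. norm (f n w) \<le> M n)"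
  shows "(\<lambda>z. \<Sum>n. f n z) holomorphic_on S"
proof (rule holomorphic_uniform_sequence[OF \<open>open S\<close>, where f = "\<lambda>n z. \<Sum>i<n. f i z"])
  show "(\<lambda>z. \<Sum>i<n. f i z) holomorphic_on S" for n
    by (intro holomorphic_on_sum hol)
next
  fix z assume "z \<in> S"
  then obtain d M where "d > 0" "cball z d \<subseteq> S" "summable M" "\<forall>n. \<forall>w\<in>cball z d. norm (f n w) \<le> M n"
    using dom[OF \<open>z \<in> S\<close>] by blast
  moreover have "uniform_limit (cball z d) (\<lambda>n z. \<Sum>i<n. f i z) (\<lambda>z. \<Sum>n. f n z) sequentially"
    by (rule Weierstrass_m_test[of _ _ M]) (use calculation in blast)+
  ultimately show "\<exists>d>0. cball z d \<subseteq> S \<and>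
      uniform_limit (cball z d) (\<lambda>n z. \<Sum>i<n. f i z) (\<lambda>z. \<Sum>n. f n z) sequentially"
    by blast
qed

section \<open>Trapezoidal rule and the continuation of \<zeta> to Re s > -1\<close>

definition trapezoid_error :: "real \<Rightarrow> complex \<Rightarrow> complex" where
  "trapezoid_error a s =
     (of_real a powr (-s) + of_real (a + 1) powr (-s)) / 2
     - (of_real a powr (1 - s) - of_real (a + 1) powr (1 - s)) / (s - 1)"

text \<open>Peano kernel form of the error: v (1 - v) / 2 times the second derivative of x powr (-
  s). Two powers of x are gained, which makes the errors summable down to Re s > -1.\<close>

lemma trapezoid_error_has_integral:
  assumes a: "a > 0" and s: "s \<noteq> 1"
  shows "((\<lambda>v. s * (s + 1) / 2 * of_real (v * (1 - v)) * of_real (v + a) powr (-s-2))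
            has_integral trapezoid_error a s) {0..1}"
proof -
  have ring_identity: "(A * (- s * ((-s-1) * P)) + B * (- s * Q) - (B * ((-s) * Q) + (-2) * R)) / 2 - R
      = s * (s + 1) / 2 * A * P" for A B P Q R :: complex
    by (simp add: field_simps)
  \<comment> \<open>With p = (z - a) (a + 1 - z) and f = z powr (- s), this is (p f' - p' f) / 2
    minus a primitive of f. Since p'' = -2, the terms in f cancel in the derivative and p f'' / 2
    remains.\<close>
  define G where "G = (\<lambda>z::complex. ((z - a) * (a + 1 - z) * (- s * z powr (-s-1))
        - ((a + 1 - z) - (z - a)) * z powr (-s)) / 2 - z powr (1 - s) / (1 - s))"
  have "((\<lambda>v. G (of_real v + of_real a)) has_vector_derivative 
      (s * (s + 1) / 2 * of_real (v * (1 - v)) * of_real (v + a) powr (-s-2))) (at v within {0..1})" 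
    if v: "v \<in> {0..1}" for v
  proof (rule has_vector_derivative_real_field)
    define x where "x = v + a"
    have nz: "complex_of_real x \<notin> \<real>\<^sub>\<le>\<^sub>0" using v a unfolding complex_nonpos_Reals_iff by (auto simp: x_def)
    define z where "z = complex_of_real x"
    have 1: "((\<lambda>z. z powr (-s-1)) has_field_derivative (-s-1) * z powr (-s-2)) (at z)"
      using has_field_derivative_powr[OF nz, of "-s-1"] by (simp add: z_def diff_diff_eq)
    have 2: "((\<lambda>z. z powr (-s)) has_field_derivative (-s) * z powr (-s-1)) (at z)"
      using has_field_derivative_powr[OF nz, of "-s"] by (simp add: z_def)
    have 3: "((\<lambda>z. z powr (1-s) / (1-s)) has_field_derivative z powr (-s)) (at z)"
      using DERIV_cdivide[OF has_field_derivative_powr[OF nz, of "1-s"], of "1-s"] s by (simp add: z_def)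
    have 4: "((\<lambda>z. (z - a) * (a + 1 - z)) has_field_derivative (a + 1 - z) - (z - a)) (at z)"
      by (auto intro!: derivative_eq_intros)
    have 5: "((\<lambda>z. (a + 1 - z) - (z - a)) has_field_derivative -2) (at z)"
      by (auto intro!: derivative_eq_intros)
    have "(G has_field_derivative (((z - a) * (a + 1 - z) * (- s * ((-s-1) * z powr (-s-2)))
            + ((a + 1 - z) - (z - a)) * (- s * z powr (-s-1)))
        - (((a + 1 - z) - (z - a)) * ((-s) * z powr (-s-1)) + (-2) * z powr (-s))) / 2 - z powr (-s)) (at z)"
      unfolding G_def
      by (rule DERIV_cong[OF DERIV_diff[OF DERIV_cdivide[OF
            DERIV_diff[OF DERIV_mult[OF 4 DERIV_cmult[OF 1]] DERIV_mult[OF 5 2]]] 3]]) (simp add: mult_ac add_ac)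
    also have "(((z - a) * (a + 1 - z) * (- s * ((-s-1) * z powr (-s-2)))
            + ((a + 1 - z) - (z - a)) * (- s * z powr (-s-1)))
        - (((a + 1 - z) - (z - a)) * ((-s) * z powr (-s-1)) + (-2) * z powr (-s))) / 2 - z powr (-s)
      = s * (s + 1) / 2 * ((z - a) * (a + 1 - z)) * z powr (-s-2)"
      by (rule ring_identity)
    also have "\<dots> = s * (s + 1) / 2 * of_real (v * (1 - v)) * of_real (v + a) powr (-s-2)"
      unfolding z_def by (simp add: x_def)
    finally show "((\<lambda>w. G (w + of_real a)) has_field_derivative s * (s + 1) / 2 * of_real (v * (1 - v)) * of_real (v + a) powr (-s-2))
            (at (complex_of_real v))"
      unfolding z_def x_def of_real_add DERIV_shift .
  qed
  hence "((\<lambda>v. s * (s + 1) / 2 * of_real (v * (1 - v)) * of_real (v + a) powr (-s-2))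
            has_integral (G (of_real 1 + of_real a) - G (of_real 0 + of_real a))) {0..1}"
    by (intro fundamental_theorem_of_calculus) auto
  also have "G (of_real 1 + of_real a) - G (of_real 0 + of_real a) = trapezoid_error a s"
  proof -
    have "x / (1 - s) - y / (1 - s) = - ((x - y) / (s - 1))" for x y
      using s by (simp add: divide_simps) (simp add: algebra_simps)
    note * = this[of "of_real (a + 1) powr (1 - s)" "of_real a powr (1 - s)"]
    have "G (of_real 1 + of_real a) - G (of_real 0 + of_real a) = (of_real a powr (-s) + of_real (a + 1) powr (-s)) / 2
        - (of_real (a + 1) powr (1 - s) / (1 - s) - of_real a powr (1 - s) / (1 - s))"
      by (simp add: G_def add_divide_distrib add.commute)
    thus ?thesis unfolding * by (simp add: trapezoid_error_def diff_divide_distrib)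
  qed
  finally show ?thesis .
qed

text \<open>A lower bound \<sigma> instead of Re s itself lets one majorant serve a whole disc. The
  powers are monotone in the exponent because \<open>a \<ge> 1\<close> and decreasing in the base
  because \<open>- 2 \<le> \<sigma>\<close>.\<close>

lemma norm_trapezoid_error_le:
  assumes s: "s \<noteq> 1" and "- 2 \<le> \<sigma>" "\<sigma> \<le> Re s" "a \<ge> 1"
  shows "norm (trapezoid_error a s) \<le> norm (s * (s + 1)) * a powr (- \<sigma> - 2)"
proof -
  have a: "a > 0" using assms by simp
  have bound: "norm (s * (s + 1) / 2 * of_real (v * (1 - v)) * of_real (v + a) powr (-s-2))
       \<le> norm (s * (s + 1)) * a powr (- \<sigma> - 2)" if "v \<in> cbox 0 1" for v
  proof -
    define x where "x = v + a"
    have v: "0 \<le> v" "v \<le> 1" using that by auto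
    hence x: "a \<le> x" by (auto simp: x_def)
    have "norm (of_real x powr (-s-2)) = x powr (- Re s - 2)"
      using x a by (subst norm_powr_real_powr) auto
    also have "\<dots> \<le> x powr (- \<sigma> - 2)" using x assms by (intro powr_mono) auto
    also have "\<dots> \<le> a powr (- \<sigma> - 2)" using x assms by (intro powr_mono2') auto
    finally have 1: "norm (of_real x powr (-s-2)) \<le> a powr (- \<sigma> - 2)" .
    have "v * (1 - v) \<le> 1 * 1" using v by (intro mult_mono) auto
    moreover have "v * (1 - v) \<ge> 0" using v by (intro mult_nonneg_nonneg) auto
    ultimately have 2: "norm (complex_of_real (v * (1 - v))) \<le> 1"
      unfolding norm_of_real by linarith
    have "norm (s * (s + 1) / 2 * of_real (v * (1 - v)) * of_real (v + a) powr (-s-2))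
       = norm (s * (s + 1)) / 2 * norm (complex_of_real (v * (1 - v))) * norm (of_real x powr (-s-2))"
      unfolding x_def by (simp only: norm_mult norm_divide) simp
    also have "\<dots> \<le> norm (s * (s + 1)) / 2 * 1 * a powr (- \<sigma> - 2)"
      by (intro mult_mono 1 2) auto
    also have "\<dots> \<le> norm (s * (s + 1)) * a powr (- \<sigma> - 2)" by (intro mult_right_mono) auto
    finally show ?thesis .
  qed
  show ?thesis
    using has_integral_bound[OF _ trapezoid_error_has_integral[OF a s, folded cbox_interval] bound] by simp
qed

text \<open>The trapezoidal rule summed over [n, n + 1] for n \<ge> 1: the end point 1 carries only
  half weight, which accounts for 1 / 2, and the integral of x powr (- s) from 1 to \<infinity> is 1
  / (s - 1).\<close>

definition zeta_right :: "complex \<Rightarrow> complex" where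
  "zeta_right s = 1 / (s - 1) + 1 / 2 + (\<Sum>n. trapezoid_error (real (Suc n)) s)"

lemma summable_Suc_powr: "x < -1 \<Longrightarrow> summable (\<lambda>n. real (Suc n) powr x)"
  using summable_real_powr_iff[of x] by (subst summable_Suc_iff) simp

lemma summable_norm_trapezoid_error:
  assumes "Re s > -1" "s \<noteq> 1"
  shows "summable (\<lambda>n. norm (trapezoid_error (real (Suc n)) s))"
proof (rule summable_comparison_test_ev)
  show "\<forall>\<^sub>F n in sequentially. norm (norm (trapezoid_error (real (Suc n)) s)) \<le>
           norm (s * (s + 1)) * real (Suc n) powr (- Re s - 2)"
    using norm_trapezoid_error_le[of s "Re s" "real (Suc n)" for n] assms
    by (intro always_eventually) (auto simp del: of_nat_Suc)
  show "summable (\<lambda>n. norm (s * (s + 1)) * real (Suc n) powr (- Re s - 2))"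
    using assms by (intro summable_mult summable_Suc_powr) auto
qed

lemma zeta_right_holomorphic: "zeta_right holomorphic_on {s. Re s > -1} - {1}"
proof -
  have op: "open ({s. Re s > -1} - {1::complex})" 
    by (intro open_Diff open_halfspace_Re_gt) auto
  have "(\<lambda>s. \<Sum>n. trapezoid_error (real (Suc n)) s) holomorphic_on {s. Re s > -1} - {1}"
  proof (rule holomorphic_on_suminf_locally_dominated[OF op])
    show "trapezoid_error (real (Suc n)) holomorphic_on {s. Re s > -1} - {1}" for n
      unfolding trapezoid_error_def by (intro holomorphic_intros) auto
  next
    fix z assume z: "z \<in> {s. Re s > -1} - {1::complex}"
    then obtain d where d: "d > 0" "cball z d \<subseteq> {s. Re s > -1} - {1}"
      using op open_contains_cball by blast
    have "\<exists>s\<in>cball z d. \<forall>t\<in>cball z d. Re s \<le> Re t"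
      using d(1) by (intro continuous_attains_inf continuous_intros) auto
    then obtain s0 where s0: "s0 \<in> cball z d" "\<And>t. t \<in> cball z d \<Longrightarrow> Re s0 \<le> Re t" by blast
    define M where "M = (norm z + d) * (norm z + d + 1)"
    show "\<exists>d>0. \<exists>M. cball z d \<subseteq> {s. Re s > -1} - {1} \<and> summable M \<and>
                 (\<forall>n. \<forall>w\<in>cball z d. norm (trapezoid_error (real (Suc n)) w) \<le> M n)"
    proof (intro exI[of _ d] conjI d exI[of _ "\<lambda>n. M * real (Suc n) powr (- Re s0 - 2)"] allI ballI)
      show "summable (\<lambda>n. M * real (Suc n) powr (- Re s0 - 2))"
        using s0(1) d(2) by (intro summable_mult summable_Suc_powr) auto
    next
      fix n w assume w: "w \<in> cball z d"
      have nw: "norm w \<le> norm z + d" using w norm_triangle_ineq[of z "w - z"]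
        by (auto simp: dist_norm norm_minus_commute)
      have "norm (trapezoid_error (real (Suc n)) w) \<le> norm (w * (w + 1)) * real (Suc n) powr (- Re s0 - 2)"
        using s0(1) s0(2)[OF w] d w by (intro norm_trapezoid_error_le) auto
      also have "norm (w * (w + 1)) \<le> M" unfolding norm_mult M_def
        using nw norm_triangle_ineq[of w 1] by (intro mult_mono) (auto intro: add_nonneg_nonneg simp: d less_imp_le)
      finally show "norm (trapezoid_error (real (Suc n)) w) \<le> M * real (Suc n) powr (- Re s0 - 2)"
        by (simp add: mult_right_mono)
    qed
  qed
  thus ?thesis unfolding zeta_right_def by (intro holomorphic_intros) auto
qed

text \<open>The trapezoidal rule is exact on constants. The value excludes s = 0 as a zero and
  settles the constant case in the countability of the zeros.\<close>

lemma zeta_right_0: "zeta_right 0 = - 1 / 2"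
proof -
  have "trapezoid_error (real (Suc n)) 0 = 0" for n
  proof -
    have "complex_of_real (real (Suc n)) \<noteq> 0" "complex_of_real (real (Suc n) + 1) \<noteq> 0"
      unfolding of_real_eq_0_iff by auto
    thus ?thesis unfolding trapezoid_error_def by simp
  qed
  thus ?thesis by (simp add: zeta_right_def)
qed

lemma zeta_right_sums:
  assumes s: "Re s > 1"
  shows "(\<lambda>n. 1 / of_nat (Suc n) powr s) sums zeta_right s"
proof -
  have s1: "s \<noteq> 1" using s by auto
  define P where "P = (\<lambda>n. \<Sum>k<n. 1 / complex_of_nat (Suc k) powr s)"
  define R where "R = (\<lambda>n. complex_of_nat (Suc n) powr (-s))"
  define Q where "Q = (\<lambda>n. complex_of_nat (Suc n) powr (1-s))"
  \<comment> \<open>The integrals telescope, and inner points collect half weights from both sides;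
    only the end points 1 and n + 1 keep half weight.\<close>
  have *: "(\<Sum>k<n. trapezoid_error (real (Suc k)) s) = P n + (R n - 1) / 2 - (1 - Q n) / (s - 1)" for n
  proof (induction n)
    case (Suc n)
    have "trapezoid_error (real (Suc n)) s = (R n + R (Suc n)) / 2 - (Q n - Q (Suc n)) / (s - 1)"
      unfolding trapezoid_error_def R_def Q_def by (simp add: add_ac)
    moreover have "P (Suc n) = P n + R n" by (simp add: P_def R_def powr_minus field_simps)
    ultimately show ?case using s1 unfolding sum.lessThan_Suc Suc.IH
      by (simp add: diff_divide_distrib add_divide_distrib)
  qed (auto simp: P_def R_def Q_def)
  have lim: "(\<lambda>n. of_nat (Suc n) powr w) \<longlonglongrightarrow> (0::complex)" if "Re w < 0" for w
  proof (rule tendsto_norm_zero_cancel)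
    have "((\<lambda>n. real (Suc n) powr Re w)) \<longlonglongrightarrow> 0"
      by (rule filterlim_compose[OF tendsto_neg_powr[OF that filterlim_ident]])
         (rule filterlim_compose[OF filterlim_real_sequentially filterlim_Suc])
    also have "(\<lambda>n. real (Suc n) powr Re w) = (\<lambda>n. norm (complex_of_nat (Suc n) powr w))"
      by (intro ext, subst norm_powr_real_powr) (auto simp del: of_nat_Suc)
    finally show "(\<lambda>n. norm (complex_of_nat (Suc n) powr w)) \<longlonglongrightarrow> 0" .
  qed
  have "(\<lambda>n. (\<Sum>k<n. trapezoid_error (real (Suc k)) s) - (R n - 1) / 2 + (1 - Q n) / (s - 1)) \<longlonglongrightarrow>
          (\<Sum>n. trapezoid_error (real (Suc n)) s) - (0 - 1) / 2 + (1 - 0) / (s - 1)"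
    unfolding R_def Q_def using s s1
    by (intro tendsto_intros lim summable_LIMSEQ summable_norm_cancel[OF summable_norm_trapezoid_error]) auto
  also have "(\<lambda>n. (\<Sum>k<n. trapezoid_error (real (Suc k)) s) - (R n - 1) / 2 + (1 - Q n) / (s - 1)) = P"
    by (simp only: * algebra_simps) simp
  finally show ?thesis by (simp add: sums_def P_def zeta_right_def add_ac)
qed

section \<open>Partial fractions of the cotangent and the hyperbolic cotangent\<close>

text \<open>Logarithmic derivative of the reflection formula, in its form for the entire function
  \<open>rGamma\<close>, whose two factors do not vanish off the integers.\<close>

lemma Digamma_reflection:
  fixes z :: complex
  assumes "z \<notin> \<int>"
  shows "Digamma (1 - z) - Digamma z = of_real pi * cos (of_real pi * z) / sin (of_real pi * z)"
proof -
  have z: "z \<notin> \<int>\<^sub>\<le>\<^sub>0" using assms nonpos_Ints_subset_Ints by blast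
  have "1 - z \<notin> \<int>" using assms Ints_diff[of 1 "1 - z"] by auto
  hence z': "1 - z \<notin> \<int>\<^sub>\<le>\<^sub>0" using nonpos_Ints_subset_Ints by blast
  have refl: "rGamma w * rGamma (1 - w) = sin (of_real pi * w) / of_real pi" for w :: complex
    by (rule rGamma_reflection_complex)
  have d1: "((\<lambda>w. rGamma w * rGamma (1 - w)) has_field_derivative
           rGamma z * rGamma (1 - z) * (Digamma (1 - z) - Digamma z)) (at z)"
    using z z' by (auto intro!: derivative_eq_intros simp: algebra_simps)
  have d2: "((\<lambda>w. sin (of_real pi * w) / of_real pi) has_field_derivative cos (of_real pi * z)) (at z)"
    by (auto intro!: derivative_eq_intros)
  have "rGamma z * rGamma (1 - z) * (Digamma (1 - z) - Digamma z) = cos (of_real pi * z)"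
    using DERIV_unique[OF d1[unfolded refl] d2] unfolding refl .
  moreover have "rGamma z * rGamma (1 - z) \<noteq> 0"
    using z z' by (simp add: rGamma_eq_zero_iff)
  ultimately show ?thesis unfolding refl by (auto simp: field_simps)
qed

text \<open>Difference of the Digamma series at 1 - z and 1 + z, in which the harmonic terms and
  Euler's constant cancel. The recurrence from 1 + z to z produces the term - 1 / z.\<close>

lemma cot_partial_fractions:
  fixes z :: complex
  assumes z: "z \<notin> \<int>"
  shows "(\<lambda>k. inverse (1 + z + of_nat k) - inverse (1 - z + of_nat k)) sums
           (of_real pi * cos (of_real pi * z) / sin (of_real pi * z) - 1 / z)"
proof -
  have nz: "z \<noteq> 0" "1 + z \<noteq> 0" "1 - z \<noteq> 0"
    using z by (auto simp: add_eq_0_iff) 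
  have D: "(\<lambda>k. inverse (of_nat (Suc k)) - inverse (w + of_nat k)) sums (Digamma w + euler_mascheroni)"
    if "w \<noteq> 0" for w :: complex
    using summable_sums[OF summable_Digamma[OF that]] by (simp add: Digamma_def)
  have "(\<lambda>k. inverse (1 + z + of_nat k) - inverse (1 - z + of_nat k)) sums
           (Digamma (1 - z) - Digamma (1 + z))"
    using sums_diff[OF D[OF nz(3)] D[OF nz(2)]] by simp
  also have "Digamma (1 + z) = Digamma z + 1 / z"
    using Digamma_plus1[OF nz(1)] by (simp add: add_ac)
  also have "Digamma (1 - z) - (Digamma z + 1 / z) = (Digamma (1 - z) - Digamma z) - 1 / z"
    by simp
  finally show ?thesis unfolding Digamma_reflection[OF z] .
qed

lemma coth_partial_fractions:
  fixes x :: real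
  assumes x: "x > 0"
  shows "(\<lambda>k. 2 * x / (x\<^sup>2 + (2 * pi * real (Suc k))\<^sup>2)) sums (1 / (exp x - 1) + 1 / 2 - 1 / x)"
proof -
  \<comment> \<open>At this point pi z = i x / 2, so the cotangent becomes a hyperbolic one;
    \<open>1 / (exp x - 1) + 1 / 2\<close> is half of coth (x / 2).\<close>
  define z :: complex where "z = \<i> * of_real (x / (2 * pi))"
  have "z \<notin> \<int>" using x by (auto simp: z_def complex_is_Int_iff)
  from sums_mult[OF cot_partial_fractions[OF this], of "\<i> / (2 * of_real pi)"]
  have S: "(\<lambda>k. \<i> / (2 * of_real pi) * (inverse (1 + z + of_nat k) - inverse (1 - z + of_nat k))) sums
     (\<i> / (2 * of_real pi) * (of_real pi * cos (of_real pi * z) / sin (of_real pi * z) - 1 / z))" .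
  have 1: "\<i> / (2 * of_real pi) * (inverse (1 + z + of_nat k) - inverse (1 - z + of_nat k))
          = of_real (2 * x / (x\<^sup>2 + (2 * pi * real (Suc k))\<^sup>2))" for k
  proof -
    have pos: "x\<^sup>2 + (2 * pi * real (Suc k))\<^sup>2 > 0" using x by (intro add_pos_nonneg) auto
    have nz: "1 + z + of_nat k \<noteq> 0" "1 - z + of_nat k \<noteq> 0"
      using x by (auto simp: z_def complex_eq_iff)
    have "(1 + z + of_nat k) * (1 - z + of_nat k) = (of_nat (Suc k))\<^sup>2 - z\<^sup>2"
      by (simp add: algebra_simps power2_eq_square)
    also have "\<dots> = of_real ((x\<^sup>2 + (2 * pi * real (Suc k))\<^sup>2) / (2*pi)\<^sup>2)"
      unfolding z_def by (simp add: power_mult_distrib field_simps power2_eq_square)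
    finally have prod: "(1 + z + of_nat k) * (1 - z + of_nat k) = of_real ((x\<^sup>2 + (2 * pi * real (Suc k))\<^sup>2) / (2*pi)\<^sup>2)" .
    have "inverse (1 + z + of_nat k) - inverse (1 - z + of_nat k)
         = - 2 * z / ((1 + z + of_nat k) * (1 - z + of_nat k))"
      using nz by (simp add: divide_simps)
    also have "\<dots> = - 2 * z * of_real ((2*pi)\<^sup>2 / (x\<^sup>2 + (2 * pi * real (Suc k))\<^sup>2))"
      unfolding prod by simp
    finally have "\<i> / (2 * of_real pi) * (inverse (1 + z + of_nat k) - inverse (1 - z + of_nat k))
        = (\<i> / (2 * of_real pi) * (- 2 * z)) * of_real ((2*pi)\<^sup>2 / (x\<^sup>2 + (2 * pi * real (Suc k))\<^sup>2))"
      by (simp only: mult.assoc)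
    also have "\<i> / (2 * of_real pi) * (- 2 * z) = of_real (x / (2 * pi * pi))"
      by (simp add: z_def field_simps)
    finally have "\<i> / (2 * of_real pi) * (inverse (1 + z + of_nat k) - inverse (1 - z + of_nat k))
      = of_real (x / (2 * pi * pi) * ((2*pi)\<^sup>2 / (x\<^sup>2 + (2 * pi * real (Suc k))\<^sup>2)))"
      by (simp only: of_real_mult)
    also have "x / (2 * pi * pi) * ((2*pi)\<^sup>2 / (x\<^sup>2 + (2 * pi * real (Suc k))\<^sup>2))
        = 2 * x / (x\<^sup>2 + (2 * pi * real (Suc k))\<^sup>2)"
      using pos by (simp add: divide_simps) (simp add: power2_eq_square)
    finally show ?thesis .
  qed
  have 2: "\<i> / (2 * of_real pi) * (of_real pi * cos (of_real pi * z) / sin (of_real pi * z) - 1 / z)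
         = of_real (1 / (exp x - 1) + 1 / 2 - 1 / x)"
  proof -
    have piz: "of_real pi * z = \<i> * of_real (x / 2)" by (simp add: z_def)
    define E where "E = exp (x / 2)"
    have E: "E > 1" "exp x = E ^ 2" using x by (auto simp: E_def exp_double[symmetric])
    have E2: "E\<^sup>2 > 1" using E(1) by (simp add: power_strict_increasing one_less_power)
    have c: "cos (of_real pi * z) = of_real ((E + inverse E) / 2)"
      unfolding piz cos_i_times by (simp add: E_def exp_of_real[symmetric] exp_minus add_ac)
    have s: "sin (of_real pi * z) = \<i> * of_real ((E - inverse E) / 2)"
      unfolding piz sin_i_times by (simp add: E_def exp_of_real[symmetric] exp_minus)
    have nz: "(E - inverse E) / 2 \<noteq> 0" using E E2 by (simp add: field_simps power2_eq_square)
    have "\<i> / (2 * of_real pi) * (of_real pi * cos (of_real pi * z) / sin (of_real pi * z) - 1 / z)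
        = of_real ((E + inverse E) / 2 / ((E - inverse E) / 2) / 2 - 1 / x)"
    proof -
      have "\<i> / (2 * P) * (P * C / (\<i> * S) - 1 / (\<i> * (X / (2 * P)))) = C / S / 2 - 1 / X"
        if "S \<noteq> 0" "X \<noteq> 0" "P \<noteq> 0" for P C S X :: complex
        using that by (simp add: divide_simps) (simp add: algebra_simps)
      moreover have "complex_of_real ((E - inverse E) / 2) \<noteq> 0" "complex_of_real x \<noteq> 0" "complex_of_real pi \<noteq> 0"
        using nz x unfolding of_real_eq_0_iff by auto
      ultimately show ?thesis unfolding c s unfolding z_def of_real_diff of_real_divide of_real_mult of_real_1 of_real_numeral by blast
    qed
    also have "(E + inverse E) / 2 / ((E - inverse E) / 2) / 2 = (E\<^sup>2 + 1) / (E\<^sup>2 - 1) / 2"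
      using E nz by (simp add: divide_simps power2_eq_square)
    also have "(E\<^sup>2 + 1) / (E\<^sup>2 - 1) / 2 = 1 / (exp x - 1) + 1 / 2"
      unfolding E(2) using E2 by (simp add: divide_simps)
    finally show ?thesis by simp
  qed
  from S show ?thesis unfolding 1 2 sums_of_real_iff .
qed

section \<open>Three integrals in closed form\<close>

text \<open>The value is written with the coth expression so that its partial fractions apply; the
  factor \<open>1 - exp (- x)\<close> will cancel the geometric series of the exp (- n x).\<close>

lemma quadratic_laplace_has_integral:
  fixes x :: real
  assumes x: "x > 0"
  shows "((\<lambda>v. v * (1 - v) * exp (- (x * v))) has_integral 
     (1 - exp (- x)) * (2 / x\<^sup>2 * (1 / (exp x - 1) + 1 / 2 - 1 / x))) {0..1}"
proof -
  define G where "G = (\<lambda>v. - exp (- (x * v)) * (v * (1 - v) / x + (1 - 2 * v) / x\<^sup>2 - 2 / x ^ 3))"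
  have "((\<lambda>v. v * (1 - v) * exp (- (x * v))) has_integral (G 1 - G 0)) {0..1}"
  proof (rule fundamental_theorem_of_calculus)
    fix v assume "v \<in> {0..1::real}"
    have "(G has_real_derivative v * (1 - v) * exp (- (x * v))) (at v)"
      unfolding G_def using x
      by (auto intro!: derivative_eq_intros) (simp add: divide_simps power2_eq_square power3_eq_cube, simp add: algebra_simps power4_eq_xxxx)
    thus "(G has_vector_derivative v * (1 - v) * exp (- (x * v))) (at v within {0..1})"
      by (simp add: has_real_derivative_iff_has_vector_derivative has_vector_derivative_at_within)
  qed auto
  also have "G 1 - G 0 = (1 + exp (-x)) / x\<^sup>2 - 2 * (1 - exp (-x)) / x ^ 3"
    using x by (simp add: G_def divide_simps power2_eq_square power3_eq_cube) (simp add: algebra_simps)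
  also have "\<dots> = (1 - exp (- x)) * (2 / x\<^sup>2 * (1 / (exp x - 1) + 1 / 2 - 1 / x))"
  proof -
    have "exp x > 1" using x by simp
    hence "exp x - 1 \<noteq> 0" by simp
    moreover have "exp x \<noteq> 0" by simp
    ultimately show ?thesis using x
      by (simp add: exp_minus divide_simps power2_eq_square power3_eq_cube) (simp add: algebra_simps)
  qed
  finally show ?thesis .
qed

text \<open>The substitution y = x^2 / (x^2 + a^2) maps the half line onto (0, 1) and gives the Beta
  integral at (s + 1) / 2 and (1 - s) / 2. These arguments add up to 1, so the reflection formula
  evaluates it.\<close>

lemma nn_integral_powr_over_quadratic:
  fixes s a :: real
  assumes s: "-1 < s" "s < 1" and a: "a > 0"
  shows "(\<integral>\<^sup>+x. ennreal (2 * x powr s / (x\<^sup>2 + a\<^sup>2)) * indicator {0<..} x \<partial>lborel)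
           = ennreal (a powr (s - 1) * (pi / cos (pi * s / 2)))"
proof -
  define g where "g = (\<lambda>x. x\<^sup>2 / (x\<^sup>2 + a\<^sup>2))"
  define g' where "g' = (\<lambda>x. 2 * x * a\<^sup>2 / (x\<^sup>2 + a\<^sup>2)\<^sup>2)"
  define h where "h = (\<lambda>t::real. t powr ((s + 1) / 2 - 1) * (1 - t) powr ((1 - s) / 2 - 1))"
  have pos: "x\<^sup>2 + a\<^sup>2 > 0" for x using a by (simp add: add_nonneg_pos)
  have deriv: "(g has_field_derivative g' x) (at x within {0<..})" if "x \<in> {0<..}" for x
    unfolding g_def g'_def using pos[of x]
    by (auto intro!: derivative_eq_intros) (simp add: divide_simps power2_eq_square, simp add: algebra_simps)
  have inj: "inj_on g {0<..}"
  proof (rule inj_onI)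
    fix x y assume "x \<in> {0<..}" "y \<in> {0<..}" "g x = g y"
    hence "x\<^sup>2 * (y\<^sup>2 + a\<^sup>2) = y\<^sup>2 * (x\<^sup>2 + a\<^sup>2)"
      using pos[of x] pos[of y] by (simp add: g_def frac_eq_eq)
    hence "x\<^sup>2 = y\<^sup>2" using a by (simp add: algebra_simps)
    thus "x = y" using \<open>x \<in> _\<close> \<open>y \<in> _\<close> by (simp add: power2_eq_iff_nonneg)
  qed
  have image: "g ` {0<..} = {0<..<1}"
  proof (intro equalityI subsetI)
    fix y assume "y \<in> g ` {0<..}"
    thus "y \<in> {0<..<1}" using a pos by (auto simp: g_def divide_simps)
  next
    fix y assume y: "y \<in> {0<..<(1::real)}"
    define x where "x = a * sqrt (y / (1 - y))"
    have "x\<^sup>2 = a\<^sup>2 * (y / (1 - y))" using y by (simp add: x_def power_mult_distrib)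
    hence "g x = y" using y a by (simp add: g_def divide_simps) (simp add: algebra_simps)
    moreover have "x > 0" using y a by (simp add: x_def)
    ultimately show "y \<in> g ` {0<..}" by force
  qed
  have B: "(h has_integral Beta ((s + 1) / 2) ((1 - s) / 2)) {0<..<1}"
    unfolding h_def has_integral_Icc_iff_Ioo[symmetric] using s by (intro has_integral_Beta_real) auto
  have "h absolutely_integrable_on {0<..<1}"
    using B by (intro nonnegative_absolutely_integrable_1) (auto simp: h_def)
  hence "h absolutely_integrable_on g ` {0<..} \<and> integral (g ` {0<..}) h = Beta ((s + 1) / 2) ((1 - s) / 2)"
    using B by (simp add: image integral_unique)
  hence *: "(\<lambda>x. \<bar>g' x\<bar> * h (g x)) absolutely_integrable_on {0<..} \<and>
      integral {0<..} (\<lambda>x. \<bar>g' x\<bar> * h (g x)) = Beta ((s + 1) / 2) ((1 - s) / 2)"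
    using has_absolute_integral_change_of_variables_1'[OF _ deriv inj] by simp
  hence "((\<lambda>x. \<bar>g' x\<bar> * h (g x)) has_integral Beta ((s + 1) / 2) ((1 - s) / 2)) {0<..}"
    by (metis has_integral_integral set_lebesgue_integral_eq_integral(1))
  hence "((\<lambda>x. a powr (s - 1) * (\<bar>g' x\<bar> * h (g x))) has_integral a powr (s - 1) * Beta ((s + 1) / 2) ((1 - s) / 2)) {0<..}"
    by (rule has_integral_mult_right)
  also have "?this \<longleftrightarrow> ((\<lambda>x. 2 * x powr s / (x\<^sup>2 + a\<^sup>2)) has_integral a powr (s - 1) * Beta ((s + 1) / 2) ((1 - s) / 2)) {0<..}"
  proof (rule has_integral_cong)
    fix x :: real assume x: "x \<in> {0<..}"
    define q where "q = x\<^sup>2 + a\<^sup>2"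
    have q: "q > 0" using pos by (simp add: q_def)
    have sq: "y\<^sup>2 = y powr 2" if "y > 0" for y :: real using that by simp
    have sq_powr: "(y\<^sup>2) powr p = y powr (2 * p)" if "y > 0" for y p :: real
      using that by (simp add: sq powr_powr del: powr_numeral)
    have e: "2 * ((s + 1) / 2 - 1) = s - 1" "2 * ((1 - s) / 2 - 1) = - s - 1" by (auto simp: field_simps)
    have g1: "1 - g x = a\<^sup>2 / q" using q by (simp add: g_def q_def[symmetric] divide_simps) (simp add: q_def)
    have "h (g x) = (x\<^sup>2 / q) powr ((s + 1) / 2 - 1) * (a\<^sup>2 / q) powr ((1 - s) / 2 - 1)"
      by (simp add: h_def g1) (simp add: g_def q_def)
    also have "(x\<^sup>2 / q) powr ((s + 1) / 2 - 1) = x powr (s - 1) / q powr ((s + 1) / 2 - 1)"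
      using x q by (subst powr_divide) (simp_all only: sq_powr greaterThan_iff e zero_le_power2 less_imp_le)
    also have "(a\<^sup>2 / q) powr ((1 - s) / 2 - 1) = a powr (- s - 1) / q powr ((1 - s) / 2 - 1)"
      using a q by (subst powr_divide) (simp_all only: sq_powr e zero_le_power2 less_imp_le)
    also have "x powr (s - 1) / q powr ((s + 1) / 2 - 1) * (a powr (- s - 1) / q powr ((1 - s) / 2 - 1))
        = x powr (s - 1) * a powr (- s - 1) / q powr ((s + 1) / 2 - 1 + ((1 - s) / 2 - 1))"
      by (simp add: powr_add)
    also have "(s + 1) / 2 - 1 + ((1 - s) / 2 - 1) = -1" by (simp add: field_simps)
    also have "x powr (s - 1) * a powr (- s - 1) / q powr (-1) = x powr (s - 1) * a powr (- s - 1) * q"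
      using q by (simp add: powr_minus divide_inverse)
    finally have "a powr (s - 1) * (\<bar>g' x\<bar> * h (g x)) = 
        (a powr (s - 1) * a powr (- s - 1) * a\<^sup>2) * (x powr (s - 1) * x) * 2 * q / q\<^sup>2"
      using x by (simp add: g'_def q_def mult_ac)
    also have "a powr (s - 1) * a powr (- s - 1) * a\<^sup>2 = 1"
      using a by (simp add: sq powr_add[symmetric] del: powr_numeral)
    also have "x powr (s - 1) * x = x powr s"
      using x by (simp add: powr_diff)
    also have "1 * x powr s * 2 * q / q\<^sup>2 = 2 * x powr s / q"
      using q by (simp add: power2_eq_square)
    finally show "a powr (s - 1) * (\<bar>g' x\<bar> * h (g x)) = 2 * x powr s / (x\<^sup>2 + a\<^sup>2)"
      by (simp add: q_def)
  qed
  also have "Beta ((s + 1) / 2) ((1 - s) / 2) = pi / cos (pi * s / 2)"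
  proof -
    have "Beta ((s + 1) / 2) ((1 - s) / 2) = Gamma ((s + 1) / 2) * Gamma (1 - (s + 1) / 2)"
      by (simp add: Beta_def field_simps)
    also have "complex_of_real \<dots> = of_real (pi / sin (pi * ((s + 1) / 2)))"
      using Gamma_reflection_complex[of "of_real ((s + 1) / 2)"]
      by (simp only: of_real_mult of_real_divide Gamma_complex_of_real[symmetric] of_real_diff of_real_1 sin_of_real[symmetric])
    finally have "Beta ((s + 1) / 2) ((1 - s) / 2) = pi / sin (pi * ((s + 1) / 2))" by (simp only: of_real_eq_iff)
    also have "sin (pi * ((s + 1) / 2)) = cos (pi * s / 2)"
    proof -
      have *: "pi * ((s + 1) / 2) = pi * s / 2 + pi / 2" by (simp add: field_simps)
      show ?thesis unfolding * sin_add by simp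
    qed
    finally show ?thesis .
  qed
  finally have "((\<lambda>x. 2 * x powr s / (x\<^sup>2 + a\<^sup>2)) has_integral a powr (s - 1) * (pi / cos (pi * s / 2))) {0<..}" .
  from nn_integral_has_integral_lebesgue'[OF _ this] show ?thesis by simp
qed

text \<open>The Gamma integral scaled by c. It turns the powers of v + n into Laplace integrals,
  after which the sum over n is geometric.\<close>

lemma nn_integral_powr_exp:
  fixes p c :: real
  assumes p: "p > 0" and c: "c > 0"
  shows "(\<integral>\<^sup>+x. ennreal (x powr (p - 1) * exp (- (c * x))) * indicator {0<..} x \<partial>lborel)
           = ennreal (Gamma p * c powr (- p))"
proof -
  have "ennreal (Gamma p) = (\<integral>\<^sup>+t. ennreal (indicator {0..} t * t powr (p - 1) / exp t) \<partial>lborel)"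
    by (rule Gamma_conv_nn_integral_real[OF p])
  also have "\<dots> = ennreal \<bar>c\<bar> * (\<integral>\<^sup>+x. ennreal (indicator {0..} (0 + c * x) * (0 + c * x) powr (p - 1) / exp (0 + c * x)) \<partial>lborel)"
    using c by (intro nn_integral_real_affine) auto
  also have "(\<integral>\<^sup>+x. ennreal (indicator {0..} (0 + c * x) * (0 + c * x) powr (p - 1) / exp (0 + c * x)) \<partial>lborel)
     = (\<integral>\<^sup>+x. ennreal (c powr (p - 1)) * (ennreal (x powr (p - 1) * exp (- (c * x))) * indicator {0<..} x) \<partial>lborel)"
  proof (rule nn_integral_cong)
    fix x :: real
    show "ennreal (indicator {0..} (0 + c * x) * (0 + c * x) powr (p - 1) / exp (0 + c * x)) =
       ennreal (c powr (p - 1)) * (ennreal (x powr (p - 1) * exp (- (c * x))) * indicator {0<..} x)"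
    proof (cases "x > 0")
      case True
      thus ?thesis using c
        by (simp add: powr_mult exp_minus field_simps ennreal_mult'[symmetric])
    next
      case False
      thus ?thesis using c by (auto simp: indicator_def zero_le_mult_iff)
    qed
  qed
  also have "\<dots> = ennreal (c powr (p - 1)) * (\<integral>\<^sup>+x. ennreal (x powr (p - 1) * exp (- (c * x))) * indicator {0<..} x \<partial>lborel)"
    (is "_ = _ * ?I")
    by (rule nn_integral_cmult) auto
  also have "ennreal \<bar>c\<bar> * (ennreal (c powr (p - 1)) * ?I) = ennreal (c powr p) * ?I"
    using c by (simp add: mult.assoc[symmetric] ennreal_mult'[symmetric] powr_diff)
  finally have "ennreal (c powr (-p)) * ennreal (Gamma p) = ennreal (c powr (-p)) * ennreal (c powr p) * ?I"
    by (simp add: mult.assoc)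
  also have "ennreal (c powr (-p)) * ennreal (c powr p) = 1"
    using c by (simp add: ennreal_mult'[symmetric] powr_add[symmetric])
  finally show ?thesis by (subst ennreal_mult'') (simp_all add: mult.commute)
qed

section \<open>The functional equation on the real interval (-1, 0)\<close>

definition trapezoid_weight :: "nat \<Rightarrow> real \<Rightarrow> real" where
  "trapezoid_weight n s = integral {0..1} (\<lambda>v. v * (1 - v) * (v + real n) powr (- s - 2))"

lemma trapezoid_weight_Suc_has_integral:
  "((\<lambda>v. v * (1 - v) * (v + real (Suc n)) powr (- s - 2)) has_integral trapezoid_weight (Suc n) s) {0..1}"
proof -
  have "continuous_on {0..1} (\<lambda>v. v * (1 - v) * (v + real (Suc n)) powr (- s - 2))"
    by (intro continuous_intros) auto
  from integrable_integral[OF integrable_continuous_interval[OF this]] show ?thesis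
    by (simp only: trapezoid_weight_def)
qed

lemma trapezoid_error_of_real:
  fixes s :: real
  assumes "s < 1"
  shows "trapezoid_error (real (Suc n)) (of_real s) = of_real (s * (s + 1) / 2 * trapezoid_weight (Suc n) s)"
proof -
  have "((\<lambda>v. complex_of_real (s * (s + 1) / 2 * (v * (1 - v) * (v + real (Suc n)) powr (- s - 2)))) has_integral 
      of_real (s * (s + 1) / 2 * trapezoid_weight (Suc n) s)) {0..1}"
    by (intro has_integral_of_real has_integral_mult_right trapezoid_weight_Suc_has_integral)
  moreover have "((\<lambda>v. complex_of_real (s * (s + 1) / 2 * (v * (1 - v) * (v + real (Suc n)) powr (- s - 2)))) has_integral 
      trapezoid_error (real (Suc n)) (of_real s)) {0..1}"
  proof (rule has_integral_eq[OF _ trapezoid_error_has_integral])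
    fix v :: real assume v: "v \<in> {0..1}"
    have "complex_of_real (v + real (Suc n)) powr (- of_real s - 2) = of_real ((v + real (Suc n)) powr (- s - 2))"
      using v powr_of_real[of "v + real (Suc n)" "-s-2"] by simp
    thus "of_real s * (of_real s + 1) / 2 * complex_of_real (v * (1 - v)) * of_real (v + real (Suc n)) powr (- of_real s - 2) =
         complex_of_real (s * (s + 1) / 2 * (v * (1 - v) * (v + real (Suc n)) powr (- s - 2)))"
      by simp
  qed (use assms in auto)
  ultimately show ?thesis by (rule has_integral_unique[rotated])
qed

text \<open>The integral is \<open>Beta (- s) 2\<close>; s < 0 makes it converge at 0. Multiplied by
  s (s + 1) / 2 it equals 1 / (s - 1) + 1 / 2, so including the interval [0, 1] absorbs the two
  elementary terms of \<open>zeta_right\<close>.\<close>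

lemma trapezoid_weight_0_has_integral:
  assumes "s < 0"
  shows "((\<lambda>v. v * (1 - v) * (v + real 0) powr (- s - 2)) has_integral trapezoid_weight 0 s) {0..1}"
    and "trapezoid_weight 0 s = 1 / ((- s) * (1 - s))"
proof -
  have "((\<lambda>v. v powr (- s - 1) * (1 - v) powr (2 - 1)) has_integral Beta (- s) 2) {0..1}"
    using assms by (intro has_integral_Beta_real) auto
  also have "?this \<longleftrightarrow> ((\<lambda>v. v * (1 - v) * (v + real 0) powr (- s - 2)) has_integral Beta (- s) 2) {0..1}"
  proof (rule has_integral_cong)
    fix v :: real assume v: "v \<in> {0..1}"
    have "v powr (- s - 1) = v * v powr (- s - 2)"
    proof (cases "v = 0")
      case False
      hence "v powr (1 + (-s-2)) = v * v powr (- s - 2)" using v by (subst powr_add) auto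
      moreover have "1 + (-s-2) = - s - 1" by simp
      ultimately show ?thesis by simp
    qed auto
    thus "v powr (- s - 1) * (1 - v) powr (2 - 1) = v * (1 - v) * (v + real 0) powr (- s - 2)"
      using v by simp
  qed
  finally have *: "((\<lambda>v. v * (1 - v) * (v + real 0) powr (- s - 2)) has_integral Beta (- s) 2) {0..1}" .
  have w: "trapezoid_weight 0 s = Beta (- s) 2"
    using integral_unique[OF *] by (simp only: trapezoid_weight_def)
  show "((\<lambda>v. v * (1 - v) * (v + real 0) powr (- s - 2)) has_integral trapezoid_weight 0 s) {0..1}"
    using * w by simp
  have G: "Gamma (-s) > 0" using assms by (intro Gamma_real_pos) auto
  have G2: "Gamma (2 - s) = (1 - s) * ((- s) * Gamma (- s))"
    using Gamma_plus1[of "1 - s"] Gamma_plus1[of "-s"] assms 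
    by (simp add: nonpos_Ints_def)
  have "Gamma (2 :: real) = 1" using Gamma_numeral[of "num.Bit0 num.One", where ?'a = real] by (simp add: fact_reduce)
  thus "trapezoid_weight 0 s = 1 / ((- s) * (1 - s))"
    using G G2 by (simp add: w Beta_def)
qed

lemma trapezoid_weight_has_integral:
  assumes "s < 0"
  shows "((\<lambda>v. v * (1 - v) * (v + real n) powr (- s - 2)) has_integral trapezoid_weight n s) {0..1}"
  using trapezoid_weight_0_has_integral(1)[OF assms] trapezoid_weight_Suc_has_integral
  by (cases n) blast+

lemma trapezoid_weight_nonneg: "s < 0 \<Longrightarrow> trapezoid_weight n s \<ge> 0"
  by (rule has_integral_nonneg[OF trapezoid_weight_has_integral]) auto

text \<open>In \<open>ennreal\<close> every exchange is an instance of Tonelli's theorem and asks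
  for no convergence. For fixed x, the sum over n and the integral over v give 2 x powr (s - 1)
  times the coth expression, whose partial fractions are then integrated term by term.
  \<open>Gamma (s + 2)\<close> comes from the Gamma integral, the cosine from the Beta
  integral.\<close>

lemma suminf_trapezoid_weight:
  fixes s :: real
  assumes s: "-1 < s" "s < 0"
  shows "(\<Sum>n. ennreal (Gamma (s + 2) * trapezoid_weight n s)) =
         (\<Sum>m. ennreal (2 * ((2 * pi * real (Suc m)) powr (s - 1) * (pi / cos (pi * s / 2)))))"
proof -
  define q where "q = (\<lambda>v::real. v * (1 - v))"
  \<comment> \<open>The end point 0 is left out so that v + n > 0 also for n = 0.\<close>
  define S where "S = {0<..<(1::real)}"
  have q: "q v \<ge> 0" if "v \<in> S" for v using that by (auto simp: q_def S_def)
  have [measurable]: "S \<in> sets borel" by (simp add: S_def)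
  have Gpos: "Gamma (s + 2) > 0" using s by (intro Gamma_real_pos) auto
  have "(\<Sum>n. ennreal (Gamma (s + 2) * trapezoid_weight n s)) = 
      (\<Sum>n. \<integral>\<^sup>+v. (\<integral>\<^sup>+x. ennreal (q v * (x powr (s + 1) * exp (- ((v + real n) * x)))) * indicator {0<..} x * indicator S v \<partial>lborel) \<partial>lborel)"
  proof (rule suminf_cong)
    fix n
    have "((\<lambda>v. Gamma (s + 2) * (v * (1 - v) * (v + real n) powr (- s - 2))) has_integral Gamma (s + 2) * trapezoid_weight n s) {0<..<1}"
      using has_integral_mult_right[OF trapezoid_weight_has_integral[OF s(2), of n], of "Gamma (s + 2)"]
      by (simp add: has_integral_Icc_iff_Ioo)
    hence "ennreal (Gamma (s + 2) * trapezoid_weight n s) =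
        (\<integral>\<^sup>+v. ennreal (Gamma (s + 2) * (v * (1 - v) * (v + real n) powr (- s - 2))) * indicator S v \<partial>lborel)"
      unfolding S_def using Gpos by (intro nn_integral_has_integral_lebesgue'[symmetric]) auto
    also have "\<dots> = (\<integral>\<^sup>+v. (\<integral>\<^sup>+x. ennreal (q v * (x powr (s + 1) * exp (- ((v + real n) * x)))) * indicator {0<..} x * indicator S v \<partial>lborel) \<partial>lborel)"
    proof (rule nn_integral_cong)
      fix v :: real
      show "ennreal (Gamma (s + 2) * (v * (1 - v) * (v + real n) powr (- s - 2))) * indicator S v =
         (\<integral>\<^sup>+x. ennreal (q v * (x powr (s + 1) * exp (- ((v + real n) * x)))) * indicator {0<..} x * indicator S v \<partial>lborel)"
      proof (cases "v \<in> S")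
        case True
        hence vn: "v + real n > 0" by (auto simp: S_def)
        have "(\<integral>\<^sup>+x. ennreal (q v * (x powr (s + 1) * exp (- ((v + real n) * x)))) * indicator {0<..} x * indicator S v \<partial>lborel)
          = (\<integral>\<^sup>+x. ennreal (q v) * (ennreal (x powr (s + 2 - 1) * exp (- ((v + real n) * x))) * indicator {0<..} x) \<partial>lborel)"
          using True q[OF True] by (intro nn_integral_cong) (simp add: ennreal_mult' mult.assoc add.commute)
        also have "\<dots> = ennreal (q v) * ennreal (Gamma (s + 2) * (v + real n) powr (- (s + 2)))"
        proof -
          have "s + 2 > 0" using s by simp
          show ?thesis
            by (subst nn_integral_cmult, measurable, subst nn_integral_powr_exp[OF \<open>s + 2 > 0\<close> vn], rule refl)
        qed
        also have "\<dots> = ennreal (Gamma (s + 2) * (v * (1 - v) * (v + real n) powr (- s - 2)))"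
          using q[OF True] by (simp add: ennreal_mult'[symmetric] q_def mult_ac)
        finally show ?thesis using True by simp
      qed auto
    qed
    finally show "ennreal (Gamma (s + 2) * trapezoid_weight n s) = 
      (\<integral>\<^sup>+v. (\<integral>\<^sup>+x. ennreal (q v * (x powr (s + 1) * exp (- ((v + real n) * x)))) * indicator {0<..} x * indicator S v \<partial>lborel) \<partial>lborel)" .
  qed
  also have "\<dots> = (\<Sum>n. \<integral>\<^sup>+x. (\<integral>\<^sup>+v. ennreal (q v * (x powr (s + 1) * exp (- ((v + real n) * x)))) * indicator {0<..} x * indicator S v \<partial>lborel) \<partial>lborel)"
    unfolding q_def by (intro suminf_cong lborel_pair.Fubini'[symmetric]) measurable
  also have "\<dots> = (\<integral>\<^sup>+x. (\<Sum>n. \<integral>\<^sup>+v. ennreal (q v * (x powr (s + 1) * exp (- ((v + real n) * x)))) * indicator {0<..} x * indicator S v \<partial>lborel) \<partial>lborel)"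
    unfolding q_def by (rule nn_integral_suminf[symmetric]) measurable
  also have "\<dots> = (\<integral>\<^sup>+x. (\<Sum>m. ennreal 2 * (ennreal (2 * x powr s / (x\<^sup>2 + (2 * pi * real (Suc m))\<^sup>2)) * indicator {0<..} x)) \<partial>lborel)"
  proof (rule nn_integral_cong)
    fix x :: real
    show "(\<Sum>n. \<integral>\<^sup>+v. ennreal (q v * (x powr (s + 1) * exp (- ((v + real n) * x)))) * indicator {0<..} x * indicator S v \<partial>lborel)
        = (\<Sum>m. ennreal 2 * (ennreal (2 * x powr s / (x\<^sup>2 + (2 * pi * real (Suc m))\<^sup>2)) * indicator {0<..} x))"
    proof (cases "x > 0")
      case x: True
      define K where "K = 2 / x\<^sup>2 * (1 / (exp x - 1) + 1 / 2 - 1 / x)"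
      have L: "(\<integral>\<^sup>+v. ennreal (q v * (x powr (s + 1) * exp (- ((v + real n) * x)))) * indicator {0<..} x * indicator S v \<partial>lborel)
          = ennreal (x powr (s + 1) * ((1 - exp (-x)) * K) * exp (-x) ^ n)" for n
      proof -
        have "((\<lambda>v. v * (1 - v) * exp (- (x * v))) has_integral (1 - exp (-x)) * K) {0<..<1}"
          using quadratic_laplace_has_integral[OF x] unfolding K_def by (simp add: has_integral_Icc_iff_Ioo)
        from has_integral_mult_right[OF this, of "x powr (s + 1) * exp (-x) ^ n"]
        have "((\<lambda>v. x powr (s + 1) * exp (-x) ^ n * (v * (1 - v) * exp (- (x * v)))) has_integral
               x powr (s + 1) * exp (-x) ^ n * ((1 - exp (-x)) * K)) S" unfolding S_def .
        from nn_integral_has_integral_lebesgue'[OF _ this]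
        have "ennreal (x powr (s + 1) * exp (-x) ^ n * ((1 - exp (-x)) * K))
            = (\<integral>\<^sup>+v. ennreal (x powr (s + 1) * exp (-x) ^ n * (v * (1 - v) * exp (- (x * v)))) * indicator S v \<partial>lborel)"
          by (auto simp: S_def)
        also have "\<dots> = (\<integral>\<^sup>+v. ennreal (q v * (x powr (s + 1) * exp (- ((v + real n) * x)))) * indicator {0<..} x * indicator S v \<partial>lborel)"
        proof (rule nn_integral_cong)
          fix v :: real
          have "exp (- ((v + real n) * x)) = exp (-x) ^ n * exp (- (x * v))"
            by (simp add: exp_of_nat_mult[symmetric] exp_add[symmetric] algebra_simps)
          thus "ennreal (x powr (s + 1) * exp (-x) ^ n * (v * (1 - v) * exp (- (x * v)))) * indicator S v =
            ennreal (q v * (x powr (s + 1) * exp (- ((v + real n) * x)))) * indicator {0<..} x * indicator S v"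
            using x by (simp add: q_def mult_ac)
        qed
        finally show ?thesis by (simp add: mult_ac)
      qed
      have C: "(\<lambda>k. 2 * x / (x\<^sup>2 + (2 * pi * real (Suc k))\<^sup>2)) sums (1 / (exp x - 1) + 1 / 2 - 1 / x)"
        by (rule coth_partial_fractions[OF x])
      have "1 / (exp x - 1) + 1 / 2 - 1 / x \<ge> 0"
        using x by (intro sums_le[OF _ sums_zero C]) auto
      hence K: "K \<ge> 0" unfolding K_def by (intro mult_nonneg_nonneg) auto
      have e: "exp (-x) < 1" using x by simp
      have "(\<lambda>n. x powr (s + 1) * ((1 - exp (-x)) * K) * exp (-x) ^ n) sums
              (x powr (s + 1) * ((1 - exp (-x)) * K) * (1 / (1 - exp (-x))))"
        using e by (intro sums_mult geometric_sums) auto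
      also have "x powr (s + 1) * ((1 - exp (-x)) * K) * (1 / (1 - exp (-x))) = x powr (s + 1) * K"
        using e by simp
      finally have 1: "(\<Sum>n. ennreal (x powr (s + 1) * ((1 - exp (-x)) * K) * exp (-x) ^ n)) = ennreal (x powr (s + 1) * K)"
        using e K by (intro suminf_ennreal_eq) auto
      have "(\<lambda>k. x powr (s + 1) * (2 / x\<^sup>2) * (2 * x / (x\<^sup>2 + (2 * pi * real (Suc k))\<^sup>2))) sums (x powr (s + 1) * (2 / x\<^sup>2) * (1 / (exp x - 1) + 1 / 2 - 1 / x))"
        by (intro sums_mult C)
      also have "x powr (s + 1) * (2 / x\<^sup>2) * (1 / (exp x - 1) + 1 / 2 - 1 / x) = x powr (s + 1) * K"
        by (simp add: K_def)
      also have "(\<lambda>k. x powr (s + 1) * (2 / x\<^sup>2) * (2 * x / (x\<^sup>2 + (2 * pi * real (Suc k))\<^sup>2))) =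
          (\<lambda>k. 2 * (2 * x powr s / (x\<^sup>2 + (2 * pi * real (Suc k))\<^sup>2)))"
      proof
        fix k
        have xs: "x powr (s + 1) = x powr s * x" using x by (simp add: powr_add)
        show "x powr (s + 1) * (2 / x\<^sup>2) * (2 * x / (x\<^sup>2 + (2 * pi * real (Suc k))\<^sup>2)) =
            2 * (2 * x powr s / (x\<^sup>2 + (2 * pi * real (Suc k))\<^sup>2))"
          unfolding xs using x by (simp add: power2_eq_square)
      qed
      finally have 2: "(\<Sum>k. ennreal (2 * (2 * x powr s / (x\<^sup>2 + (2 * pi * real (Suc k))\<^sup>2)))) = ennreal (x powr (s + 1) * K)"
        using x by (intro suminf_ennreal_eq) auto
      show ?thesis unfolding L 1 2[symmetric] using x by (intro suminf_cong, subst ennreal_mult') simp_all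
    qed auto
  qed
  also have "\<dots> = (\<Sum>m. \<integral>\<^sup>+x. ennreal 2 * (ennreal (2 * x powr s / (x\<^sup>2 + (2 * pi * real (Suc m))\<^sup>2)) * indicator {0<..} x) \<partial>lborel)"
    by (rule nn_integral_suminf) measurable
  also have "\<dots> = (\<Sum>m. ennreal (2 * ((2 * pi * real (Suc m)) powr (s - 1) * (pi / cos (pi * s / 2)))))"
  proof (rule suminf_cong)
    fix m
    have "(\<integral>\<^sup>+x. ennreal 2 * (ennreal (2 * x powr s / (x\<^sup>2 + (2 * pi * real (Suc m))\<^sup>2)) * indicator {0<..} x) \<partial>lborel)
      = ennreal 2 * (\<integral>\<^sup>+x. ennreal (2 * x powr s / (x\<^sup>2 + (2 * pi * real (Suc m))\<^sup>2)) * indicator {0<..} x \<partial>lborel)"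
      by (rule nn_integral_cmult) measurable
    also have "\<dots> = ennreal 2 * ennreal ((2 * pi * real (Suc m)) powr (s - 1) * (pi / cos (pi * s / 2)))"
      using s by (subst nn_integral_powr_over_quadratic) (auto simp del: of_nat_Suc)
    finally show "(\<integral>\<^sup>+x. ennreal 2 * (ennreal (2 * x powr s / (x\<^sup>2 + (2 * pi * real (Suc m))\<^sup>2)) * indicator {0<..} x) \<partial>lborel)
       = ennreal (2 * ((2 * pi * real (Suc m)) powr (s - 1) * (pi / cos (pi * s / 2))))"
      by (subst ennreal_mult') simp_all
  qed
  finally show ?thesis .
qed

definition zeta_reflected :: "complex \<Rightarrow> complex" where
  "zeta_reflected s = (2 * of_real pi) powr s * zeta_right (1 - s) * Gamma (1 - s) * sin (of_real pi * s / 2) / of_real pi"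

lemma zeta_right_of_real:
  fixes s :: real
  assumes s: "-1 < s" "s < 0"
  shows "summable (\<lambda>n. trapezoid_weight n s)"
    and "zeta_right (of_real s) = of_real (s * (s + 1) / 2 * (\<Sum>n. trapezoid_weight n s))"
proof -
  have nz: "s * (s + 1) / 2 \<noteq> 0" using s by simp
  have "summable (\<lambda>n. trapezoid_error (real (Suc n)) (of_real s))"
    using summable_norm_cancel[OF summable_norm_trapezoid_error[of "of_real s"]] s by auto
  hence "summable (\<lambda>n. s * (s + 1) / 2 * trapezoid_weight (Suc n) s)"
    using s by (simp only: trapezoid_error_of_real summable_complex_of_real)
  hence sm': "summable (\<lambda>n. trapezoid_weight (Suc n) s)"
    using nz by (simp only: summable_cmult_iff) auto
  thus sm: "summable (\<lambda>n. trapezoid_weight n s)" by (subst (asm) summable_Suc_iff)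
  have "zeta_right (of_real s) = 1 / (of_real s - 1) + 1 / 2 + (\<Sum>n. of_real (s * (s + 1) / 2 * trapezoid_weight (Suc n) s))"
    unfolding zeta_right_def using s by (simp only: trapezoid_error_of_real)
  also have "(\<Sum>n. complex_of_real (s * (s + 1) / 2 * trapezoid_weight (Suc n) s)) =
      of_real (s * (s + 1) / 2 * (\<Sum>n. trapezoid_weight (Suc n) s))"
    using sm' by (subst suminf_of_real[symmetric]) (simp_all only: suminf_mult summable_mult)
  also have "(\<Sum>n. trapezoid_weight (Suc n) s) = (\<Sum>n. trapezoid_weight n s) - trapezoid_weight 0 s"
    using suminf_split_head[OF sm] .
  also have "1 / (of_real s - 1) + 1 / 2 + complex_of_real (s * (s + 1) / 2 * ((\<Sum>n. trapezoid_weight n s) - trapezoid_weight 0 s))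
      = of_real (1 / (s - 1) + 1 / 2 + s * (s + 1) / 2 * ((\<Sum>n. trapezoid_weight n s) - trapezoid_weight 0 s))"
    by simp
  also have "1 / (s - 1) + 1 / 2 + s * (s + 1) / 2 * ((\<Sum>n. trapezoid_weight n s) - trapezoid_weight 0 s)
      = s * (s + 1) / 2 * (\<Sum>n. trapezoid_weight n s)"
    unfolding trapezoid_weight_0_has_integral(2)[OF s(2)] using s by (simp add: divide_simps) (simp add: algebra_simps)
  finally show "zeta_right (of_real s) = of_real (s * (s + 1) / 2 * (\<Sum>n. trapezoid_weight n s))" .
qed

text \<open>As 1 - s > 1, the sum Z over m is the Dirichlet series of \<zeta> (1 - s). Dividing by 2
  Gamma s turns \<open>Gamma (s + 2)\<close> into s (s + 1) / 2 and leaves \<zeta> (s) on the left.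
  On the right, the reflection formula and the double angle formula for sin (pi s) trade the
  reciprocal of Gamma s cos (pi s / 2) for Gamma (1 - s) sin (pi s / 2).\<close>

lemma zeta_right_eq_reflected_real:
  fixes s :: real
  assumes s: "-1 < s" "s < 0"
  shows "zeta_right (of_real s) = zeta_reflected (of_real s)"
proof -
  define W where "W = (\<Sum>n. trapezoid_weight n s)"
  define Z where "Z = (\<Sum>m. real (Suc m) powr (s - 1))"
  define c where "c = 2 * ((2 * pi) powr (s - 1) * (pi / cos (pi * s / 2)))"
  have cos_pos: "cos (pi * s / 2) > 0"
    using s mult_strict_left_mono[OF s(1) pi_gt_zero] by (intro cos_gt_zero_pi) (auto simp: mult_less_0_iff)
  have c: "c > 0" using cos_pos by (simp add: c_def)
  have Gpos: "Gamma (s + 2) > 0" using s by (intro Gamma_real_pos) auto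
  have sZ: "summable (\<lambda>m. real (Suc m) powr (s - 1))" using s by (intro summable_Suc_powr) auto
  have "ennreal (Gamma (s + 2) * W) = (\<Sum>n. ennreal (Gamma (s + 2) * trapezoid_weight n s))"
    unfolding W_def using Gpos trapezoid_weight_nonneg[OF s(2)] zeta_right_of_real(1)[OF s]
    by (subst suminf_ennreal2) (auto simp: suminf_mult intro!: summable_mult)
  also have "\<dots> = (\<Sum>m. ennreal (c * real (Suc m) powr (s - 1)))"
    unfolding suminf_trapezoid_weight[OF s] c_def by (simp add: powr_mult mult_ac del: of_nat_Suc)
  also have "\<dots> = ennreal (c * Z)"
    unfolding Z_def using c sZ by (subst suminf_ennreal2) (auto simp: suminf_mult simp del: of_nat_Suc intro!: summable_mult)
  finally have WZ: "Gamma (s + 2) * W = c * Z"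
    using Gpos c sZ zeta_right_of_real(1)[OF s] trapezoid_weight_nonneg[OF s(2)]
    by (subst (asm) ennreal_inj) (auto simp: W_def Z_def intro!: mult_nonneg_nonneg suminf_nonneg simp del: of_nat_Suc)
  have snz: "s \<notin> \<int>"
    using s by (auto elim!: Ints_cases)
  have G2: "Gamma (s + 2) = (s + 1) * (s * Gamma s)"
  proof -
    have "Gamma (s + 1 + 1) = (s + 1) * Gamma (s + 1)"
      using s by (intro Gamma_plus1) (auto dest: nonpos_Ints_nonpos)
    moreover have "Gamma (s + 1) = s * Gamma s"
      using snz nonpos_Ints_subset_Ints by (intro Gamma_plus1) blast
    moreover have "s + 2 = s + 1 + 1" by simp
    ultimately show ?thesis by (simp only:)
  qed
  have refl: "Gamma s * Gamma (1 - s) = pi / sin (pi * s)"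
  proof -
    have "complex_of_real (Gamma s * Gamma (1 - s)) = of_real (pi / sin (pi * s))"
      using Gamma_reflection_complex[of "of_real s"]
      by (simp only: of_real_mult of_real_divide Gamma_complex_of_real[symmetric] of_real_diff of_real_1 sin_of_real[symmetric])
    thus ?thesis by (simp only: of_real_eq_iff)
  qed
  have sin2: "sin (pi * s) = 2 * sin (pi * s / 2) * cos (pi * s / 2)"
    using sin_double[of "pi * s / 2"] by simp
  have sin_neg: "sin (pi * s / 2) < 0"
  proof -
    have "0 < - (pi * s / 2)" using s by (simp add: mult_less_0_iff)
    moreover have "- (pi * s / 2) < pi"
      using mult_strict_left_mono[OF s(1) pi_gt_zero] pi_gt_zero by linarith
    ultimately have "sin (- (pi * s / 2)) > 0" by (rule sin_gt_zero)
    thus ?thesis by simp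
  qed
  have Gs: "Gamma s \<noteq> 0" "Gamma s * Gamma (1 - s) \<noteq> 0"
    using G2 Gpos refl sin2 sin_neg cos_pos by auto
  have "s * (s + 1) / 2 * W = (2 * pi) powr s * Z * Gamma (1 - s) * sin (pi * s / 2) / pi"
  proof -
    have "s * (s + 1) / 2 * W = Gamma (s + 2) * W / (2 * Gamma s)" using Gs by (simp add: G2)
    also have "\<dots> = (2 * pi) powr (s - 1) * Z * (pi / (Gamma s * cos (pi * s / 2)))"
      unfolding WZ by (simp add: c_def mult_ac)
    also have "pi / (Gamma s * cos (pi * s / 2)) = 2 * Gamma (1 - s) * sin (pi * s / 2)"
      using refl sin_neg cos_pos Gs unfolding sin2 by (simp add: divide_simps) (simp add: mult_ac)
    also have "(2 * pi) powr (s - 1) = (2 * pi) powr s / (2 * pi)"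
      by (simp add: powr_diff)
    finally show ?thesis by simp
  qed
  moreover have "zeta_right (1 - of_real s) = of_real Z"
  proof -
    have "(\<lambda>n. 1 / of_nat (Suc n) powr (1 - of_real s)) sums zeta_right (1 - of_real s)"
      using s by (intro zeta_right_sums) auto
    also have "(\<lambda>n. 1 / complex_of_nat (Suc n) powr (1 - of_real s)) = (\<lambda>n. of_real (real (Suc n) powr (s - 1)))"
    proof
      fix n
      have "complex_of_nat (Suc n) powr (1 - of_real s) = of_real (real (Suc n) powr (1 - s))"
        using powr_of_real[of "real (Suc n)" "1 - s"] by (simp del: of_nat_Suc)
      thus "1 / complex_of_nat (Suc n) powr (1 - of_real s) = of_real (real (Suc n) powr (s - 1))"
        using powr_minus[of "real (Suc n)" "1 - s"] by (simp add: divide_inverse del: of_nat_Suc)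
    qed
    finally show ?thesis
      using sums_unique2 sums_of_real[OF summable_sums[OF sZ]] unfolding Z_def by blast
  qed
  moreover have "(2 * of_real pi :: complex) powr of_real s = of_real ((2 * pi) powr s)"
    using powr_of_real[of "2 * pi" s] by simp
  moreover have "Gamma (1 - complex_of_real s) = of_real (Gamma (1 - s))"
    using Gamma_complex_of_real[of "1 - s"] by simp
  moreover have "sin (of_real pi * complex_of_real s / 2) = of_real (sin (pi * s / 2))"
    using sin_of_real[of "pi * s / 2", where ?'a = complex] by simp
  ultimately show ?thesis
    unfolding zeta_right_of_real(2)[OF s] zeta_reflected_def W_def[symmetric] by (simp del: of_real_add of_real_mult of_real_divide add: of_real_mult[symmetric] of_real_divide[symmetric])
qed

section \<open>Continuation to the punctured plane and the functional equation\<close>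

text \<open>Re s < 1 keeps 1 - s off the poles of Gamma. At 0 the pole of
  \<open>zeta_right (1 - s)\<close> meets the zero of the sine; the formula evaluates to 0 there and
  not to the limit - 1 / 2.\<close>

lemma zeta_reflected_holomorphic: "zeta_reflected holomorphic_on {s. Re s < 1} - {0}"
proof -
  have "zeta_right \<circ> (\<lambda>s. 1 - s) holomorphic_on {s. Re s < 1} - {0}"
    by (rule holomorphic_on_compose_gen[OF _ zeta_right_holomorphic]) (auto intro!: holomorphic_intros)
  moreover have "1 - z \<notin> \<int>\<^sub>\<le>\<^sub>0" if "Re z < 1" for z
    using that by (auto elim!: nonpos_Ints_cases simp: complex_eq_iff)
  ultimately show ?thesis
    unfolding zeta_reflected_def o_def by (auto intro!: holomorphic_intros)
qed

lemma zeta_right_eq_reflected: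
  assumes "-1 < Re s" "Re s < 1" "s \<noteq> 0"
  shows "zeta_right s = zeta_reflected s"
proof -
  define A where "A = {s. -1 < Re s} \<inter> {s. Re s < 1}"
  have A: "open A" "convex A"
    unfolding A_def by (auto intro!: open_Int open_halfspace_Re_gt open_halfspace_Re_lt convex_Int convex_halfspace_Re_gt convex_halfspace_Re_lt)
  have "zeta_right s - zeta_reflected s = 0"
  proof (rule analytic_continuation[of "\<lambda>s. zeta_right s - zeta_reflected s" "A - {0}" "of_real ` {-1<..<0}" "of_real (-1/2)"])
    show "(\<lambda>s. zeta_right s - zeta_reflected s) holomorphic_on A - {0}"
      by (intro holomorphic_intros holomorphic_on_subset[OF zeta_right_holomorphic] 
            holomorphic_on_subset[OF zeta_reflected_holomorphic]) (auto simp: A_def)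
    show "connected (A - {0})"
      using A by (intro connected_open_delete convex_connected) auto
    have "(-1/2::real) islimpt {-1<..<0}"
      by (intro interior_limit_point) auto
    thus "complex_of_real (-1/2) islimpt of_real ` {-1<..<0}"
    proof (rule islimpt_isCont_image)
      show "eventually (\<lambda>y. complex_of_real y \<noteq> of_real (- 1 / 2)) (at (- 1 / 2))"
        unfolding of_real_eq_iff by (rule eventually_neq_at_within)
    qed (intro continuous_intros)
  qed (use A assms zeta_right_eq_reflected_real in \<open>auto simp: A_def\<close>)
  thus ?thesis by simp
qed

text \<open>The witness is glued from \<open>zeta_right\<close> and \<open>zeta_reflected\<close>,
  which agree on -1 < Re s < 0. Uniqueness is the identity theorem, starting from Re s > 1; the
  value at 1 is prescribed.\<close>

lemma riemann_zeta_works: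
  "riemann_zeta holomorphic_on - {1} \<and>
      (\<forall>s. Re s > 1 \<longrightarrow> (\<lambda>n. 1 / of_nat (Suc n) powr s) sums riemann_zeta s) \<and> riemann_zeta 1 = 0"
  (is "?P riemann_zeta")
proof -
  define Z where "Z = (\<lambda>s. if s \<in> {s. Re s > -1} - {1} then zeta_right s else if s = 1 then 0 else zeta_reflected s)"
  have "Z holomorphic_on ({s. Re s > -1} - {1}) \<union> {s. Re s < 0}"
  proof (rule holomorphic_on_Un)
    show "Z holomorphic_on {s. Re s > -1} - {1}"
      by (rule holomorphic_transform[OF zeta_right_holomorphic]) (simp add: Z_def)
    have "zeta_reflected holomorphic_on {s. Re s < 0}"
      by (rule holomorphic_on_subset[OF zeta_reflected_holomorphic]) auto
    thus "Z holomorphic_on {s. Re s < 0}"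
    proof (rule holomorphic_transform)
      fix s :: complex assume s: "s \<in> {s. Re s < 0}"
      hence "s \<noteq> 0" "s \<noteq> 1" by auto
      thus "zeta_reflected s = Z s"
        using s zeta_right_eq_reflected[of s] by (simp add: Z_def)
    qed
  qed (simp_all add: open_halfspace_Re_gt open_halfspace_Re_lt open_delete)
  moreover have "({s. Re s > -1} - {1}) \<union> {s. Re s < 0} = - {1::complex}"
    by (auto simp: not_less)
  ultimately have hol: "Z holomorphic_on - {1}" by simp
  have Z: "?P Z"
  proof (intro conjI allI impI hol)
    fix s :: complex assume s: "Re s > 1"
    hence "s \<noteq> 1" by auto
    hence "Z s = zeta_right s" using s by (simp add: Z_def)
    thus "(\<lambda>n. 1 / of_nat (Suc n) powr s) sums Z s"
      using zeta_right_sums[OF s] by simp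
  qed (simp add: Z_def)
  show ?thesis unfolding riemann_zeta_def
  proof (rule theI[of ?P Z, OF Z])
    fix Y assume Y: "?P Y"
    show "Y = Z"
    proof
      fix s
      show "Y s = Z s"
      proof (cases "s = 1")
        case False
        have "connected (- {1::complex})" by (rule connected_punctured_universe) simp
        moreover have "Y z = Z z" if "z \<in> {s. Re s > 1}" for z
        proof -
          have "Re z > 1" using that by simp
          thus ?thesis using Y Z sums_unique2 by metis
        qed
        moreover have "(2::complex) \<in> {s. Re s > 1}" by simp
        hence "{s::complex. Re s > 1} \<noteq> {}" by blast
        moreover have "{s. Re s > 1} \<subseteq> - {1::complex}" by auto
        moreover have "open (- {1::complex})" by (simp add: open_Compl)
        moreover have "Y holomorphic_on - {1}" "Z holomorphic_on - {1}" 
          by (rule conjunct1[OF Y]) (rule conjunct1[OF Z])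
        ultimately show ?thesis
          using analytic_continuation_open[of "{s. Re s > 1}" "- {1}" Y Z s] False open_halfspace_Re_gt[of 1] by simp
      qed (use Y Z in auto)
    qed
  qed
qed

lemma riemann_zeta_holomorphic: "riemann_zeta holomorphic_on - {1}"
  using riemann_zeta_works by blast

lemma riemann_zeta_sums: "Re s > 1 \<Longrightarrow> (\<lambda>n. 1 / of_nat (Suc n) powr s) sums riemann_zeta s"
  using riemann_zeta_works by blast

lemma riemann_zeta_eq_right:
  assumes "Re s > -1" "s \<noteq> 1"
  shows "riemann_zeta s = zeta_right s"
proof (rule analytic_continuation_open[of "{s. Re s > 1}" "{s. Re s > -1} - {1}" riemann_zeta zeta_right])
  show "connected ({s. Re s > -1} - {1::complex})"
    by (intro connected_open_delete convex_connected convex_halfspace_Re_gt open_halfspace_Re_gt) auto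
  show "riemann_zeta holomorphic_on {s. Re s > -1} - {1}"
    by (rule holomorphic_on_subset[OF riemann_zeta_holomorphic]) auto
  show "riemann_zeta z = zeta_right z" if "z \<in> {s. Re s > 1}" for z
    using that sums_unique2[OF riemann_zeta_sums zeta_right_sums] by simp
qed (use assms zeta_right_holomorphic in \<open>auto intro!: open_halfspace_Re_gt open_Diff exI[of _ 2]\<close>)

lemma riemann_zeta_0: "riemann_zeta 0 = - 1 / 2"
  using riemann_zeta_eq_right[of 0] zeta_right_0 by simp

theorem riemann_zeta_functional_equation:
  assumes "Re s < 1" "s \<noteq> 0"
  shows "riemann_zeta s = (2 * of_real pi) powr s * riemann_zeta (1 - s) * Gamma (1 - s)
           * sin (of_real pi * s / 2) / of_real pi"
proof -
  have "riemann_zeta s - zeta_reflected s = 0"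
  proof (rule analytic_continuation_open[of "{s. Re s > -1} \<inter> {s. Re s < 0}" "{s. Re s < 1} - {0}" 
        "\<lambda>s. riemann_zeta s - zeta_reflected s" "\<lambda>_. 0"])
    show "connected ({s. Re s < 1} - {0::complex})"
      by (intro connected_open_delete convex_connected convex_halfspace_Re_lt open_halfspace_Re_lt) auto
    show "(\<lambda>s. riemann_zeta s - zeta_reflected s) holomorphic_on {s. Re s < 1} - {0}"
      by (intro holomorphic_intros holomorphic_on_subset[OF riemann_zeta_holomorphic] zeta_reflected_holomorphic) auto
    have "of_real (-1/2) \<in> {s. Re s > -1} \<inter> {s. Re s < 0}" by auto
    thus "{s. Re s > -1} \<inter> {s. Re s < 0} \<noteq> {}" by blast
    show "riemann_zeta z - zeta_reflected z = 0" if "z \<in> {s. Re s > -1} \<inter> {s. Re s < 0}" for z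
    proof -
      have "-1 < Re z" "Re z < 1" "z \<noteq> 0" "z \<noteq> 1" using that by auto
      thus ?thesis using riemann_zeta_eq_right zeta_right_eq_reflected by simp
    qed
  qed (use assms in \<open>auto intro!: open_halfspace_Re_gt open_halfspace_Re_lt open_Diff\<close>)
  moreover have "riemann_zeta (1 - s) = zeta_right (1 - s)"
    using assms by (intro riemann_zeta_eq_right) auto
  ultimately show ?thesis by (simp add: zeta_reflected_def)
qed

text \<open>The zeros to the left of the critical line come from the sine factor and the zeros to the right.\<close>

lemma nontrivial_zeta_zero_reflect:
  assumes "nontrivial_zeta_zero s" "Re s < 1 / 2"
  shows "riemann_zeta (1 - s) = 0"
proof (rule ccontr)
  assume nz: "riemann_zeta (1 - s) \<noteq> 0"
  have s: "riemann_zeta s = 0" "\<And>k::nat. k \<ge> 1 \<Longrightarrow> s \<noteq> - 2 * of_nat k"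
    using assms by (auto simp: nontrivial_zeta_zero_def)
  have s0: "s \<noteq> 0" using s(1) riemann_zeta_0 by auto
  have "1 - s \<notin> \<int>\<^sub>\<le>\<^sub>0"
    using assms(2) by (auto elim!: nonpos_Ints_cases simp: complex_eq_iff)
  hence "Gamma (1 - s) \<noteq> 0" by (simp add: Gamma_eq_zero_iff)
  hence "sin (of_real pi * s / 2) = 0"
    using riemann_zeta_functional_equation[of s] s s0 nz assms(2) by auto
  then obtain k :: int where "of_real pi * s / 2 = of_real (of_int k * pi)"
    unfolding sin_eq_0 by auto
  \<comment> \<open>So s is an even integer, nonzero and below 1/2, that is, one of the trivial
    zeros.\<close>
  hence sk: "s = 2 * of_int k" by simp
  hence "k < 0" using assms(2) s0 by (cases "k = 0") auto
  hence "s = - 2 * of_nat (nat (-k))" "nat (-k) \<ge> 1" using sk by auto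
  thus False using s(2) by blast
qed

section \<open>The Dirichlet series of the von Mangoldt function\<close>

text \<open>Stated as an unordered sum over pairs, so that the pairs can be regrouped by the product
  of their indices.\<close>

lemma has_sum_product_abs:
  fixes f g :: "nat \<Rightarrow> complex"
  assumes f: "(f has_sum a) A" and g: "(g has_sum b) B"
    and nf: "(\<lambda>x. norm (f x)) summable_on A" and ng: "(\<lambda>x. norm (g x)) summable_on B"
  shows "((\<lambda>(x, y). f x * g y) has_sum (a * b)) (A \<times> B)"
proof (rule has_sum_SigmaI)
  show "((\<lambda>y. case (x, y) of (x, y) \<Rightarrow> f x * g y) has_sum f x * b) B" for x
    using has_sum_cmult_right[OF g] by simp
  show "((\<lambda>x. f x * b) has_sum a * b) A" by (rule has_sum_cmult_left[OF f])
  have "(\<lambda>(x, y). norm (f x) * norm (g y)) summable_on A \<times> B"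
  proof (rule summable_on_SigmaI)
    show "((\<lambda>y. case (x, y) of (x, y) \<Rightarrow> norm (f x) * norm (g y)) has_sum norm (f x) * infsum (\<lambda>y. norm (g y)) B) B" for x
      using has_sum_cmult_right[OF has_sum_infsum[OF ng]] by simp
    show "(\<lambda>x. norm (f x) * infsum (\<lambda>y. norm (g y)) B) summable_on A"
      using summable_on_cmult_left[OF nf] .
  qed auto
  hence "(\<lambda>p. norm (case p of (x, y) \<Rightarrow> f x * g y)) summable_on A \<times> B"
    by (simp add: case_prod_unfold norm_mult)
  thus "(\<lambda>(x, y). f x * g y) summable_on A \<times> B" by (rule abs_summable_summable)
qed

lemma norm_of_nat_powr: "n > 0 \<Longrightarrow> norm (of_nat n powr s) = real n powr Re s"
  using norm_powr_real_powr[of "of_nat n" s] by simp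

text \<open>Complex powers satisfy \<open>0 powr s = 0\<close>, so Dirichlet series may be indexed from \<open>0\<close>.\<close>

lemma norm_dirichlet_term_le:
  assumes "norm (a n) \<le> real n" and "Re s > 3"
  shows "norm (a n * of_nat n powr (-s)) \<le> real n powr (-2)"
proof (cases "n = 0")
  case False
  have "norm (a n * of_nat n powr (-s)) = norm (a n) * real n powr (- Re s)"
    using False by (simp add: norm_mult norm_of_nat_powr)
  also have "\<dots> \<le> real n powr 1 * real n powr (-3)"
    using assms False by (intro mult_mono powr_mono) auto
  also have "\<dots> = real n powr (-2)" unfolding powr_add[symmetric] by simp
  finally show ?thesis .
qed auto

lemma summable_norm_dirichlet:
  assumes "\<And>n. norm (a n) \<le> real n" and "Re s > 3"
  shows "summable (\<lambda>n. norm (a n * of_nat n powr (-s)))"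
proof (rule summable_comparison_test')
  show "summable (\<lambda>n. real n powr (-2))" by (simp add: summable_real_powr_iff)
  show "norm (norm (a n * of_nat n powr (-s))) \<le> real n powr (-2)" if "n \<ge> 0" for n
    using norm_dirichlet_term_le[of a n s] assms by simp
qed

text \<open>The crude coefficient bound costs one power of n. For Re s > 3 this leaves the majorant
  n^-2 on the whole half plane, so the radius of the discs in the differentiation theorem is
  arbitrary.\<close>

lemma dirichlet_series_has_derivative:
  fixes a :: "nat \<Rightarrow> complex"
  assumes a: "\<And>n. norm (a n) \<le> real n"
  obtains D D' where
    "\<And>s. Re s > 3 \<Longrightarrow> (\<lambda>n. a n * of_nat n powr (-s)) sums D s"
    "\<And>s. Re s > 3 \<Longrightarrow> (\<lambda>n. - of_real (ln (real n)) * (a n * of_nat n powr (-s))) sums D' s"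
    "\<And>s. Re s > 3 \<Longrightarrow> (D has_field_derivative D' s) (at s)"
proof -
  have "\<exists>D D'. \<forall>s \<in> {s. Re s > 3}. (\<lambda>n. a n * of_nat n powr (-s)) sums D s \<and>
       (\<lambda>n. - of_real (ln (real n)) * (a n * of_nat n powr (-s))) sums D' s \<and> (D has_field_derivative D' s) (at s)"
  proof (rule series_and_derivative_comparison_complex)
    show "open {s. Re s > 3}" by (rule open_halfspace_Re_gt)
    show "((\<lambda>s. a n * of_nat n powr (-s)) has_field_derivative - of_real (ln (real n)) * (a n * of_nat n powr (-s))) (at s)"
      for n s
    proof (cases "n = 0")
      case False
      hence "of_nat n powr w = exp (w * of_real (ln (real n)))" for w :: complex
        by (simp add: powr_def Ln_of_nat)
      thus ?thesis by (auto intro!: derivative_eq_intros)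
    qed auto
  next
    fix s :: complex assume "s \<in> {s. Re s > 3}"
    show "\<exists>d h. 0 < d \<and> summable h \<and> range h \<subseteq> \<real>\<^sub>\<ge>\<^sub>0 \<and>
      (\<forall>\<^sub>F n in sequentially. \<forall>y\<in>ball s d \<inter> {s. Re s > 3}. norm (a n * of_nat n powr (-y)) \<le> cmod (h n))"
    proof (rule exI[of _ 1], rule exI[of _ "\<lambda>n. of_real (real n powr (-2))"], intro conjI always_eventually allI ballI)
      show "summable (\<lambda>n. complex_of_real (real n powr (-2)))"
        by (simp only: summable_complex_of_real summable_real_powr_iff)
      show "range (\<lambda>n. complex_of_real (real n powr (-2))) \<subseteq> \<real>\<^sub>\<ge>\<^sub>0"
        by auto
      fix n y assume "y \<in> ball s 1 \<inter> {s. Re s > 3}"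
      thus "norm (a n * of_nat n powr (-y)) \<le> norm (complex_of_real (real n powr (-2)))"
        using norm_dirichlet_term_le[of a n y] a by simp
    qed simp
  qed
  thus ?thesis using that by auto
qed

lemma norm_mangoldt_le: "norm (mangoldt n :: complex) \<le> real n"
proof (cases "n = 0")
  case False
  hence "mangoldt n \<le> ln (real n)" by (intro mangoldt_le) auto
  also have "\<dots> \<le> real n" using ln_bound[of "real n"] False by simp
  finally show ?thesis by simp
qed auto

lemma riemann_zeta_dirichlet_sums:
  assumes "Re s > 1"
  shows "(\<lambda>n. 1 * of_nat n powr (-s)) sums riemann_zeta s"
proof -
  have "(\<lambda>n. of_nat (Suc n) powr (-s)) sums riemann_zeta s"
    using riemann_zeta_sums[OF assms] by (simp only: powr_minus divide_inverse mult_1)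
  from sums_Suc[OF this] show ?thesis by simp
qed

text \<open>The coefficient at index 0 is set to 0 because the general bound demands it there; as
  \<open>0 powr (- s)\<close> vanishes, the series of \<zeta> is unchanged.\<close>

lemma one_norm_le: "norm (if n = 0 then 0 else 1 :: complex) \<le> real n"
  by simp

text \<open>A far half plane suffices, since the resulting formula for \<open>\<zeta>' / \<zeta>\<close> is continued analytically.\<close>

lemma riemann_zeta_mangoldt:
  assumes s: "Re s > 3" and D: "(\<lambda>n. mangoldt n * of_nat n powr (-s)) sums D"
  shows "(\<lambda>n. of_real (ln (real n)) * of_nat n powr (-s)) sums (D * riemann_zeta s)"
proof -
  \<comment> \<open>Only for positive indices is \<open>(d, k) \<mapsto> (d * k, d)\<close> a
    bijection onto the pairs of a number and one of its divisors.\<close>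
  define N where "N = {1::nat..}"
  have restrict: "(f has_sum S) N" "(\<lambda>n. norm (f n)) summable_on N" 
    if "f sums S" "summable (\<lambda>n. norm (f n))" "f 0 = 0" for f :: "nat \<Rightarrow> complex" and S
  proof -
    have "(f has_sum S) UNIV" using norm_summable_imp_has_sum[OF that(2,1)] .
    also have "?this \<longleftrightarrow> (f has_sum S) N"
      by (rule has_sum_cong_neutral) (auto simp: N_def not_le that(3))
    finally show "(f has_sum S) N" .
    have "(\<lambda>n. norm (f n)) summable_on UNIV"
      using that(2) by (subst summable_on_UNIV_nonneg_real_iff) auto
    thus "(\<lambda>n. norm (f n)) summable_on N" by (rule summable_on_subset_banach) auto
  qed
  have s1: "summable (\<lambda>n. norm (mangoldt n * of_nat n powr (-s) :: complex))"
    by (rule summable_norm_dirichlet[OF norm_mangoldt_le s])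
  have "summable (\<lambda>n. norm ((if n = 0 then 0 else 1) * of_nat n powr (-s) :: complex))"
    by (rule summable_norm_dirichlet[OF one_norm_le s])
  also have "(\<lambda>n. norm ((if n = 0 then 0 else 1) * of_nat n powr (-s) :: complex)) = (\<lambda>n. norm (1 * of_nat n powr (-s) :: complex))"
    by auto
  finally have s2: "summable (\<lambda>n. norm (1 * of_nat n powr (-s) :: complex))" .
  have z: "(\<lambda>n. 1 * of_nat n powr (-s)) sums riemann_zeta s"
    using s by (intro riemann_zeta_dirichlet_sums) auto
  have "((\<lambda>(d, k). (mangoldt d * of_nat d powr (-s)) * (1 * of_nat k powr (-s))) has_sum (D * riemann_zeta s)) (N \<times> N)"
    by (rule has_sum_product_abs[OF restrict(1)[OF D s1] restrict(1)[OF z s2] restrict(2)[OF D s1] restrict(2)[OF z s2]]) auto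
  \<comment> \<open>Collecting the pairs by their product n leaves the sum of
    \<open>mangoldt\<close> over the divisors of n, which is ln n.\<close>
  also have "?this \<longleftrightarrow> ((\<lambda>(n, d). mangoldt d * of_nat n powr (-s)) has_sum (D * riemann_zeta s)) (SIGMA n:N. {d. d dvd n})"
  proof (rule has_sum_reindex_bij_witness[where i = "\<lambda>(n, d). (d, n div d)" and j = "\<lambda>(d, k). (d * k, d)"])
    fix p assume "p \<in> N \<times> N"
    then obtain d k where p: "p = (d, k)" "d \<ge> 1" "k \<ge> 1" by (auto simp: N_def)
    have "(complex_of_nat d * of_nat k) powr (-s) = of_nat d powr (-s) * of_nat k powr (-s)"
      using powr_times_real[of "of_nat d" "of_nat k" "-s"] by simp
    thus "(case case p of (d, k) \<Rightarrow> (d * k, d) of (n, d) \<Rightarrow> mangoldt d * complex_of_nat n powr (-s)) =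
         (case p of (d, k) \<Rightarrow> (mangoldt d * of_nat d powr (-s)) * (1 * of_nat k powr (-s)))"
      by (simp add: p)
  qed (auto simp: N_def Suc_le_eq dest: dvd_pos_nat intro: Nat.gr0I elim!: dvdE)
  finally have "((\<lambda>n. of_real (ln (real n)) * of_nat n powr (-s)) has_sum (D * riemann_zeta s)) N"
  proof (rule has_sum_SigmaD)
    fix n assume n: "n \<in> N"
    hence n0: "n \<noteq> 0" by (auto simp: N_def)
    have "(\<Sum>d | d dvd n. mangoldt d * of_nat n powr (-s)) = of_real (ln (real n)) * complex_of_nat n powr (-s)"
      unfolding sum_distrib_right[symmetric] mangoldt_sum[OF n0] ..
    thus "((\<lambda>d. case (n, d) of (n, d) \<Rightarrow> mangoldt d * of_nat n powr (-s)) has_sum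
            of_real (ln (real n)) * complex_of_nat n powr (-s)) {d. d dvd n}"
      using n0 by (intro has_sum_finiteI) auto
  qed
  also have "?this \<longleftrightarrow> ((\<lambda>n. of_real (ln (real n)) * of_nat n powr (-s)) has_sum (D * riemann_zeta s)) UNIV"
    by (rule has_sum_cong_neutral) (auto simp: N_def not_le)
  finally show ?thesis by (rule has_sum_imp_sums)
qed

text \<open>Termwise differentiation of \<zeta> gives the series of - ln n n^-s, which is minus the
  product of D and \<zeta>. The product form spares a proof that \<zeta> has no zeros in this half
  plane. D' is obtained as well, since the Laplace transform brings in the factors ln n.\<close>

lemma mangoldt_dirichlet_series:
  obtains D D' where
    "\<And>s. Re s > 3 \<Longrightarrow> (\<lambda>n. mangoldt n * of_nat n powr (-s)) sums D s"
    "\<And>s. Re s > 3 \<Longrightarrow> (\<lambda>n. - of_real (ln (real n)) * (mangoldt n * of_nat n powr (-s))) sums D' s"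
    "\<And>s. Re s > 3 \<Longrightarrow> (D has_field_derivative D' s) (at s)"
    "\<And>s. Re s > 3 \<Longrightarrow> deriv riemann_zeta s = - D s * riemann_zeta s"
proof -
  obtain D D' where D: 
    "\<And>s. Re s > 3 \<Longrightarrow> (\<lambda>n. mangoldt n * of_nat n powr (-s)) sums D s"
    "\<And>s. Re s > 3 \<Longrightarrow> (\<lambda>n. - of_real (ln (real n)) * (mangoldt n * of_nat n powr (-s))) sums D' s"
    "\<And>s. Re s > 3 \<Longrightarrow> (D has_field_derivative D' s) (at s)"
    using dirichlet_series_has_derivative[OF norm_mangoldt_le] by blast
  obtain Z Z' where Z:
    "\<And>s. Re s > 3 \<Longrightarrow> (\<lambda>n. (if n = 0 then 0 else 1) * of_nat n powr (-s)) sums Z s"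
    "\<And>s. Re s > 3 \<Longrightarrow> (\<lambda>n. - of_real (ln (real n)) * ((if n = 0 then 0 else 1) * of_nat n powr (-s))) sums Z' s"
    "\<And>s. Re s > 3 \<Longrightarrow> (Z has_field_derivative Z' s) (at s)"
    using dirichlet_series_has_derivative[OF one_norm_le] by blast
  have one: "(if n = 0 then 0 else 1) * of_nat n powr w = of_nat n powr (w::complex)" for n w by auto
  have Z_eq: "riemann_zeta s = Z s" if "Re s > 3" for s
    using Z(1)[OF that] riemann_zeta_dirichlet_sums[of s] that unfolding one mult_1 by (auto intro: sums_unique2)
  have "deriv riemann_zeta s = - D s * riemann_zeta s" if s: "Re s > 3" for s
  proof -
    have "deriv riemann_zeta s = Z' s"
    proof (rule DERIV_imp_deriv)
      show "(riemann_zeta has_field_derivative Z' s) (at s)"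
        by (rule has_field_derivative_transform_within_open[OF Z(3)[OF s] open_halfspace_Re_gt[of 3]])
           (use s Z_eq in auto)
    qed
    also have "Z' s = - (D s * riemann_zeta s)"
      using sums_unique2[OF Z(2)[OF s, unfolded one mult_minus_left] sums_minus[OF riemann_zeta_mangoldt[OF s D(1)[OF s]]]]
      by simp
    finally show ?thesis by simp
  qed
  thus ?thesis using that[of D D'] D by blast
qed

section \<open>The Laplace transform of the truncated sums\<close>

text \<open>The weight \<open>sin (t * ln y) / (sqrt y * ln y)\<close> at y = exp u. Division by
  zero gives it the value 0 at u = 0 in place of the limit t.\<close>

definition damped_sinc :: "real \<Rightarrow> real \<Rightarrow> real" where
  "damped_sinc t u = exp (- u / 2) * sin (t * u) / u"

definition damped_sinc_deriv :: "real \<Rightarrow> real \<Rightarrow> real" where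
  "damped_sinc_deriv t u =
     exp (- u / 2) * (t * u * cos (t * u) - u / 2 * sin (t * u) - sin (t * u)) / u\<^sup>2"

definition sine_integral :: "real \<Rightarrow> real \<Rightarrow> real" where
  "sine_integral t u = integral {1..exp u} (\<lambda>y. sin (t * ln y) / (sqrt y * ln y))"

lemma damped_sinc_has_real_derivative:
  assumes "u \<noteq> 0"
  shows "(damped_sinc t has_real_derivative damped_sinc_deriv t u) (at u)"
  unfolding damped_sinc_def damped_sinc_deriv_def using assms
  by (auto intro!: derivative_eq_intros) (simp add: divide_simps power2_eq_square, simp add: algebra_simps)

lemma sqrt_exp: "sqrt (exp u) = exp (u / 2)"
  by (rule real_sqrt_unique) (auto simp: exp_double[symmetric])

lemma damped_sinc_ln:
  assumes "y > 0"
  shows "sin (t * ln y) / (sqrt y * ln y) = damped_sinc t (ln y)"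
  using assms sqrt_exp[of "ln y"] by (simp add: damped_sinc_def exp_minus divide_simps)

lemma sine_integral_properties:
  shows "continuous_on {0..} (sine_integral t)"
    and "\<And>u. u > 0 \<Longrightarrow> (sine_integral t has_real_derivative exp u * damped_sinc t u) (at u)"
proof -
  \<comment> \<open>Replacing the value 0 / 0 = 0 at y = 1 by the limit t makes the integrand
    continuous, so the fundamental theorem applies; a single point does not change the
    integral.\<close>
  define h where "h = (\<lambda>y. if y = 1 then t else damped_sinc t (ln y))"
  have h_int: "integral {1..x} (\<lambda>y. sin (t * ln y) / (sqrt y * ln y)) = integral {1..x} h" for x
    by (rule integral_spike[of "{1}"]) (auto simp: h_def damped_sinc_ln)
  have lim: "(damped_sinc t \<longlongrightarrow> t) (at 0)"
  proof -
    have "((\<lambda>u. sin (t * u)) has_real_derivative t) (at 0)"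
      by (auto intro!: derivative_eq_intros)
    hence "((\<lambda>u. sin (t * u) / u) \<longlongrightarrow> t) (at 0)"
      by (simp add: DERIV_def)
    moreover have "((\<lambda>u::real. exp (- u / 2)) \<longlongrightarrow> exp (- 0 / 2)) (at 0)"
      by (intro tendsto_intros) auto
    ultimately have "((\<lambda>u. exp (- u / 2) * (sin (t * u) / u)) \<longlongrightarrow> exp (- 0 / 2) * t) (at 0)"
      by (intro tendsto_mult)
    thus ?thesis by (simp add: damped_sinc_def[abs_def])
  qed
  have cont: "isCont h y" if "y > 0" for y
  proof (cases "y = 1")
    case True
    have "filterlim ln (at 0) (at (1::real))"
    proof (rule filterlim_atI)
      have "(ln \<longlongrightarrow> ln 1) (at (1::real))" by (intro tendsto_intros) auto
      thus "(ln \<longlongrightarrow> 0) (at (1::real))" by simp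
      have "eventually (\<lambda>x. x \<in> {0<..} - {1}) (at (1::real))"
        by (intro eventually_at_in_open) auto
      thus "eventually (\<lambda>x::real. ln x \<noteq> 0) (at 1)" by eventually_elim auto
    qed
    from filterlim_compose[OF lim this] have "((\<lambda>x. damped_sinc t (ln x)) \<longlongrightarrow> t) (at 1)" .
    hence "(h \<longlongrightarrow> t) (at 1)"
    proof (rule Lim_transform_eventually)
      show "eventually (\<lambda>x. damped_sinc t (ln x) = h x) (at 1)"
        using eventually_neq_at_within[of 1] by eventually_elim (simp add: h_def)
    qed
    thus ?thesis using True by (simp add: isCont_def h_def)
  next
    case False
    have "isCont (\<lambda>y. damped_sinc t (ln y)) y"
      using that False by (intro isCont_o2[OF _ DERIV_isCont[OF damped_sinc_has_real_derivative]] isCont_ln) auto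
    moreover have "eventually (\<lambda>x. x \<in> - {1}) (nhds y)"
      using False by (intro eventually_nhds_in_open) auto
    hence "eventually (\<lambda>x. damped_sinc t (ln x) = h x) (nhds y)"
      by eventually_elim (simp add: h_def)
    ultimately show ?thesis using isCont_cong[of "\<lambda>y. damped_sinc t (ln y)" h y] by simp
  qed
  have cont_on: "continuous_on {1..b} h" for b
    using cont by (intro continuous_at_imp_continuous_on) auto
  have sine_integral: "sine_integral t = (\<lambda>u. integral {1..exp u} h)"
    by (simp add: sine_integral_def[abs_def] h_int)
  show "(sine_integral t has_real_derivative exp u * damped_sinc t u) (at u)" if "u > 0" for u
  proof -
    have "((\<lambda>x. integral {1..x} h) has_real_derivative h (exp u)) (at (exp u) within {1..exp u + 1})"
      using that by (intro integral_has_real_derivative cont_on) auto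
    moreover have "exp u \<in> interior {1..exp u + 1}" using that by simp
    ultimately have "((\<lambda>x. integral {1..x} h) has_real_derivative h (exp u)) (at (exp u))"
      by (simp only: at_within_interior)
    from DERIV_chain2[OF this DERIV_exp] show ?thesis
      using that by (simp add: sine_integral h_def mult.commute)
  qed
  show "continuous_on {0..} (sine_integral t)"
    unfolding continuous_on_eq_continuous_within
  proof
    fix u :: real assume u: "u \<in> {0..}"
    have "continuous_on {0..u+1} (\<lambda>v. integral {1..exp v} h)"
    proof (rule continuous_on_compose2[of "{1..exp (u+1)}" "\<lambda>x. integral {1..x} h"])
      show "continuous_on {1..exp (u+1)} (\<lambda>x. integral {1..x} h)"
        by (intro indefinite_integral_continuous_1 integrable_continuous_interval cont_on)
    qed (auto intro!: continuous_intros)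
    hence "continuous (at u within {0..u+1}) (sine_integral t)"
      using u by (simp add: sine_integral continuous_on_eq_continuous_within)
    moreover have "at u within {0..} = at u within {0..u+1}"
      by (rule at_within_nhd[of _ "{..<u+1}"]) auto
    ultimately show "continuous (at u within {0..}) (sine_integral t)" by simp
  qed
qed

section \<open>The truncated sums as functions of u = ln X\<close>

definition f_exp :: "real \<Rightarrow> real \<Rightarrow> real" where
  "f_exp t u = f_trunc (exp u) t"

lemma finite_nat_below: "finite {n::nat. 1 \<le> n \<and> real n < x}"
  by (rule finite_subset[of _ "{..nat \<lceil>x\<rceil>}"]) (auto, linarith)

lemma f_exp_eq_psi:
  "f_exp t u = - (\<Sum>n | 1 \<le> n \<and> real n < exp u. mangoldt n * damped_sinc t (ln (real n)))
     + (chebyshev_psi (exp u) - exp u) * damped_sinc t u + sine_integral t u"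
proof -
  have "mangoldt n * sin (t * ln (real n)) / (sqrt (real n) * ln (real n)) = mangoldt n * damped_sinc t (ln (real n))"
    if "1 \<le> n" for n
    using damped_sinc_ln[of "real n" t] that unfolding times_divide_eq_right[symmetric] by simp
  moreover have "sin (t * ln (exp u)) / (sqrt (exp u) * ln (exp u)) = damped_sinc t u"
    by (subst damped_sinc_ln) auto
  hence "chebyshev_delta (exp u) * sin (t * ln (exp u)) / (sqrt (exp u) * ln (exp u)) 
      = (chebyshev_psi (exp u) - exp u) * damped_sinc t u"
    unfolding times_divide_eq_right[symmetric] by (simp add: chebyshev_delta_def)
  moreover have "(\<Sum>n | 1 \<le> n \<and> real n < exp u. mangoldt n * sin (t * ln (real n)) / (sqrt (real n) * ln (real n)))
      = (\<Sum>n | 1 \<le> n \<and> real n < exp u. mangoldt n * damped_sinc t (ln (real n)))"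
    by (rule sum.cong) (use calculation in auto)
  ultimately show ?thesis
    unfolding f_exp_def f_trunc_def sine_integral_def by simp
qed

text \<open>The maximum makes each summand continuous across its jump point \<open>ln n\<close>.\<close>

lemma f_exp_eq_sum:
  assumes "u \<le> U"
  shows "f_exp t u = (\<Sum>n | 1 \<le> n \<and> real n < exp U. 
            mangoldt n * (damped_sinc t (max u (ln (real n))) - damped_sinc t (ln (real n))))
          - (exp u * damped_sinc t u - sine_integral t u)"
proof -
  have "(\<Sum>n | 1 \<le> n \<and> real n < exp U. 
            mangoldt n * (damped_sinc t (max u (ln (real n))) - damped_sinc t (ln (real n))))
     = (\<Sum>n | 1 \<le> n \<and> real n < exp u. mangoldt n * (damped_sinc t u - damped_sinc t (ln (real n))))"
  proof (rule sum.mono_neutral_cong_right)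
    show "{n. 1 \<le> n \<and> real n < exp u} \<subseteq> {n. 1 \<le> n \<and> real n < exp U}"
    proof (clarsimp)
      fix n assume "real n < exp u"
      also have "exp u \<le> exp U" using assms by simp
      finally show "real n < exp U" .
    qed
    show "\<forall>n\<in>{n. 1 \<le> n \<and> real n < exp U} - {n. 1 \<le> n \<and> real n < exp u}.
        mangoldt n * (damped_sinc t (max u (ln (real n))) - damped_sinc t (ln (real n))) = 0"
    proof
      fix n assume "n \<in> {n. 1 \<le> n \<and> real n < exp U} - {n. 1 \<le> n \<and> real n < exp u}"
      hence "u \<le> ln (real n)" by (subst ln_ge_iff) auto
      thus "mangoldt n * (damped_sinc t (max u (ln (real n))) - damped_sinc t (ln (real n))) = 0"
        by (simp add: max_def)
    qed
    fix n assume "n \<in> {n. 1 \<le> n \<and> real n < exp u}"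
    hence "ln (real n) < ln (exp u)" by (subst ln_less_cancel_iff) auto
    hence "ln (real n) < u" by simp
    thus "mangoldt n * (damped_sinc t (max u (ln (real n))) - damped_sinc t (ln (real n))) = 
       mangoldt n * (damped_sinc t u - damped_sinc t (ln (real n)))" by (simp add: max_def)
  qed (rule finite_nat_below)
  also have "\<dots> = chebyshev_psi (exp u) * damped_sinc t u 
      - (\<Sum>n | 1 \<le> n \<and> real n < exp u. mangoldt n * damped_sinc t (ln (real n)))"
    by (simp add: chebyshev_psi_def sum_distrib_right sum_subtractf right_diff_distrib)
  finally show ?thesis by (simp add: f_exp_eq_psi algebra_simps)
qed

text \<open>The jumps of \<psi> and of the sum over n cancel at every ln n, as
  \<open>f_exp_eq_sum\<close> shows. The factor u clears the denominator of
  \<open>damped_sinc\<close>: without it, the value 0 / 0 = 0 would break continuity at u =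
  0.\<close>

lemma continuous_on_times_f_exp: "continuous_on {0..U} (\<lambda>u. u * f_exp t u)"
proof -
  have sinc: "continuous_on {0..U} (\<lambda>u. mangoldt n * (damped_sinc t (max u (ln (real n))) - damped_sinc t (ln (real n))))"
    for n
  proof (cases "n \<le> 1")
    case True
    hence "mangoldt n = (0::real)" by (cases n) auto
    thus ?thesis by simp
  next
    case False
    \<comment> \<open>For n \<ge> 2 the maximum is at least ln n > 0 and so stays away from 0, where
      \<open>damped_sinc\<close> need not be continuous.\<close>
    have "continuous_on {0<..} (damped_sinc t)"
      by (intro continuous_at_imp_continuous_on ballI DERIV_isCont[OF damped_sinc_has_real_derivative]) auto
    hence "continuous_on {0..U} (\<lambda>u. damped_sinc t (max u (ln (real n))))"
      by (rule continuous_on_compose2) (use False in \<open>auto intro!: continuous_intros simp: less_max_iff_disj\<close>)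
    thus ?thesis by (intro continuous_intros)
  qed
  have "continuous_on {0..U} (\<lambda>u. u * (\<Sum>n | 1 \<le> n \<and> real n < exp U. 
            mangoldt n * (damped_sinc t (max u (ln (real n))) - damped_sinc t (ln (real n))))
          - (exp u * (exp (- u / 2) * sin (t * u)) - u * sine_integral t u))"
    by (intro continuous_intros sinc continuous_on_subset[OF sine_integral_properties(1)]) auto
  thus ?thesis
  proof (rule continuous_on_eq)
    fix u assume "u \<in> {0..U}"
    moreover have "u * damped_sinc t u = exp (- u / 2) * sin (t * u)"
      by (simp add: damped_sinc_def)
    ultimately show "u * (\<Sum>n | 1 \<le> n \<and> real n < exp U. 
            mangoldt n * (damped_sinc t (max u (ln (real n))) - damped_sinc t (ln (real n))))
          - (exp u * (exp (- u / 2) * sin (t * u)) - u * sine_integral t u) = u * f_exp t u"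
      using f_exp_eq_sum[of u U t] by (simp only: right_diff_distrib atLeastAtMost_iff mult.left_commute[of u "exp u"])
  qed
qed

text \<open>Convergence bounds \<open>f_exp\<close> only beyond some U; the remaining compact
  interval is covered by continuity. The growth 1 + u is due to the extra factor u.\<close>

lemma times_f_exp_bounded:
  assumes "((\<lambda>X. f_trunc X t) \<longlongrightarrow> l) at_top"
  obtains C where "C \<ge> 0" "\<And>u. u \<ge> 0 \<Longrightarrow> \<bar>u * f_exp t u\<bar> \<le> C * (1 + u)"
proof -
  have "((\<lambda>u. f_exp t u) \<longlongrightarrow> l) at_top"
    unfolding f_exp_def using filterlim_compose[OF assms exp_at_top] .
  hence "eventually (\<lambda>u. dist (f_exp t u) l < 1) at_top" by (rule tendstoD) auto
  then obtain U where U: "\<And>u. u \<ge> U \<Longrightarrow> dist (f_exp t u) l < 1" 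
    by (auto simp: eventually_at_top_linorder)
  have "bounded ((\<lambda>u. u * f_exp t u) ` {0..max 0 U})"
    by (intro compact_imp_bounded compact_continuous_image continuous_on_times_f_exp) auto
  then obtain B where B: "\<And>u. u \<in> {0..max 0 U} \<Longrightarrow> \<bar>u * f_exp t u\<bar> \<le> B" 
    unfolding bounded_iff by (metis imageI real_norm_def)
  define C where "C = \<bar>B\<bar> + \<bar>l\<bar> + 1"
  show ?thesis
  proof
    show "C \<ge> 0" by (simp add: C_def)
    fix u :: real assume u: "u \<ge> 0"
    show "\<bar>u * f_exp t u\<bar> \<le> C * (1 + u)"
    proof (cases "u \<le> max 0 U")
      case True
      hence "\<bar>u * f_exp t u\<bar> \<le> C * 1" using B[of u] u by (simp add: C_def)
      also have "\<dots> \<le> C * (1 + u)" using u by (intro mult_left_mono) (auto simp: C_def)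
      finally show ?thesis .
    next
      case False
      hence "\<bar>f_exp t u - l\<bar> < 1" using U[of u] by (simp add: dist_real_def)
      hence "\<bar>f_exp t u\<bar> \<le> C" unfolding C_def by linarith
      hence "\<bar>u * f_exp t u\<bar> \<le> u * C" using u by (simp add: abs_mult mult_left_mono)
      also have "\<dots> \<le> C * (1 + u)" using u by (simp add: C_def algebra_simps)
      finally show ?thesis .
    qed
  qed
qed

text \<open>The antiderivative of \<open>u\<^sup>2 H'(u) e\<^sup>-\<^sup>z\<^sup>u\<close> for \<open>H = damped_sinc t\<close>: writing sine and cosine by
  exponentials turns the integrand into a sum of two terms \<open>(a u + b) e\<^sup>-\<^sup>c\<^sup>u\<close>.\<close>

definition exp_primitive :: "complex \<Rightarrow> complex \<Rightarrow> complex \<Rightarrow> real \<Rightarrow> complex" where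
  "exp_primitive a b c u = - (exp (- c * of_real u) * ((a * of_real u + b) / c + a / c\<^sup>2))"

definition sinc_primitive :: "real \<Rightarrow> complex \<Rightarrow> real \<Rightarrow> complex" where
  "sinc_primitive t z u =
     exp_primitive (of_real t / 2 + \<i> / 4) (\<i> / 2) (z + 1 / 2 - \<i> * of_real t) u
     + exp_primitive (of_real t / 2 - \<i> / 4) (- \<i> / 2) (z + 1 / 2 + \<i> * of_real t) u"

lemma exp_primitive_has_vector_derivative:
  assumes "c \<noteq> 0"
  shows "(exp_primitive a b c has_vector_derivative (a * of_real u + b) * exp (- c * of_real u)) (at u)"
proof -
  have "((\<lambda>w. - (exp (- c * w) * ((a * w + b) / c + a / c\<^sup>2))) has_field_derivative
           (a * of_real u + b) * exp (- c * of_real u)) (at (of_real u))"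
    using assms by (auto intro!: derivative_eq_intros) (simp add: divide_simps power2_eq_square, simp add: algebra_simps)
  from has_vector_derivative_real_field[OF this] show ?thesis
    by (simp add: exp_primitive_def[abs_def])
qed

text \<open>Origin of the constants: t cos (t u) - sin (t u) / 2 has the coefficients t/2 + i/4 and
  t/2 - i/4 at exp (i t u) and exp (- i t u), while - sin (t u) has i/2 and - i/2. The factor exp (-
  u / 2) adds 1/2 to z, and the condition on Re z keeps both exponents nonzero.\<close>

lemma sinc_primitive_has_vector_derivative:
  assumes "Re z > -1/2" and "u \<noteq> 0"
  shows "(sinc_primitive t z has_vector_derivative
           of_real (damped_sinc_deriv t u * u\<^sup>2) * exp (- z * of_real u)) (at u)"
proof -
  have nz: "z + 1 / 2 - \<i> * of_real t \<noteq> 0" "z + 1 / 2 + \<i> * of_real t \<noteq> 0"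
    using assms(1) by (auto simp: complex_eq_iff)
  define a where "a = complex_of_real t / 2 + \<i> / 4"
  define a' where "a' = complex_of_real t / 2 - \<i> / 4"
  define U where "U = complex_of_real u"
  have "(sinc_primitive t z has_vector_derivative
          (a * U + \<i> / 2) * exp (- (z + 1 / 2 - \<i> * of_real t) * U)
          + (a' * U + - \<i> / 2) * exp (- (z + 1 / 2 + \<i> * of_real t) * U)) (at u)"
    unfolding sinc_primitive_def[abs_def] a_def a'_def U_def
    by (intro has_vector_derivative_add exp_primitive_has_vector_derivative nz)
  also have "(a * U + \<i> / 2) * exp (- (z + 1 / 2 - \<i> * of_real t) * U)
          + (a' * U + - \<i> / 2) * exp (- (z + 1 / 2 + \<i> * of_real t) * U)
     = exp (- z * U) * exp (- U / 2) * ((a * U + \<i> / 2) * exp (\<i> * (of_real t * U)) + (a' * U + - \<i> / 2) * exp (- (\<i> * (of_real t * U))))"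
  proof -
    have "- (z + 1 / 2 - \<i> * of_real t) * U = - z * U + - U / 2 + \<i> * (of_real t * U)"
      "- (z + 1 / 2 + \<i> * of_real t) * U = - z * U + - U / 2 + - (\<i> * (of_real t * U))"
      by (simp_all add: algebra_simps)
    thus ?thesis by (simp only: exp_add) (simp only: distrib_left distrib_right mult_ac)
  qed
  also have "(a * U + \<i> / 2) * exp (\<i> * (of_real t * U)) + (a' * U + - \<i> / 2) * exp (- (\<i> * (of_real t * U)))
      = of_real t * U * cos (of_real t * U) - U / 2 * sin (of_real t * U) - sin (of_real t * U)"
    unfolding cos_exp_eq sin_exp_eq a_def a'_def by (simp add: divide_simps) (simp add: algebra_simps)
  also have "exp (- z * U) * exp (- U / 2) * (of_real t * U * cos (of_real t * U) - U / 2 * sin (of_real t * U) - sin (of_real t * U))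
      = of_real (exp (- u / 2) * (t * u * cos (t * u) - u / 2 * sin (t * u) - sin (t * u))) * exp (- z * U)"
  proof -
    have "exp (- U / 2) = of_real (exp (- u / 2))" using exp_of_real[of "- u / 2", where ?'a = complex] by (simp add: U_def)
    moreover have "sin (of_real t * U) = of_real (sin (t * u))" using sin_of_real[of "t * u", where ?'a = complex] by (simp add: U_def)
    moreover have "cos (of_real t * U) = of_real (cos (t * u))" using cos_of_real[of "t * u", where ?'a = complex] by (simp add: U_def)
    ultimately show ?thesis by (simp add: U_def)
  qed
  also have "exp (- u / 2) * (t * u * cos (t * u) - u / 2 * sin (t * u) - sin (t * u)) = damped_sinc_deriv t u * u\<^sup>2"
    using assms(2) by (simp add: damped_sinc_deriv_def)
  finally show ?thesis by (simp add: U_def)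
qed

text \<open>Integration by parts against \<open>(z u\<^sup>2 - 2 u) e\<^sup>-\<^sup>z\<^sup>u\<close>, the derivative of \<open>- u\<^sup>2 e\<^sup>-\<^sup>z\<^sup>u\<close>.\<close>

lemma has_integral_by_parts_quadratic_exp:
  fixes g g' :: "real \<Rightarrow> real" and K :: "real \<Rightarrow> complex"
  assumes "0 \<le> A" "A \<le> B"
    and cont: "continuous_on {A..B} (\<lambda>u. u * g u)" and contK: "continuous_on {A..B} K"
    and g: "\<And>u. A < u \<Longrightarrow> u < B \<Longrightarrow> (g has_real_derivative g' u) (at u)"
    and K: "\<And>u. A < u \<Longrightarrow> u < B \<Longrightarrow>
               (K has_vector_derivative of_real (g' u * u\<^sup>2) * exp (- z * of_real u)) (at u)"
  shows "((\<lambda>u. of_real (u * g u) * ((z * of_real u - 2) * exp (- z * of_real u))) has_integral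
           (K B - of_real (B * g B) * (of_real B * exp (- z * of_real B)))
           - (K A - of_real (A * g A) * (of_real A * exp (- z * of_real A)))) {A..B}"
proof -
  \<comment> \<open>The product of u^2 and g is split as (u g) times u because continuity up to the
    left end is available only for u g.\<close>
  define G where "G = (\<lambda>u. K u - of_real (u * g u) * (of_real u * exp (- z * of_real u)))"
  have "((\<lambda>u. of_real (u * g u) * ((z * of_real u - 2) * exp (- z * of_real u))) has_integral (G B - G A)) {A..B}"
  proof (rule fundamental_theorem_of_calculus_interior[OF \<open>A \<le> B\<close>])
    show "continuous_on {A..B} G"
      unfolding G_def by (intro continuous_intros cont contK)
    fix u assume u: "u \<in> {A<..<B}"
    have "((\<lambda>w. w * exp (- z * w)) has_field_derivative (1 - z * of_real u) * exp (- z * of_real u)) (at (of_real u))"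
      by (auto intro!: derivative_eq_intros simp: algebra_simps)
    hence 1: "((\<lambda>u. of_real u * exp (- z * of_real u)) has_vector_derivative (1 - z * of_real u) * exp (- z * of_real u)) (at u)"
      by (rule has_vector_derivative_real_field)
    have "((\<lambda>u. u * g u) has_real_derivative g u + u * g' u) (at u)"
      using u by (auto intro!: derivative_eq_intros g)
    hence 2: "((\<lambda>u. complex_of_real (u * g u)) has_vector_derivative of_real (g u + u * g' u)) (at u)"
      by (intro has_vector_derivative_of_real) (simp add: has_real_derivative_iff_has_vector_derivative)
    have "(G has_vector_derivative of_real (g' u * u\<^sup>2) * exp (- z * of_real u) - 
        (of_real (u * g u) * ((1 - z * of_real u) * exp (- z * of_real u)) + 
         of_real (g u + u * g' u) * (of_real u * exp (- z * of_real u)))) (at u)"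
      unfolding G_def using u by (intro has_vector_derivative_diff K has_vector_derivative_mult 1 2) auto
    also have "of_real (g' u * u\<^sup>2) * exp (- z * of_real u) - 
        (of_real (u * g u) * ((1 - z * of_real u) * exp (- z * of_real u)) + 
         of_real (g u + u * g' u) * (of_real u * exp (- z * of_real u)))
       = of_real (u * g u) * ((z * of_real u - 2) * exp (- z * of_real u))"
      by (simp add: algebra_simps power2_eq_square)
    finally show "(G has_vector_derivative of_real (u * g u) * ((z * of_real u - 2) * exp (- z * of_real u))) (at u)" .
  qed
  thus ?thesis by (simp only: G_def)
qed

lemma sinc_primitive_continuous:
  assumes "Re z > -1/2"
  shows "continuous_on S (sinc_primitive t z)"
proof -
  have nz: "z + 1 / 2 - \<i> * of_real t \<noteq> 0" "z + 1 / 2 + \<i> * of_real t \<noteq> 0"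
    using assms(1) by (auto simp: complex_eq_iff)
  thus ?thesis unfolding sinc_primitive_def exp_primitive_def by (intro continuous_intros) auto
qed

text \<open>By \<open>f_exp_eq_sum\<close> each n contributes a multiple of H (u) - H (ln n), where
  H is \<open>damped_sinc t\<close>, from u = ln n onwards and nothing before. The smooth part has
  the derivative exp u H' (u), and exp u shifts z to z - 1 in the primitive; hence Re z > 1/2. All
  boundary terms at U recombine to \<open>f_exp t U\<close>.\<close>

lemma f_exp_integral:
  assumes z: "Re z > 1 / 2" and U: "U \<ge> 0"
  shows "((\<lambda>u. of_real (u * f_exp t u) * ((z * of_real u - 2) * exp (- z * of_real u))) has_integral
           - of_real (U * f_exp t U) * (of_real U * exp (- z * of_real U))
           + (\<Sum>n | 1 \<le> n \<and> real n < exp U. mangoldt n * (sinc_primitive t z U - sinc_primitive t z (ln (real n))))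
           - (sinc_primitive t (z - 1) U - sinc_primitive t (z - 1) 0)) {0..U}"
proof -
  define q where "q = (\<lambda>u::real. (z * of_real u - 2) * exp (- z * of_real u))"
  define e where "e = of_real U * exp (- z * of_real U)"
  define N where "N = {n::nat. 1 \<le> n \<and> real n < exp U}"
  define r where "r = (\<lambda>u. exp u * damped_sinc t u - sine_integral t u)"
  define d where "d = (\<lambda>n u. damped_sinc t (max u (ln (real n))) - damped_sinc t (ln (real n)))"
  define K where "K = sinc_primitive t z"
  define K' where "K' = sinc_primitive t (z - 1)"
  have "finite N" unfolding N_def by (rule finite_nat_below)
  have 1: "((\<lambda>u. of_real (u * r u) * q u) has_integral (K' U - of_real (U * r U) * e) - (K' 0 - of_real (0 * r 0) * (of_real 0 * exp (- z * of_real 0)))) {0..U}"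
    unfolding q_def e_def
  proof (rule has_integral_by_parts_quadratic_exp[where g' = "\<lambda>u. exp u * damped_sinc_deriv t u"])
    have "continuous_on {0..U} (\<lambda>u. exp u * (exp (- u / 2) * sin (t * u)) - u * sine_integral t u)"
      by (intro continuous_intros continuous_on_subset[OF sine_integral_properties(1)]) auto
    thus "continuous_on {0..U} (\<lambda>u. u * r u)"
      by (rule continuous_on_eq) (simp add: r_def damped_sinc_def algebra_simps)
    show "continuous_on {0..U} K'" unfolding K'_def using z by (intro sinc_primitive_continuous) auto
    fix u assume u: "0 < u" "u < U"
    show "(r has_real_derivative exp u * damped_sinc_deriv t u) (at u)"
      unfolding r_def using u
      by (auto intro!: derivative_eq_intros damped_sinc_has_real_derivative sine_integral_properties(2))
    have "(K' has_vector_derivative of_real (damped_sinc_deriv t u * u\<^sup>2) * exp (- (z - 1) * of_real u)) (at u)"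
      unfolding K'_def using z u by (intro sinc_primitive_has_vector_derivative) auto
    also have "of_real (damped_sinc_deriv t u * u\<^sup>2) * exp (- (z - 1) * of_real u)
        = of_real (exp u * damped_sinc_deriv t u * u\<^sup>2) * exp (- z * of_real u)"
    proof -
      have "- (z - 1) * of_real u = of_real u + - z * of_real u" by (simp add: algebra_simps)
      thus ?thesis by (simp only: exp_add exp_of_real of_real_mult mult_ac)
    qed
    finally show "(K' has_vector_derivative of_real (exp u * damped_sinc_deriv t u * u\<^sup>2) * exp (- z * of_real u)) (at u)" .
  qed (use U in auto)
  have 2: "((\<lambda>u. mangoldt n * (of_real (u * d n u) * q u)) has_integral mangoldt n * (K U - K (ln (real n)) - of_real (U * d n U) * e)) {0..U}"
    if n: "n \<in> N" for n
  proof (cases "n = 1")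
    case True
    thus ?thesis by simp
  next
    case False
    define l where "l = ln (real n)"
    have l: "l > 0" using False n by (simp add: l_def N_def)
    have "ln (real n) < ln (exp U)" using n by (subst ln_less_cancel_iff) (auto simp: N_def)
    hence lU: "l < U" by (simp add: l_def)
    have "((\<lambda>u. of_real (u * d n u) * q u) has_integral 0) {0..l}"
      by (rule has_integral_is_0) (auto simp: d_def l_def max_def)
    moreover have "((\<lambda>u. of_real (u * d n u) * q u) has_integral (K U - of_real (U * d n U) * e) - (K l - of_real (l * d n l) * (of_real l * exp (- z * of_real l)))) {l..U}"
      unfolding q_def e_def
    proof (rule has_integral_by_parts_quadratic_exp[where g' = "damped_sinc_deriv t"])
      have "continuous_on {0<..} (damped_sinc t)"
        by (intro continuous_at_imp_continuous_on ballI DERIV_isCont[OF damped_sinc_has_real_derivative]) auto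
      hence "continuous_on {l..U} (\<lambda>u. damped_sinc t (max u l))"
        by (rule continuous_on_compose2) (use l in \<open>auto intro!: continuous_intros simp: less_max_iff_disj\<close>)
      thus "continuous_on {l..U} (\<lambda>u. u * d n u)"
        unfolding d_def l_def[symmetric] by (intro continuous_intros)
      show "continuous_on {l..U} K" unfolding K_def using z by (intro sinc_primitive_continuous) auto
      fix u assume u: "l < u" "u < U"
      have "((\<lambda>u. damped_sinc t u - damped_sinc t l) has_real_derivative damped_sinc_deriv t u) (at u)"
        using l u by (auto intro!: derivative_eq_intros damped_sinc_has_real_derivative)
      thus "(d n has_real_derivative damped_sinc_deriv t u) (at u)"
        by (rule has_field_derivative_transform_within_open[of _ _ _ "{l<..}"]) (use u in \<open>auto simp: d_def l_def max_def\<close>)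
      show "(K has_vector_derivative of_real (damped_sinc_deriv t u * u\<^sup>2) * exp (- z * of_real u)) (at u)"
        unfolding K_def using z u l by (intro sinc_primitive_has_vector_derivative) auto
    qed (use l lU in auto)
    ultimately have "((\<lambda>u. of_real (u * d n u) * q u) has_integral 0 + ((K U - of_real (U * d n U) * e) - (K l - of_real (l * d n l) * (of_real l * exp (- z * of_real l))))) {0..U}"
      using l lU by (intro has_integral_combine[of 0 l U]) auto
    moreover have "d n l = 0" by (simp add: d_def l_def)
    ultimately have "((\<lambda>u. of_real (u * d n u) * q u) has_integral (K U - K (ln (real n)) - of_real (U * d n U) * e)) {0..U}"
      by (simp add: l_def algebra_simps)
    thus ?thesis by (rule has_integral_mult_right)
  qed
  have f: "complex_of_real (u * f_exp t u) = (\<Sum>n\<in>N. mangoldt n * of_real (u * d n u)) - of_real (u * r u)" if "u \<le> U" for u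
    unfolding f_exp_eq_sum[OF that] d_def r_def N_def 
    by (simp add: right_diff_distrib sum_distrib_left mult.left_commute)
  have "((\<lambda>u. (\<Sum>n\<in>N. mangoldt n * (of_real (u * d n u) * q u)) - of_real (u * r u) * q u) has_integral
      (\<Sum>n\<in>N. mangoldt n * (K U - K (ln (real n)) - of_real (U * d n U) * e))
       - ((K' U - of_real (U * r U) * e) - (K' 0 - of_real (0 * r 0) * (of_real 0 * exp (- z * of_real 0))))) {0..U}"
    by (intro has_integral_diff has_integral_sum 1 2 \<open>finite N\<close>)
  hence "((\<lambda>u. of_real (u * f_exp t u) * q u) has_integral
      (\<Sum>n\<in>N. mangoldt n * (K U - K (ln (real n)) - of_real (U * d n U) * e))
       - ((K' U - of_real (U * r U) * e) - (K' 0 - of_real (0 * r 0) * (of_real 0 * exp (- z * of_real 0))))) {0..U}"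
    by (rule has_integral_eq[rotated]) (simp only: f atLeastAtMost_iff left_diff_distrib sum_distrib_right mult.assoc)
  also have "(\<Sum>n\<in>N. mangoldt n * (K U - K (ln (real n)) - of_real (U * d n U) * e))
       - ((K' U - of_real (U * r U) * e) - (K' 0 - of_real (0 * r 0) * (of_real 0 * exp (- z * of_real 0))))
     = - of_real (U * f_exp t U) * e + (\<Sum>n\<in>N. mangoldt n * (K U - K (ln (real n)))) - (K' U - K' 0)"
  proof -
    have "(\<Sum>n\<in>N. mangoldt n * (K U - K (ln (real n)) - of_real (U * d n U) * e))
        = (\<Sum>n\<in>N. mangoldt n * (K U - K (ln (real n)))) - (\<Sum>n\<in>N. mangoldt n * of_real (U * d n U)) * e"
      unfolding sum_distrib_right sum_subtractf[symmetric] by (simp only: right_diff_distrib mult.assoc)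
    moreover have "(\<Sum>n\<in>N. mangoldt n * complex_of_real (U * d n U)) = of_real (U * f_exp t U) + of_real (U * r U)"
      by (simp only: f[OF order.refl] diff_add_cancel)
    ultimately show ?thesis by (simp add: ring_distribs)
  qed
  finally show ?thesis by (simp only: q_def e_def K_def K'_def N_def)
qed

section \<open>Convergence and holomorphy of the Laplace transform\<close>

text \<open>The improper integral V, cut into unit intervals: each piece is holomorphic by the
  Leibniz rule on a compact interval, and the series by the M-test.\<close>

definition f_laplace :: "real \<Rightarrow> complex \<Rightarrow> complex" where
  "f_laplace t z = (\<Sum>n. integral {real n..real (Suc n)}
      (\<lambda>u. of_real (u * f_exp t u) * ((z * of_real u - 2) * exp (- z * of_real u))))"

lemma continuous_on_f_laplace_integrand:
  fixes z :: complex
  assumes "0 \<le> a"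
  shows "continuous_on {a..b} (\<lambda>u. of_real (u * f_exp t u) * ((z * of_real u - 2) * exp (- z * of_real u)))"
proof -
  have "continuous_on {a..b} (\<lambda>u. u * f_exp t u)"
    by (rule continuous_on_subset[OF continuous_on_times_f_exp[of b]]) (use assms in auto)
  hence "continuous_on {a..b} (\<lambda>u. complex_of_real (u * f_exp t u))"
    by (rule continuous_on_of_real)
  thus ?thesis by (rule continuous_on_mult) (intro continuous_intros)
qed

lemma f_laplace_piece_holomorphic:
  "(\<lambda>z. integral {real n..real (Suc n)}
      (\<lambda>u. of_real (u * f_exp t u) * ((z * of_real u - 2) * exp (- z * of_real u)))) holomorphic_on {z. Re z > 0}"
  unfolding cbox_interval[symmetric]
proof (rule leibniz_rule_holomorphic[where fx = "\<lambda>z u. of_real (u * f_exp t u) * ((of_real u - of_real u * (z * of_real u - 2)) * exp (- z * of_real u))"])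
  show "((\<lambda>z. of_real (u * f_exp t u) * ((z * of_real u - 2) * exp (- z * of_real u))) has_field_derivative
      of_real (u * f_exp t u) * ((of_real u - of_real u * (z * of_real u - 2)) * exp (- z * of_real u))) (at z within {z. Re z > 0})"
    for z u by (auto intro!: derivative_eq_intros simp: algebra_simps)
  have cont: "continuous_on {0..real (Suc n)} (\<lambda>u. complex_of_real (u * f_exp t u))"
    by (intro continuous_on_of_real continuous_on_times_f_exp)
  have "continuous_on ({z. Re z > 0} \<times> cbox (real n) (real (Suc n))) (\<lambda>p. complex_of_real (snd p * f_exp t (snd p)))"
    by (rule continuous_on_compose2[OF cont]) (auto intro!: continuous_intros)
  thus "continuous_on ({z. Re z > 0} \<times> cbox (real n) (real (Suc n)))
     (\<lambda>(z, u). of_real (u * f_exp t u) * ((of_real u - of_real u * (z * of_real u - 2)) * exp (- z * of_real u)))"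
    unfolding case_prod_unfold by (rule continuous_on_mult) (intro continuous_intros)
qed (use integrable_continuous_interval[OF continuous_on_f_laplace_integrand] in \<open>auto simp: convex_halfspace_Re_gt\<close>)

lemma linear_le_exp: 
  fixes d u :: real
  assumes "d > 0" "u \<ge> 0"
  shows "1 + u \<le> (1 + 1 / d) * exp (d * u)"
proof -
  have "d * u \<le> exp (d * u)" using exp_ge_add_one_self[of "d * u"] by linarith
  hence "u \<le> 1 / d * exp (d * u)" using assms by (simp add: field_simps)
  moreover have "1 \<le> exp (d * u)" using assms by simp
  ultimately have "1 + u \<le> exp (d * u) + 1 / d * exp (d * u)" by linarith
  thus ?thesis by (simp add: distrib_right)
qed

text \<open>Two factors 1 + u occur, one from the growth of u b (u) and one from the kernel. Each is
  absorbed by exp (d u), so exp (- 4 d u) still leaves exp (- 2 d u).\<close>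

lemma f_laplace_integrand_bound:
  assumes C: "C \<ge> 0" "\<And>u. u \<ge> 0 \<Longrightarrow> \<bar>u * f_exp t u\<bar> \<le> C * (1 + u)"
    and d: "d > 0" and u: "u \<ge> 0" and z: "norm z \<le> R" "4 * d \<le> Re z"
  shows "norm (of_real (u * f_exp t u) * ((z * of_real u - 2) * exp (- z * of_real u)))
           \<le> C * (R + 2) * (1 + 1 / d)\<^sup>2 * exp (- (2 * d) * u)"
proof -
  have R: "R \<ge> 0" using z(1) norm_ge_zero order_trans by blast
  have "norm (z * of_real u - 2) \<le> norm z * u + 2"
    using norm_triangle_ineq4[of "z * of_real u" 2] u by (simp add: norm_mult)
  also have "\<dots> \<le> R * u + 2" using z(1) u by (intro add_mono mult_right_mono) auto
  also have "\<dots> \<le> (R + 2) * (1 + u)" using R u by (simp add: algebra_simps)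
  finally have 1: "norm (z * of_real u - 2) \<le> (R + 2) * (1 + u)" .
  have 2: "norm (exp (- z * of_real u)) \<le> exp (- (4 * d) * u)"
    using z(2) u by (simp add: norm_exp_eq_Re mult_right_mono)
  have 3: "norm (complex_of_real (u * f_exp t u)) \<le> C * (1 + u)"
    using C(2)[OF u] by (simp only: norm_of_real)
  have "norm (of_real (u * f_exp t u) * ((z * of_real u - 2) * exp (- z * of_real u)))
      \<le> C * (1 + u) * ((R + 2) * (1 + u) * exp (- (4 * d) * u))"
    unfolding norm_mult[of "of_real (u * f_exp t u)"] norm_mult[of "z * of_real u - 2"]
    using R u C by (intro mult_mono 1 2 3) auto
  also have "\<dots> = C * (R + 2) * ((1 + u)\<^sup>2 * exp (- (4 * d) * u))"
    by (simp add: power2_eq_square mult_ac)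
  also have "\<dots> \<le> C * (R + 2) * (((1 + 1 / d) * exp (d * u))\<^sup>2 * exp (- (4 * d) * u))"
    using linear_le_exp[OF d u] u C(1) R by (intro mult_left_mono mult_right_mono power_mono) auto
  also have "((1 + 1 / d) * exp (d * u))\<^sup>2 * exp (- (4 * d) * u) = (1 + 1 / d)\<^sup>2 * exp (- (2 * d) * u)"
    by (simp add: power_mult_distrib exp_double[symmetric] mult.assoc exp_add[symmetric])
  finally show ?thesis by (simp add: mult.assoc)
qed

lemma f_laplace_piece_bound:
  assumes C: "C \<ge> 0" "\<And>u. u \<ge> 0 \<Longrightarrow> \<bar>u * f_exp t u\<bar> \<le> C * (1 + u)"
    and d: "d > 0" and z: "norm z \<le> R" "4 * d \<le> Re z"
  shows "norm (integral {real n..real (Suc n)}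
      (\<lambda>u. of_real (u * f_exp t u) * ((z * of_real u - 2) * exp (- z * of_real u))))
        \<le> C * (R + 2) * (1 + 1 / d)\<^sup>2 * exp (- (2 * d)) ^ n"
proof -
  have R: "R \<ge> 0" using z(1) norm_ge_zero order_trans by blast
  have "norm (integral {real n..real (Suc n)}
      (\<lambda>u. of_real (u * f_exp t u) * ((z * of_real u - 2) * exp (- z * of_real u))))
      \<le> C * (R + 2) * (1 + 1 / d)\<^sup>2 * exp (- (2 * d)) ^ n * (real (Suc n) - real n)"
  proof (rule integral_bound)
    show "continuous_on {real n..real (Suc n)} (\<lambda>u. of_real (u * f_exp t u) * ((z * of_real u - 2) * exp (- z * of_real u)))"
      by (rule continuous_on_f_laplace_integrand) simp
    fix u assume u: "u \<in> {real n..real (Suc n)}"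
    have "norm (of_real (u * f_exp t u) * ((z * of_real u - 2) * exp (- z * of_real u)))
           \<le> C * (R + 2) * (1 + 1 / d)\<^sup>2 * exp (- (2 * d) * u)"
      using u by (intro f_laplace_integrand_bound[OF C d _ z]) auto
    also have "\<dots> \<le> C * (R + 2) * (1 + 1 / d)\<^sup>2 * exp (- (2 * d) * real n)"
      using u d C R by (intro mult_left_mono) auto
    also have "exp (- (2 * d) * real n) = exp (- (2 * d)) ^ n"
      using exp_of_nat2_mult[of "- (2 * d)" n] by simp
    finally show "norm (of_real (u * f_exp t u) * ((z * of_real u - 2) * exp (- z * of_real u)))
       \<le> C * (R + 2) * (1 + 1 / d)\<^sup>2 * exp (- (2 * d)) ^ n" .
  qed simp
  thus ?thesis by simp
qed

lemma summable_exp_power: "d > 0 \<Longrightarrow> summable (\<lambda>n. c * exp (- (2 * d)) ^ n :: real)"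
  by (intro summable_mult summable_geometric) auto

lemma f_laplace_summable:
  assumes C: "C \<ge> 0" "\<And>u. u \<ge> 0 \<Longrightarrow> \<bar>u * f_exp t u\<bar> \<le> C * (1 + u)" and "Re z > 0"
  shows "summable (\<lambda>n. integral {real n..real (Suc n)}
      (\<lambda>u. of_real (u * f_exp t u) * ((z * of_real u - 2) * exp (- z * of_real u))))"
proof (rule summable_norm_cancel, rule summable_comparison_test')
  show "summable (\<lambda>n. C * (norm z + 2) * (1 + 1 / (Re z / 4))\<^sup>2 * exp (- (2 * (Re z / 4))) ^ n)"
    using assms(3) by (intro summable_exp_power) auto
  show "norm (norm (integral {real n..real (Suc n)}
      (\<lambda>u. of_real (u * f_exp t u) * ((z * of_real u - 2) * exp (- z * of_real u)))))
        \<le> C * (norm z + 2) * (1 + 1 / (Re z / 4))\<^sup>2 * exp (- (2 * (Re z / 4))) ^ n" if "n \<ge> 0" for n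
    unfolding real_norm_def abs_norm_cancel using assms(3) by (intro f_laplace_piece_bound[OF C]) auto
qed

lemma f_laplace_holomorphic:
  assumes C: "C \<ge> 0" "\<And>u. u \<ge> 0 \<Longrightarrow> \<bar>u * f_exp t u\<bar> \<le> C * (1 + u)"
  shows "f_laplace t holomorphic_on {z. Re z > 0}"
  unfolding f_laplace_def[abs_def]
proof (rule holomorphic_on_suminf_locally_dominated[OF open_halfspace_Re_gt f_laplace_piece_holomorphic])
  fix z :: complex assume z: "z \<in> {z. Re z > 0}"
  define e where "e = Re z / 2"
  have e: "e > 0" using z by (simp add: e_def)
  have w: "Re w \<ge> e" "norm w \<le> norm z + e" if "w \<in> cball z e" for w
  proof -
    have "norm (z - w) \<le> e" using that by (simp add: dist_norm)
    moreover have "\<bar>Re (z - w)\<bar> \<le> norm (z - w)" by (rule abs_Re_le_cmod)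
    ultimately show "Re w \<ge> e" by (auto simp: e_def)
    show "norm w \<le> norm z + e"
      using norm_triangle_ineq4[of z "z - w"] \<open>norm (z - w) \<le> e\<close> by simp
  qed
  show "\<exists>d>0. \<exists>M. cball z d \<subseteq> {z. Re z > 0} \<and> summable M \<and> (\<forall>n. \<forall>w\<in>cball z d. norm (integral {real n..real (Suc n)}
      (\<lambda>u. of_real (u * f_exp t u) * ((w * of_real u - 2) * exp (- w * of_real u)))) \<le> M n)"
  proof (rule exI[of _ e], intro conjI e, rule exI[of _ "\<lambda>n. C * (norm z + e + 2) * (1 + 1 / (e / 4))\<^sup>2 * exp (- (2 * (e / 4))) ^ n"],
      intro conjI allI ballI)
    show "cball z e \<subseteq> {z. Re z > 0}"
    proof
      fix v assume "v \<in> cball z e"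
      from w(1)[OF this] e show "v \<in> {z. Re z > 0}" by simp
    qed
    show "summable (\<lambda>n. C * (norm z + e + 2) * (1 + 1 / (e / 4))\<^sup>2 * exp (- (2 * (e / 4))) ^ n)"
      using e by (intro summable_exp_power) auto
    fix n v assume v: "v \<in> cball z e"
    show "norm (integral {real n..real (Suc n)}
      (\<lambda>u. of_real (u * f_exp t u) * ((v * of_real u - 2) * exp (- v * of_real u)))) \<le> 
        C * (norm z + e + 2) * (1 + 1 / (e / 4))\<^sup>2 * exp (- (2 * (e / 4))) ^ n"
      using w[OF v] e by (intro f_laplace_piece_bound[OF C]) auto
  qed
qed

section \<open>The Laplace transform for large Re z as a Dirichlet series\<close>

text \<open>The trivial bound x^2 is enough: it only has to be beaten by the decay of the primitive
  for Re z > 4.\<close>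

lemma chebyshev_psi_bounds:
  assumes x: "x > 0"
  shows "0 \<le> chebyshev_psi x" "chebyshev_psi x \<le> x\<^sup>2"
proof -
  show "0 \<le> chebyshev_psi x"
    unfolding chebyshev_psi_def by (intro sum_nonneg mangoldt_nonneg)
  define N where "N = {n::nat. 1 \<le> n \<and> real n < x}"
  have "N \<subseteq> {1..nat \<lfloor>x\<rfloor>}" by (auto simp: N_def le_nat_floor)
  hence "card N \<le> card {1..nat \<lfloor>x\<rfloor>}" by (intro card_mono) auto
  hence "card N \<le> nat \<lfloor>x\<rfloor>" by simp
  also have "real (nat \<lfloor>x\<rfloor>) \<le> x" using x by simp
  finally have card: "real (card N) \<le> x" by simp
  have "chebyshev_psi x = (\<Sum>n\<in>N. mangoldt n)" by (simp add: chebyshev_psi_def N_def)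
  also have "\<dots> \<le> real (card N) * x"
  proof (rule sum_bounded_above)
    fix n assume n: "n \<in> N"
    have "mangoldt n \<le> real n" using norm_mangoldt_le[of n] by simp
    thus "mangoldt n \<le> x" using n by (simp add: N_def)
  qed
  also have "\<dots> \<le> x * x" using card x by (intro mult_right_mono) auto
  finally show "chebyshev_psi x \<le> x\<^sup>2" by (simp add: power2_eq_square)
qed

text \<open>Re c \<ge> 1 makes the divisions by c harmless; the linear factor is paid for with exp
  u, hence Re c - 1 in the exponent.\<close>

lemma norm_exp_primitive_le:
  assumes "Re c \<ge> 1" "u \<ge> 0"
  shows "norm (exp_primitive a b c u) \<le> 2 * (norm a + norm b) * exp (- (Re c - 1) * u)"
proof -
  have c: "norm c \<ge> 1" using assms(1) complex_Re_le_cmod[of c] by linarith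
  have div: "norm (w / c) \<le> norm w" for w
    using c by (simp add: norm_divide divide_le_eq mult_le_cancel_left1 mult_left_le order_trans[OF c])
  have "norm ((a * of_real u + b) / c + a / c\<^sup>2) \<le> norm ((a * of_real u + b) / c) + norm (a / c / c)"
    using norm_triangle_ineq[of "(a * of_real u + b) / c" "a / c\<^sup>2"] by (simp add: power2_eq_square)
  also have "\<dots> \<le> norm (a * of_real u + b) + norm a"
    using div[of "a * of_real u + b"] div[of "a / c"] div[of a] by linarith
  also have "\<dots> \<le> norm a * u + norm b + norm a"
    using norm_triangle_ineq[of "a * of_real u" b] assms(2) by (simp add: norm_mult)
  also have "\<dots> \<le> (norm a + norm b) * (1 + u)"
    using assms(2) by (simp add: algebra_simps)
  also have "\<dots> \<le> (norm a + norm b) * (2 * exp u)"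
    using linear_le_exp[of 1 u] assms(2) by (intro mult_left_mono) auto
  finally have 1: "norm ((a * of_real u + b) / c + a / c\<^sup>2) \<le> (norm a + norm b) * (2 * exp u)" .
  have "norm (exp_primitive a b c u) = exp (- Re c * u) * norm ((a * of_real u + b) / c + a / c\<^sup>2)"
    by (simp add: exp_primitive_def norm_mult norm_exp_eq_Re)
  also have "\<dots> \<le> exp (- Re c * u) * ((norm a + norm b) * (2 * exp u))"
    by (intro mult_left_mono 1) auto
  also have "\<dots> = 2 * (norm a + norm b) * (exp (- Re c * u) * exp u)" by simp
  also have "exp (- Re c * u) * exp u = exp (- (Re c - 1) * u)"
    unfolding exp_add[symmetric] by (simp add: algebra_simps)
  finally show ?thesis .
qed

lemma norm_sinc_primitive_le:
  assumes "Re z \<ge> 1" "u \<ge> 0"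
  shows "norm (sinc_primitive t z u) \<le> (4 * \<bar>t\<bar> + 8) * exp (- (Re z - 1 / 2) * u)"
proof -
  have "norm (sinc_primitive t z u) \<le>
      2 * (norm (of_real t / 2 + \<i> / 4) + norm (\<i> / 2)) * exp (- (Re z - 1 / 2) * u) +
      2 * (norm (of_real t / 2 - \<i> / 4) + norm (- \<i> / 2)) * exp (- (Re z - 1 / 2) * u)"
    unfolding sinc_primitive_def
    using norm_exp_primitive_le[of "z + 1 / 2 - \<i> * of_real t" u "of_real t / 2 + \<i> / 4" "\<i> / 2"]
      norm_exp_primitive_le[of "z + 1 / 2 + \<i> * of_real t" u "of_real t / 2 - \<i> / 4" "- \<i> / 2"] assms
    by (intro norm_triangle_mono) auto
  also have "\<dots> = (2 * (norm (of_real t / 2 + \<i> / 4) + norm (\<i> / 2)) +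
      2 * (norm (of_real t / 2 - \<i> / 4) + norm (- \<i> / 2))) * exp (- (Re z - 1 / 2) * u)"
    by (simp only: distrib_right)
  also have "\<dots> \<le> (4 * \<bar>t\<bar> + 8) * exp (- (Re z - 1 / 2) * u)"
  proof (rule mult_right_mono)
    have "norm (of_real t / 2 + \<i> / 4) \<le> \<bar>t\<bar> / 2 + 1 / 4" "norm (of_real t / 2 - \<i> / 4) \<le> \<bar>t\<bar> / 2 + 1 / 4"
      using norm_triangle_ineq[of "of_real t / 2" "\<i> / 4"] norm_triangle_ineq4[of "of_real t / 2" "\<i> / 4"]
      by (simp_all add: norm_divide)
    moreover have "norm (\<i> / 2) = 1 / 2" "norm (- \<i> / 2) = 1 / 2" by (simp_all add: norm_divide)
    ultimately show "2 * (norm (of_real t / 2 + \<i> / 4) + norm (\<i> / 2)) +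
      2 * (norm (of_real t / 2 - \<i> / 4) + norm (- \<i> / 2)) \<le> 4 * \<bar>t\<bar> + 8"
      using abs_ge_zero[of t] by argo
  qed simp
  finally show ?thesis .
qed

lemma tendsto_zero_exp_bound:
  fixes g :: "nat \<Rightarrow> complex"
  assumes "\<And>n. norm (g n) \<le> B * exp (- real n)"
  shows "g \<longlonglongrightarrow> 0"
proof (rule Lim_null_comparison)
  show "eventually (\<lambda>n. norm (g n) \<le> B * exp (- real n)) sequentially"
    using assms by simp
  have "(\<lambda>n. exp (- 1 :: real) ^ n) \<longlonglongrightarrow> 0" by (intro LIMSEQ_realpow_zero) auto
  hence "(\<lambda>n. B * exp (- 1) ^ n) \<longlonglongrightarrow> B * 0" by (intro tendsto_mult tendsto_const)
  thus "(\<lambda>n. B * exp (- real n)) \<longlonglongrightarrow> 0"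
    by (simp add: exp_of_nat_mult[symmetric])
qed

lemma sum_pieces_eq_integral:
  fixes g :: "real \<Rightarrow> complex"
  assumes "\<And>b. g integrable_on {0..b}"
  shows "(\<Sum>k<n. integral {real k..real (Suc k)} g) = integral {0..real n} g"
proof (induction n)
  case (Suc n)
  have "integral {0..real n} g + integral {real n..real (Suc n)} g = integral {0..real (Suc n)} g"
    by (rule Henstock_Kurzweil_Integration.integral_combine[OF _ _ assms]) auto
  thus ?case using Suc.IH by simp
qed simp

text \<open>At u = ln n the exponential is n^-c. The constant terms therefore give multiples of the
  series D, and the term linear in u gives its derivative series D'.\<close>

lemma mangoldt_exp_primitive_sums:
  assumes c: "c \<noteq> 0"
    and D: "(\<lambda>n. mangoldt n * of_nat n powr (-c)) sums D"
    and D': "(\<lambda>n. - of_real (ln (real n)) * (mangoldt n * of_nat n powr (-c))) sums D'"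
  shows "(\<lambda>n. mangoldt n * exp_primitive a b c (ln (real n))) sums (a / c * D' - (b / c + a / c\<^sup>2) * D)"
proof -
  have "(\<lambda>n. a / c * (- of_real (ln (real n)) * (mangoldt n * of_nat n powr (-c))) - (b / c + a / c\<^sup>2) * (mangoldt n * of_nat n powr (-c)))
      sums (a / c * D' - (b / c + a / c\<^sup>2) * D)"
    by (intro sums_diff sums_mult D D')
  also have "(\<lambda>n. a / c * (- of_real (ln (real n)) * (mangoldt n * of_nat n powr (-c))) - (b / c + a / c\<^sup>2) * (mangoldt n * of_nat n powr (-c)))
      = (\<lambda>n. mangoldt n * exp_primitive a b c (ln (real n)))"
  proof
    fix n
    show "a / c * (- of_real (ln (real n)) * (mangoldt n * of_nat n powr (-c))) - (b / c + a / c\<^sup>2) * (mangoldt n * of_nat n powr (-c))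
       = mangoldt n * exp_primitive a b c (ln (real n))"
    proof (cases "n = 0")
      case False
      hence "of_nat n powr (-c) = exp (- c * of_real (ln (real n)))"
        by (simp add: powr_def Ln_of_nat)
      thus ?thesis
        by (simp add: exp_primitive_def add_divide_distrib algebra_simps)
    qed simp
  qed
  finally show ?thesis .
qed

text \<open>The limit of \<open>f_exp_integral\<close> as U runs through the integers. The boundary
  terms decay at least like exp (- U); what remains is minus the sum of the primitive over the ln n,
  which gives D and D', and the primitive for z - 1 at u = 0, which gives the polar terms at c =
  1.\<close>

lemma f_laplace_eq_dirichlet:
  fixes t :: real
  assumes C: "C \<ge> 0" "\<And>u. u \<ge> 0 \<Longrightarrow> \<bar>u * f_exp t u\<bar> \<le> C * (1 + u)"
    and D: "\<And>s. Re s > 3 \<Longrightarrow> (\<lambda>n. mangoldt n * of_nat n powr (-s)) sums D s"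
    and D': "\<And>s. Re s > 3 \<Longrightarrow> (\<lambda>n. - of_real (ln (real n)) * (mangoldt n * of_nat n powr (-s))) sums D' s"
    and z: "Re z > 4"
  defines "F \<equiv> (\<lambda>a b c. (b / c + a / c\<^sup>2) * D c - a / c * D' c - b / (c - 1) - a / (c - 1)\<^sup>2)"
  shows "f_laplace t z = F (of_real t / 2 + \<i> / 4) (\<i> / 2) (z + 1 / 2 - \<i> * of_real t)
     + F (of_real t / 2 - \<i> / 4) (- \<i> / 2) (z + 1 / 2 + \<i> * of_real t)"
proof -
  define g where "g = (\<lambda>u. of_real (u * f_exp t u) * ((z * of_real u - 2) * exp (- z * of_real u)))"
  define K where "K = sinc_primitive t z"
  define K' where "K' = sinc_primitive t (z - 1)"
  define a where "a = complex_of_real t / 2 + \<i> / 4"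
  define a' where "a' = complex_of_real t / 2 - \<i> / 4"
  define c where "c = z + 1 / 2 - \<i> * of_real t"
  define c' where "c' = z + 1 / 2 + \<i> * of_real t"
  have "Re c > 3" "Re c' > 3" using z by (auto simp: c_def c'_def)
  moreover from this have "c \<noteq> 0" "c' \<noteq> 0" by auto
  ultimately have c: "Re c > 3" "Re c' > 3" "c \<noteq> 0" "c' \<noteq> 0" by blast+
  define S where "S = (a / c * D' c - (\<i> / 2 / c + a / c\<^sup>2) * D c) + (a' / c' * D' c' - (- \<i> / 2 / c' + a' / c'\<^sup>2) * D c')"
  have partial: "(\<Sum>k<n. integral {real k..real (Suc k)} g) = 
      - (of_real (real n * f_exp t (real n)) * (of_real (real n) * exp (- z * of_real (real n))))
      + of_real (chebyshev_psi (exp (real n))) * K (real n)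
      - (\<Sum>k<nat \<lceil>exp (real n)\<rceil>. mangoldt k * K (ln (real k))) - (K' (real n) - K' 0)" for n
  proof -
    have "(\<Sum>k<n. integral {real k..real (Suc k)} g) = integral {0..real n} g"
      unfolding g_def by (intro sum_pieces_eq_integral integrable_continuous_interval continuous_on_f_laplace_integrand) simp
    also have "\<dots> = - of_real (real n * f_exp t (real n)) * (of_real (real n) * exp (- z * of_real (real n)))
           + (\<Sum>k | 1 \<le> k \<and> real k < exp (real n). mangoldt k * (K (real n) - K (ln (real k)))) - (K' (real n) - K' 0)"
      unfolding g_def K_def K'_def by (intro integral_unique f_exp_integral) (use z in auto)
    also have "(\<Sum>k | 1 \<le> k \<and> real k < exp (real n). mangoldt k * (K (real n) - K (ln (real k)))) =
        (\<Sum>k | 1 \<le> k \<and> real k < exp (real n). mangoldt k * K (real n)) - (\<Sum>k | 1 \<le> k \<and> real k < exp (real n). mangoldt k * K (ln (real k)))"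
      by (simp only: right_diff_distrib sum_subtractf)
    also have "(\<Sum>k | 1 \<le> k \<and> real k < exp (real n). mangoldt k * K (real n)) = of_real (chebyshev_psi (exp (real n))) * K (real n)"
      by (simp add: chebyshev_psi_def sum_distrib_right)
    \<comment> \<open>For natural k, \<open>real k < x\<close> is equivalent to k being below the
      ceiling of x, so the cutoff yields a partial sum of a series. The additional index 0
      contributes \<open>mangoldt 0 = 0\<close>.\<close>
    also have "(\<Sum>k | 1 \<le> k \<and> real k < exp (real n). mangoldt k * K (ln (real k))) = (\<Sum>k<nat \<lceil>exp (real n)\<rceil>. mangoldt k * K (ln (real k)))"
    proof (rule sum.mono_neutral_left)
      have iff: "k < nat \<lceil>x\<rceil> \<longleftrightarrow> real k < x" for k x
        by (simp add: zless_nat_eq_int_zless less_ceiling_iff)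
      show "{k. 1 \<le> k \<and> real k < exp (real n)} \<subseteq> {..<nat \<lceil>exp (real n)\<rceil>}" by (auto simp: iff)
      show "\<forall>k\<in>{..<nat \<lceil>exp (real n)\<rceil>} - {k. 1 \<le> k \<and> real k < exp (real n)}. mangoldt k * K (ln (real k)) = 0"
      proof
        fix k assume "k \<in> {..<nat \<lceil>exp (real n)\<rceil>} - {k. 1 \<le> k \<and> real k < exp (real n)}"
        hence "k = 0" by (cases k) (auto simp: iff)
        thus "mangoldt k * K (ln (real k)) = 0" by simp
      qed
    qed simp
    finally show ?thesis by simp
  qed
  have lim1: "(\<lambda>n. of_real (real n * f_exp t (real n)) * (of_real (real n) * exp (- z * of_real (real n)))) \<longlonglongrightarrow> 0"
  proof (rule tendsto_zero_exp_bound)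
    fix n
    have n: "1 + real n \<le> 2 * exp (real n)" using linear_le_exp[of 1 "real n"] by simp
    have "norm (complex_of_real (real n * f_exp t (real n))) \<le> C * (1 + real n)"
      using C(2)[of "real n"] by (simp only: norm_of_real)
    also have "\<dots> \<le> C * (2 * exp (real n))" using n C(1) by (intro mult_left_mono)
    finally have 1: "norm (complex_of_real (real n * f_exp t (real n))) \<le> C * (2 * exp (real n))" .
    have "norm (exp (- z * of_real (real n))) = exp (- Re z * real n)"
      by (simp add: norm_exp_eq_Re)
    also have "\<dots> \<le> exp (- 3 * real n)" using z by (simp add: mult_right_mono)
    finally have 2: "norm (exp (- z * of_real (real n))) \<le> exp (- 3 * real n)" .
    have 3: "norm (complex_of_real (real n)) \<le> 2 * exp (real n)" using n by simp
    have "norm (of_real (real n * f_exp t (real n)) * (of_real (real n) * exp (- z * of_real (real n))))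
        \<le> C * (2 * exp (real n)) * (2 * exp (real n) * exp (- 3 * real n))"
      unfolding norm_mult[of "of_real (real n * f_exp t (real n))"] norm_mult[of "of_real (real n)"]
      using C(1) by (intro mult_mono 1 2 3) auto
    also have "\<dots> = 4 * C * exp (real n + (real n + - 3 * real n))"
      by (simp only: exp_add mult_ac)
    also have "real n + (real n + - 3 * real n) = - real n" by simp
    finally show "norm (of_real (real n * f_exp t (real n)) * (of_real (real n) * exp (- z * of_real (real n)))) \<le> 4 * C * exp (- real n)" .
  qed
  have lim2: "(\<lambda>n. of_real (chebyshev_psi (exp (real n))) * K (real n)) \<longlonglongrightarrow> 0"
  proof (rule tendsto_zero_exp_bound)
    fix n
    have 1: "norm (complex_of_real (chebyshev_psi (exp (real n)))) \<le> (exp (real n))\<^sup>2"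
      using chebyshev_psi_bounds[of "exp (real n)"] by simp
    have "norm (K (real n)) \<le> (4 * \<bar>t\<bar> + 8) * exp (- (Re z - 1 / 2) * real n)"
      unfolding K_def using z by (intro norm_sinc_primitive_le) auto
    also have "\<dots> \<le> (4 * \<bar>t\<bar> + 8) * exp (- 3 * real n)"
      using z by (intro mult_left_mono iffD2[OF exp_le_cancel_iff] mult_right_mono) auto
    finally have 2: "norm (K (real n)) \<le> (4 * \<bar>t\<bar> + 8) * exp (- 3 * real n)" .
    have "norm (of_real (chebyshev_psi (exp (real n))) * K (real n)) \<le> (exp (real n))\<^sup>2 * ((4 * \<bar>t\<bar> + 8) * exp (- 3 * real n))"
      unfolding norm_mult by (intro mult_mono 1 2) auto
    also have "\<dots> = (4 * \<bar>t\<bar> + 8) * exp (real n + (real n + - 3 * real n))"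
      by (simp only: exp_add power2_eq_square mult_ac)
    also have "real n + (real n + - 3 * real n) = - real n" by simp
    finally show "norm (of_real (chebyshev_psi (exp (real n))) * K (real n)) \<le> (4 * \<bar>t\<bar> + 8) * exp (- real n)" .
  qed
  have lim3: "(\<lambda>n. K' (real n)) \<longlonglongrightarrow> 0"
  proof (rule tendsto_zero_exp_bound)
    fix n
    have "norm (K' (real n)) \<le> (4 * \<bar>t\<bar> + 8) * exp (- (Re (z - 1) - 1 / 2) * real n)"
      unfolding K'_def using z by (intro norm_sinc_primitive_le) auto
    also have "\<dots> \<le> (4 * \<bar>t\<bar> + 8) * exp (- 1 * real n)"
      using z by (intro mult_left_mono iffD2[OF exp_le_cancel_iff] mult_right_mono) auto
    finally show "norm (K' (real n)) \<le> (4 * \<bar>t\<bar> + 8) * exp (- real n)" by simp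
  qed
  have "(\<lambda>k. mangoldt k * exp_primitive a (\<i> / 2) c (ln (real k)) + mangoldt k * exp_primitive a' (- \<i> / 2) c' (ln (real k))) sums S"
    unfolding S_def by (intro sums_add mangoldt_exp_primitive_sums D D' c)
  hence "(\<lambda>k. mangoldt k * K (ln (real k))) sums S"
    by (simp only: K_def sinc_primitive_def a_def a'_def c_def c'_def distrib_left)
  hence "(\<lambda>m. \<Sum>k<m. mangoldt k * K (ln (real k))) \<longlonglongrightarrow> S" by (simp only: sums_def)
  moreover have "filterlim (\<lambda>n. nat \<lceil>exp (real n)\<rceil>) at_top sequentially"
  proof (rule filterlim_at_top_mono[OF filterlim_ident])
    have "n \<le> nat \<lceil>exp (real n)\<rceil>" for n
    proof -
      have "real n \<le> exp (real n)" using exp_ge_add_one_self[of "real n"] by linarith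
      thus ?thesis by (simp add: le_nat_iff le_ceiling_iff)
    qed
    thus "eventually (\<lambda>n. n \<le> nat \<lceil>exp (real n)\<rceil>) sequentially" by simp
  qed
  ultimately have lim4: "(\<lambda>n. \<Sum>k<nat \<lceil>exp (real n)\<rceil>. mangoldt k * K (ln (real k))) \<longlonglongrightarrow> S"
    by (rule filterlim_compose)
  have "(\<lambda>n. \<Sum>k<n. integral {real k..real (Suc k)} g) \<longlonglongrightarrow> - 0 + 0 - S - (0 - K' 0)"
    unfolding partial by (intro tendsto_intros lim1 lim2 lim3 lim4)
  moreover have "(\<lambda>n. \<Sum>k<n. integral {real k..real (Suc k)} g) \<longlonglongrightarrow> f_laplace t z"
    unfolding f_laplace_def g_def using f_laplace_summable[OF C] z by (intro summable_LIMSEQ) auto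
  ultimately have "f_laplace t z = - 0 + 0 - S - (0 - K' 0)" using LIMSEQ_unique by blast
  also have "\<dots> = - S + K' 0" by simp
  \<comment> \<open>At u = 0 the exponentials are 1. The shift by 1 comes from the term - x in
    \<Delta> (x), so these are the terms that remove the pole of \<zeta>' / \<zeta> at 1.\<close>
  also have "K' 0 = - (\<i> / 2 / (c - 1) + a / (c - 1)\<^sup>2) + - (- \<i> / 2 / (c' - 1) + a' / (c' - 1)\<^sup>2)"
  proof -
    have "z - 1 + 1 / 2 - \<i> * of_real t = c - 1" "z - 1 + 1 / 2 + \<i> * of_real t = c' - 1"
      by (simp_all add: c_def c'_def)
    thus ?thesis by (simp add: K'_def sinc_primitive_def exp_primitive_def a_def a'_def)
  qed
  finally have "f_laplace t z = F a (\<i> / 2) c + F a' (- \<i> / 2) c'"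
    by (simp add: S_def F_def)
  thus ?thesis by (simp only: a_def a'_def c_def c'_def)
qed

section \<open>Zeros to the right of the critical line\<close>

text \<open>Each point of E is isolated by a member of a countable basis, and distinct points need
  distinct members.\<close>

lemma discrete_imp_countable:
  fixes E :: "'a :: second_countable_topology set"
  assumes "discrete E"
  shows "countable E"
proof -
  obtain B :: "'a set set" where B: "countable B" "topological_basis B"
    using ex_countable_basis by blast
  have "\<exists>b\<in>B. b \<inter> E = {x}" if x: "x \<in> E" for x
  proof -
    obtain T where T: "open T" "T \<inter> E = {x}"
      using discreteD[OF assms x] by (auto simp: isolated_in_def)
    then obtain b where "b \<in> B" "x \<in> b" "b \<subseteq> T"
      using topological_basisE[OF B(2), of T x] by blast
    thus ?thesis using T x by blast
  qed
  then obtain b where b: "\<And>x. x \<in> E \<Longrightarrow> b x \<in> B" "\<And>x. x \<in> E \<Longrightarrow> b x \<inter> E = {x}"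
    by metis
  have "inj_on b E"
    by (rule inj_onI) (metis b(2) singleton_inject)
  moreover have "countable (b ` E)" using b(1) B(1) by (meson countable_subset image_subsetI)
  ultimately show ?thesis by (rule countable_image_inj_on[rotated])
qed

text \<open>The continuation of the Mellin transform of \<open>\<psi>(x) - x\<close>.\<close>

definition psi_mellin :: "complex \<Rightarrow> complex" where
  "psi_mellin w = - deriv riemann_zeta w / (w * riemann_zeta w) - 1 / (w - 1)"

definition zeta_nonzero_region :: "complex set" where
  "zeta_nonzero_region = {w. Re w > 1 / 2 \<and> w \<noteq> 1 \<and> riemann_zeta w \<noteq> 0}"

lemma open_zeta_nonzero_region: "open zeta_nonzero_region"
proof -
  have "continuous_on (- {1}) riemann_zeta"
    using riemann_zeta_holomorphic holomorphic_on_imp_continuous_on by blast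
  hence "open (- {1} \<inter> riemann_zeta -` (- {0}))"
    by (rule continuous_open_preimage) (auto simp: open_Compl)
  hence "open ((- {1} \<inter> riemann_zeta -` (- {0})) \<inter> {w. Re w > 1 / 2})"
    by (rule open_Int[OF _ open_halfspace_Re_gt])
  also have "(- {1} \<inter> riemann_zeta -` (- {0})) \<inter> {w. Re w > 1 / 2} = zeta_nonzero_region"
    by (auto simp: zeta_nonzero_region_def)
  finally show ?thesis .
qed

lemma psi_mellin_holomorphic: "psi_mellin holomorphic_on zeta_nonzero_region"
proof -
  have z: "riemann_zeta holomorphic_on zeta_nonzero_region"
    by (rule holomorphic_on_subset[OF riemann_zeta_holomorphic]) (auto simp: zeta_nonzero_region_def)
  have d: "deriv riemann_zeta holomorphic_on zeta_nonzero_region"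
    by (rule holomorphic_deriv[OF z open_zeta_nonzero_region])
  have "(\<lambda>w. 1 / (w - 1)) holomorphic_on zeta_nonzero_region"
    by (intro holomorphic_intros) (auto simp: zeta_nonzero_region_def)
  moreover have "(\<lambda>w. - deriv riemann_zeta w / (w * riemann_zeta w)) holomorphic_on zeta_nonzero_region"
    by (intro holomorphic_on_divide holomorphic_on_minus holomorphic_on_mult d z holomorphic_on_ident)
       (auto simp: zeta_nonzero_region_def)
  ultimately show ?thesis
    unfolding psi_mellin_def[abs_def] by (intro holomorphic_on_diff)
qed

text \<open>Zeros of a nonconstant holomorphic function are isolated, hence countable on a countable
  union of closed sets; the punctured plane is one, by the complements of the discs of radius 1 / (n
  + 1) around 1. A constant \<zeta> would be - 1 / 2 throughout and have no zeros.\<close>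

lemma countable_zeta_zeros: "countable {w. w \<noteq> 1 \<and> riemann_zeta w = 0}"
proof (cases "riemann_zeta constant_on - {1}")
  case True
  hence "riemann_zeta w = - 1 / 2" if "w \<noteq> 1" for w
    using that riemann_zeta_0 by (auto simp: constant_on_def)
  hence "{w. w \<noteq> 1 \<and> riemann_zeta w = 0} = {}" by auto
  thus ?thesis by (simp only: countable_empty)
next
  case False
  have "(\<Union>n. - ball (1::complex) (inverse (real (Suc n)))) = - {1}"
  proof (intro equalityI subsetI)
    fix w :: complex assume "w \<in> - {1}"
    then obtain n where "inverse (real (Suc n)) < dist 1 w"
      using reals_Archimedean[of "dist 1 w"] by auto
    thus "w \<in> (\<Union>n. - ball 1 (inverse (real (Suc n))))" by (auto simp: not_less intro: less_imp_le)
  qed auto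
  hence fsigma: "fsigma (- {1::complex})"
    using fsigma.intros[of "\<lambda>n. - ball (1::complex) (inverse (real (Suc n)))"] by (simp add: closed_Compl)
  have "connected (- {1::complex})" by (rule connected_punctured_universe) simp
  hence "countable {w \<in> - {1}. riemann_zeta w = 0}"
    by (rule holomorphic_countable_zeros[OF riemann_zeta_holomorphic _ _ fsigma False, rotated]) (simp add: open_Compl)
  thus ?thesis by simp
qed

lemma psi_mellin_dirichlet:
  assumes D: "\<And>s. Re s > 3 \<Longrightarrow> (D has_field_derivative D' s) (at s)"
    and z: "\<And>s. Re s > 3 \<Longrightarrow> deriv riemann_zeta s = - D s * riemann_zeta s"
    and w: "Re w > 3" "w \<in> zeta_nonzero_region"
  shows "psi_mellin w = D w / w - 1 / (w - 1)"
    and "deriv psi_mellin w = D' w / w - D w / w\<^sup>2 + 1 / (w - 1)\<^sup>2"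
proof -
  have eq: "psi_mellin s = D s / s - 1 / (s - 1)" if "Re s > 3" "s \<in> zeta_nonzero_region" for s
    using that z[of s] by (auto simp: psi_mellin_def zeta_nonzero_region_def)
  show "psi_mellin w = D w / w - 1 / (w - 1)" using eq w by blast
  have "((\<lambda>s. D s / s - 1 / (s - 1)) has_field_derivative D' w / w - D w / w\<^sup>2 + 1 / (w - 1)\<^sup>2) (at w)"
  proof -
    have "w \<noteq> 0" "w - 1 \<noteq> 0" using w by auto
    thus ?thesis using D[OF w(1)]
      by (auto intro!: derivative_eq_intros) (simp add: divide_simps power2_eq_square)
  qed
  hence "(psi_mellin has_field_derivative D' w / w - D w / w\<^sup>2 + 1 / (w - 1)\<^sup>2) (at w)"
  proof (rule has_field_derivative_transform_within_open)
    show "open ({s. Re s > 3} \<inter> zeta_nonzero_region)"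
      by (intro open_Int open_halfspace_Re_gt open_zeta_nonzero_region)
  qed (use w eq in auto)
  thus "deriv psi_mellin w = D' w / w - D w / w\<^sup>2 + 1 / (w - 1)\<^sup>2" by (rule DERIV_imp_deriv)
qed

section \<open>Continuation of the formula for the Laplace transform\<close>

text \<open>In the variable w = z + 1/2 - i t the two arguments become w and w + 2 i t, and the half
  plane Re z > 0 becomes Re w > 1/2.\<close>

lemma f_laplace_shift_holomorphic:
  assumes C: "C \<ge> 0" "\<And>u. u \<ge> 0 \<Longrightarrow> \<bar>u * f_exp t u\<bar> \<le> C * (1 + u)"
  shows "(\<lambda>w. f_laplace t (w - 1 / 2 + \<i> * of_real t)) holomorphic_on {w. Re w > 1 / 2}"
proof -
  have hol: "(\<lambda>w. w - 1 / 2 + \<i> * complex_of_real t) holomorphic_on {w. Re w > 1 / 2}"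
    by (intro holomorphic_intros)
  have sub: "(\<lambda>w. w - 1 / 2 + \<i> * complex_of_real t) ` {w. Re w > 1 / 2} \<subseteq> {z. Re z > 0}" by auto
  show ?thesis
    using holomorphic_on_compose_gen[OF hol f_laplace_holomorphic[OF C] sub] unfolding o_def .
qed

text \<open>The Dirichlet series prove the formula for Re w > 5. It extends to all w for which w and
  w + 2 i t are both admissible: only countably many points of the half plane are missing, so this
  open set is connected and the identity theorem applies.\<close>

lemma f_laplace_eq_psi_mellin:
  assumes lim: "((\<lambda>X. f_trunc X t) \<longlongrightarrow> l) at_top"
    and w: "w \<in> zeta_nonzero_region" "w + 2 * \<i> * of_real t \<in> zeta_nonzero_region"
  shows "f_laplace t (w - 1 / 2 + \<i> * of_real t) =
           \<i> / 2 * psi_mellin w - (of_real t / 2 + \<i> / 4) * deriv psi_mellin w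
           + (- \<i> / 2 * psi_mellin (w + 2 * \<i> * of_real t)
              - (of_real t / 2 - \<i> / 4) * deriv psi_mellin (w + 2 * \<i> * of_real t))"
    (is "?L w = ?R w")
proof -
  obtain C where C: "C \<ge> 0" "\<And>u. u \<ge> 0 \<Longrightarrow> \<bar>u * f_exp t u\<bar> \<le> C * (1 + u)"
    using times_f_exp_bounded[OF lim] by metis
  obtain D D' where D: 
    "\<And>s. Re s > 3 \<Longrightarrow> (\<lambda>n. mangoldt n * of_nat n powr (-s)) sums D s"
    "\<And>s. Re s > 3 \<Longrightarrow> (\<lambda>n. - of_real (ln (real n)) * (mangoldt n * of_nat n powr (-s))) sums D' s"
    "\<And>s. Re s > 3 \<Longrightarrow> (D has_field_derivative D' s) (at s)"
    "\<And>s. Re s > 3 \<Longrightarrow> deriv riemann_zeta s = - D s * riemann_zeta s"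
    using mangoldt_dirichlet_series by blast
  define sh where "sh = (\<lambda>w. w + 2 * \<i> * complex_of_real t)"
  define bad where "bad = insert 1 {w. w \<noteq> 1 \<and> riemann_zeta w = 0}"
  define A where "A = zeta_nonzero_region \<inter> sh -` zeta_nonzero_region"
  have bad: "countable bad" "countable (sh -` bad)"
  proof -
    show "countable bad" unfolding bad_def by (intro countable_insert countable_zeta_zeros)
    moreover have "sh -` bad \<subseteq> (\<lambda>w. w - 2 * \<i> * of_real t) ` bad"
    proof
      fix w assume "w \<in> sh -` bad"
      hence "sh w \<in> bad" "w = sh w - 2 * \<i> * of_real t" by (auto simp: sh_def)
      thus "w \<in> (\<lambda>w. w - 2 * \<i> * of_real t) ` bad" by blast
    qed
    ultimately show "countable (sh -` bad)" by (meson countable_image countable_subset)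
  qed
  have A_eq: "A = {w. Re w > 1 / 2} - (bad \<union> sh -` bad)"
    by (auto simp: A_def sh_def bad_def zeta_nonzero_region_def)
  have openA: "open A"
    unfolding A_def by (intro open_Int open_zeta_nonzero_region open_vimage) (auto simp: sh_def intro!: continuous_intros)
  have connA: "connected A"
    unfolding A_eq using bad
    by (intro connected_open_diff_countable open_halfspace_Re_gt convex_connected convex_halfspace_Re_gt) auto
  have ne: "A \<inter> {w. Re w > 5} \<noteq> {}"
  proof
    assume empty: "A \<inter> {w. Re w > 5} = {}"
    have "ball 7 1 \<subseteq> bad \<union> sh -` bad"
    proof
      fix w :: complex assume "w \<in> ball 7 1"
      hence "Re w > 5" using abs_Re_le_cmod[of "7 - w"] by (auto simp: dist_norm)
      hence "w \<notin> A" "w \<in> {w. Re w > 1 / 2}" using empty by auto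
      thus "w \<in> bad \<union> sh -` bad" unfolding A_eq by blast
    qed
    hence "countable (ball (7::complex) 1)" using bad by (meson countable_Un countable_subset)
    thus False using uncountable_ball[of 1 "7::complex"] by simp
  qed
  have dM: "deriv psi_mellin holomorphic_on zeta_nonzero_region"
    by (rule holomorphic_deriv[OF psi_mellin_holomorphic open_zeta_nonzero_region])
  have comp: "(\<lambda>w. h (w + 2 * \<i> * of_real t)) holomorphic_on A" if "h holomorphic_on zeta_nonzero_region" for h
  proof -
    have "sh holomorphic_on A" unfolding sh_def by (intro holomorphic_intros)
    from holomorphic_on_compose_gen[OF this that] show ?thesis by (auto simp: A_def sh_def o_def)
  qed
  show ?thesis
  proof (rule analytic_continuation_open[of "A \<inter> {w. Re w > 5}" A ?L ?R])
    show "?L holomorphic_on A"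
      by (rule holomorphic_on_subset[OF f_laplace_shift_holomorphic[OF C]]) (auto simp: A_def zeta_nonzero_region_def)
    have "psi_mellin holomorphic_on A" "deriv psi_mellin holomorphic_on A"
      using psi_mellin_holomorphic dM by (auto simp: A_def elim: holomorphic_on_subset)
    thus "?R holomorphic_on A"
      by (intro holomorphic_on_add holomorphic_on_diff holomorphic_on_mult holomorphic_on_const
            comp[OF psi_mellin_holomorphic] comp[OF dM])
    show "?L v = ?R v" if v: "v \<in> A \<inter> {w. Re w > 5}" for v
    proof -
      have r: "Re v > 3" "v \<in> zeta_nonzero_region" "Re (sh v) > 3" "sh v \<in> zeta_nonzero_region"
        using v by (auto simp: A_def sh_def)
      note M = psi_mellin_dirichlet[OF D(3,4) r(1,2)] psi_mellin_dirichlet[OF D(3,4) r(3,4)]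
      have e: "v - 1 / 2 + \<i> * of_real t + 1 / 2 - \<i> * of_real t = v"
        "v - 1 / 2 + \<i> * of_real t + 1 / 2 + \<i> * of_real t = sh v"
        by (simp_all add: sh_def)
      have "Re (v - 1 / 2 + \<i> * of_real t) > 4" using v by auto
      note eq = f_laplace_eq_dirichlet[OF C D(1,2) this, unfolded e]
      \<comment> \<open>Regroups each summand as b M (c) - a M' (c), with M =
        \<open>psi_mellin\<close> in terms of D and D'.\<close>
      have ring: "(b / c + a / c\<^sup>2) * x - a / c * y - b / (c - 1) - a / (c - 1)\<^sup>2
          = b * (x / c - 1 / (c - 1)) - a * (y / c - x / c\<^sup>2 + 1 / (c - 1)\<^sup>2)" for a b c x y :: complex
        by (simp add: algebra_simps)
      have shv: "v + 2 * \<i> * of_real t = sh v" by (simp add: sh_def)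
      show ?thesis
        using eq by (simp only: shv M ring)
    qed
  qed (use openA connA ne w in \<open>auto simp: A_def sh_def intro!: open_Int open_halfspace_Re_gt\<close>)
qed

section \<open>The double pole at a zero of \<zeta>\<close>

text \<open>At a zero of order m the logarithmic derivative of \<zeta> has a simple pole with
  residue m, so \<open>psi_mellin\<close> has the residue - m / \<rho>. Its derivative then has a
  double pole with coefficient c = m / \<rho>, which is not 0.\<close>

lemma psi_mellin_at_zero:
  assumes zero: "riemann_zeta \<rho> = 0" and \<rho>: "Re \<rho> > 1 / 2" "\<rho> \<noteq> 1"
  obtains c where "c \<noteq> 0"
    "eventually (\<lambda>w. w \<in> zeta_nonzero_region) (at \<rho>)"
    "((\<lambda>w. (w - \<rho>)\<^sup>2 * psi_mellin w) \<longlongrightarrow> 0) (at \<rho>)"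
    "((\<lambda>w. (w - \<rho>)\<^sup>2 * deriv psi_mellin w) \<longlongrightarrow> c) (at \<rho>)"
proof -
  define S where "S = {w. Re w > 1 / 2} - {1::complex}"
  have S: "open S" "connected S" "\<rho> \<in> S"
  proof -
    show "open S" unfolding S_def by (rule open_delete[OF open_halfspace_Re_gt])
    show "connected S" unfolding S_def
      by (rule connected_open_delete[OF open_halfspace_Re_gt convex_connected[OF convex_halfspace_Re_gt]]) simp
    show "\<rho> \<in> S" using \<rho> by (simp add: S_def)
  qed
  have holS: "riemann_zeta holomorphic_on S"
    by (rule holomorphic_on_subset[OF riemann_zeta_holomorphic]) (auto simp: S_def)
  have "\<not> riemann_zeta constant_on S"
  proof
    assume "riemann_zeta constant_on S"
    hence "S \<subseteq> {w. w \<noteq> 1 \<and> riemann_zeta w = 0}"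
      using S(3) zero by (auto simp: constant_on_def S_def)
    hence "countable S" using countable_zeta_zeros countable_subset by blast
    moreover obtain r where "r > 0" "ball \<rho> r \<subseteq> S" using S openE by blast
    ultimately show False using uncountable_ball countable_subset by blast
  qed
  then obtain g r m where g: "0 < (m::nat)" "0 < r" "ball \<rho> r \<subseteq> S" "g holomorphic_on ball \<rho> r"
      "\<And>w. w \<in> ball \<rho> r \<Longrightarrow> riemann_zeta w = (w - \<rho>) ^ m * g w" "\<And>w. w \<in> ball \<rho> r \<Longrightarrow> g w \<noteq> 0"
    using holomorphic_factor_zero_nonconstant[OF holS S zero] by metis
  \<comment> \<open>This is (w - \<rho>) times \<open>psi_mellin w\<close>, with the singularity at
    \<rho> removed.\<close>
  define N where "N = (\<lambda>w. - of_nat m / w - (w - \<rho>) * (deriv g w / (w * g w) + 1 / (w - 1)))"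
  have nz: "w \<noteq> 0" "w \<noteq> 1" if "w \<in> ball \<rho> r" for w
  proof -
    have "w \<in> S" using that g(3) by blast
    thus "w \<noteq> 0" "w \<noteq> 1" by (auto simp: S_def)
  qed
  have dg: "deriv g holomorphic_on ball \<rho> r" by (rule holomorphic_deriv[OF g(4)]) auto
  have holN: "N holomorphic_on ball \<rho> r"
    unfolding N_def using nz g(6) by (intro holomorphic_intros g(4) dg) auto
  have zdiff: "w - \<rho> \<noteq> 0" "riemann_zeta w \<noteq> 0" if "w \<in> ball \<rho> r - {\<rho>}" for w
    using that g(5,6) by auto
  have M: "psi_mellin w = N w / (w - \<rho>)" if w: "w \<in> ball \<rho> r - {\<rho>}" for w
  proof -
    have gd: "(g has_field_derivative deriv g w) (at w)"
      using w g(4) by (intro holomorphic_derivI[of _ "ball \<rho> r"]) auto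
    obtain k where k: "m = Suc k" using g(1) by (cases m) auto
    have "((\<lambda>w. (w - \<rho>) ^ m * g w) has_field_derivative
         of_nat m * (w - \<rho>) ^ k * g w + (w - \<rho>) ^ m * deriv g w) (at w)"
      unfolding k by (rule derivative_eq_intros gd refl)+ (simp add: algebra_simps)
    hence "(riemann_zeta has_field_derivative
         of_nat m * (w - \<rho>) ^ k * g w + (w - \<rho>) ^ m * deriv g w) (at w)"
      by (rule has_field_derivative_transform_within_open[of _ _ _ "ball \<rho> r"]) (use w g(5) in auto)
    hence "deriv riemann_zeta w = of_nat m * (w - \<rho>) ^ k * g w + (w - \<rho>) ^ m * deriv g w"
      by (rule DERIV_imp_deriv)
    moreover have "riemann_zeta w = (w - \<rho>) ^ m * g w" using g(5) w by auto
    moreover have "w \<noteq> 0" "w - 1 \<noteq> 0" "g w \<noteq> 0" "w - \<rho> \<noteq> 0" using nz[of w] g(6)[of w] w by auto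
    ultimately show ?thesis
      unfolding psi_mellin_def N_def k by (simp add: divide_simps) (simp add: algebra_simps)
  qed
  have dM: "deriv psi_mellin w = deriv N w / (w - \<rho>) - N w / (w - \<rho>)\<^sup>2" if w: "w \<in> ball \<rho> r - {\<rho>}" for w
  proof (rule DERIV_imp_deriv)
    have "(N has_field_derivative deriv N w) (at w)"
      using w holN by (intro holomorphic_derivI[of _ "ball \<rho> r"]) auto
    hence "((\<lambda>w. N w / (w - \<rho>)) has_field_derivative deriv N w / (w - \<rho>) - N w / (w - \<rho>)\<^sup>2) (at w)"
      using zdiff(1)[OF w] by (auto intro!: derivative_eq_intros simp: divide_simps power2_eq_square)
    thus "(psi_mellin has_field_derivative deriv N w / (w - \<rho>) - N w / (w - \<rho>)\<^sup>2) (at w)"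
      by (rule has_field_derivative_transform_within_open[of _ _ _ "ball \<rho> r - {\<rho>}"]) (use w M in auto)
  qed
  have ev: "eventually (\<lambda>w. w \<in> ball \<rho> r - {\<rho>}) (at \<rho>)"
    using g(2) by (intro eventually_at_in_open) auto
  have N_lim: "(N \<longlongrightarrow> N \<rho>) (at \<rho>)" "(deriv N \<longlongrightarrow> deriv N \<rho>) (at \<rho>)"
    using holN holomorphic_deriv[OF holN] g(2)
    by (auto intro!: isContD continuous_on_interior[of "ball \<rho> r"] holomorphic_on_imp_continuous_on)
  show ?thesis
  proof
    show "- N \<rho> \<noteq> 0" using g(1) nz[of \<rho>] g(2) by (simp add: N_def)
    show "eventually (\<lambda>w. w \<in> zeta_nonzero_region) (at \<rho>)"
      using ev
    proof eventually_elim
      case (elim w)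
      thus ?case using zdiff(2)[of w] g(3) by (auto simp: zeta_nonzero_region_def S_def)
    qed
    have "((\<lambda>w. (w - \<rho>) * N w) \<longlongrightarrow> (\<rho> - \<rho>) * N \<rho>) (at \<rho>)"
      by (intro tendsto_intros N_lim)
    hence "((\<lambda>w. (w - \<rho>) * N w) \<longlongrightarrow> 0) (at \<rho>)" by simp
    thus "((\<lambda>w. (w - \<rho>)\<^sup>2 * psi_mellin w) \<longlongrightarrow> 0) (at \<rho>)"
    proof (rule Lim_transform_eventually)
      show "eventually (\<lambda>w. (w - \<rho>) * N w = (w - \<rho>)\<^sup>2 * psi_mellin w) (at \<rho>)"
        using ev by eventually_elim (use M zdiff in \<open>simp add: power2_eq_square\<close>)
    qed
    have "((\<lambda>w. (w - \<rho>) * deriv N w - N w) \<longlongrightarrow> (\<rho> - \<rho>) * deriv N \<rho> - N \<rho>) (at \<rho>)"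
      by (intro tendsto_intros N_lim)
    hence "((\<lambda>w. (w - \<rho>) * deriv N w - N w) \<longlongrightarrow> - N \<rho>) (at \<rho>)" by simp
    thus "((\<lambda>w. (w - \<rho>)\<^sup>2 * deriv psi_mellin w) \<longlongrightarrow> - N \<rho>) (at \<rho>)"
    proof (rule Lim_transform_eventually)
      show "eventually (\<lambda>w. (w - \<rho>) * deriv N w - N w = (w - \<rho>)\<^sup>2 * deriv psi_mellin w) (at \<rho>)"
        using ev
      proof eventually_elim
        case (elim w)
        have "u * x - y = u\<^sup>2 * (x / u - y / u\<^sup>2)" if "u \<noteq> 0" for u x y :: complex
          using that by (simp add: field_simps power2_eq_square)
        thus ?case using zdiff(1)[OF elim] unfolding dM[OF elim] by blast
      qed
    qed
  qed
qed

text \<open>Multiply the formula by (w - \<rho>)^2 and let w tend to \<rho>. The Laplace transform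
  and the terms at w + 2 i t are holomorphic at \<rho> and drop out, as does the simple pole of
  \<open>psi_mellin\<close>; what is left is a c = 0. But c is nonzero and Im a = 1/4.\<close>

lemma zeta_zero_shift:
  assumes lim: "((\<lambda>X. f_trunc X t) \<longlongrightarrow> l) at_top"
    and zero: "riemann_zeta \<rho> = 0" and \<rho>: "Re \<rho> > 1 / 2" "\<rho> \<noteq> 1"
  shows "\<rho> + 2 * \<i> * of_real t \<notin> zeta_nonzero_region"
proof
  assume shift: "\<rho> + 2 * \<i> * of_real t \<in> zeta_nonzero_region"
  obtain C where C: "C \<ge> 0" "\<And>u. u \<ge> 0 \<Longrightarrow> \<bar>u * f_exp t u\<bar> \<le> C * (1 + u)"
    using times_f_exp_bounded[OF lim] by metis
  define T where "T = (\<lambda>w. w + 2 * \<i> * complex_of_real t) -` zeta_nonzero_region"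
  define a where "a = complex_of_real t / 2 + \<i> / 4"
  define R where "R = (\<lambda>w. - \<i> / 2 * psi_mellin (w + 2 * \<i> * of_real t)
              - (of_real t / 2 - \<i> / 4) * deriv psi_mellin (w + 2 * \<i> * of_real t))"
  define L where "L = (\<lambda>w. f_laplace t (w - 1 / 2 + \<i> * of_real t))"
  obtain c where c: "c \<noteq> 0" and ev: "eventually (\<lambda>w. w \<in> zeta_nonzero_region) (at \<rho>)"
    and M: "((\<lambda>w. (w - \<rho>)\<^sup>2 * psi_mellin w) \<longlongrightarrow> 0) (at \<rho>)"
      "((\<lambda>w. (w - \<rho>)\<^sup>2 * deriv psi_mellin w) \<longlongrightarrow> c) (at \<rho>)"
    using psi_mellin_at_zero[OF zero \<rho>] by metis
  have T: "open T" "\<rho> \<in> T"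
    unfolding T_def using shift by (auto intro!: open_vimage open_zeta_nonzero_region continuous_intros)
  have comp: "(\<lambda>w. h (w + 2 * \<i> * of_real t)) holomorphic_on T" if "h holomorphic_on zeta_nonzero_region" for h
  proof -
    have "(\<lambda>w. w + 2 * \<i> * complex_of_real t) holomorphic_on T" by (intro holomorphic_intros)
    from holomorphic_on_compose_gen[OF this that] show ?thesis by (auto simp: T_def o_def)
  qed
  have "R holomorphic_on T"
    unfolding R_def
    by (intro holomorphic_on_add holomorphic_on_diff holomorphic_on_mult holomorphic_on_const
          comp psi_mellin_holomorphic holomorphic_deriv open_zeta_nonzero_region)
  hence R: "(R \<longlongrightarrow> R \<rho>) (at \<rho>)"
    using T by (intro isContD) (metis continuous_on_eq_continuous_at holomorphic_on_imp_continuous_on)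
  have "L holomorphic_on {w. Re w > 1 / 2}"
    unfolding L_def by (rule f_laplace_shift_holomorphic[OF C])
  hence L: "(L \<longlongrightarrow> L \<rho>) (at \<rho>)"
    using \<rho>(1) by (intro isContD)
      (metis continuous_on_eq_continuous_at holomorphic_on_imp_continuous_on mem_Collect_eq open_halfspace_Re_gt)
  have "((\<lambda>w. \<i> / 2 * ((w - \<rho>)\<^sup>2 * psi_mellin w) - a * ((w - \<rho>)\<^sup>2 * deriv psi_mellin w) + (w - \<rho>)\<^sup>2 * R w)
      \<longlongrightarrow> \<i> / 2 * 0 - a * c + (\<rho> - \<rho>)\<^sup>2 * R \<rho>) (at \<rho>)"
    by (intro tendsto_intros M R)
  moreover have "((\<lambda>w. (w - \<rho>)\<^sup>2 * L w) \<longlongrightarrow> (\<rho> - \<rho>)\<^sup>2 * L \<rho>) (at \<rho>)"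
    by (intro tendsto_intros L)
  hence "((\<lambda>w. \<i> / 2 * ((w - \<rho>)\<^sup>2 * psi_mellin w) - a * ((w - \<rho>)\<^sup>2 * deriv psi_mellin w) + (w - \<rho>)\<^sup>2 * R w)
      \<longlongrightarrow> (\<rho> - \<rho>)\<^sup>2 * L \<rho>) (at \<rho>)"
  proof (rule Lim_transform_eventually)
    have "eventually (\<lambda>w. w \<in> T) (at \<rho>)"
      using T by (simp add: eventually_at_topological) blast
    with ev show "eventually (\<lambda>w. (w - \<rho>)\<^sup>2 * L w = \<i> / 2 * ((w - \<rho>)\<^sup>2 * psi_mellin w)
        - a * ((w - \<rho>)\<^sup>2 * deriv psi_mellin w) + (w - \<rho>)\<^sup>2 * R w) (at \<rho>)"
    proof eventually_elim
      case (elim w)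
      hence eq: "L w = \<i> / 2 * psi_mellin w - a * deriv psi_mellin w + R w"
        unfolding L_def R_def a_def T_def by (intro f_laplace_eq_psi_mellin[OF lim]) auto
      show ?case unfolding eq by (simp add: algebra_simps)
    qed
  qed
  ultimately have "\<i> / 2 * 0 - a * c + (\<rho> - \<rho>)\<^sup>2 * R \<rho> = (\<rho> - \<rho>)\<^sup>2 * L \<rho>"
    using tendsto_unique[OF at_neq_bot] by blast
  hence "a = 0" using c by simp
  moreover have "Im a = 1 / 4" by (simp add: a_def)
  ultimately show False by simp
qed

theorem theorem6:
  fixes E :: "real set" and f :: "real \<Rightarrow> real"
  assumes "E \<subseteq> {0..}" and "discrete E"
    and "continuous_on ({0..} - E) f"
    and "\<And>t. t \<in> {0..} - E \<Longrightarrow> ((\<lambda>X. f_trunc X t) \<longlongrightarrow> f t) at_top"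
    and "\<exists>C T. \<forall>X\<ge>2. \<forall>t\<in>{0..} - E. t \<ge> T \<longrightarrow> \<bar>f_trunc X t\<bar> \<le> C * ln t"
  shows "riemann_hypothesis"
proof -
  have no_zero: "riemann_zeta \<rho> \<noteq> 0" if \<rho>: "Re \<rho> > 1 / 2" "\<rho> \<noteq> 1" for \<rho>
  proof
    assume zero: "riemann_zeta \<rho> = 0"
    define sh where "sh = (\<lambda>t. \<rho> + 2 * \<i> * complex_of_real t)"
    \<comment> \<open>The pole 1 is among the excluded points, because a shift of \<rho> onto it
      would also leave the region where the second pair of terms is holomorphic.\<close>
    define bad where "bad = insert 1 {w. w \<noteq> 1 \<and> riemann_zeta w = 0}"
    have "countable bad" unfolding bad_def by (intro countable_insert countable_zeta_zeros)
    moreover have "sh -` bad \<subseteq> (\<lambda>w. Im (w - \<rho>) / 2) ` bad"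
    proof
      fix t assume "t \<in> sh -` bad"
      hence "sh t \<in> bad" "t = Im (sh t - \<rho>) / 2" by (auto simp: sh_def)
      thus "t \<in> (\<lambda>w. Im (w - \<rho>) / 2) ` bad" by blast
    qed
    ultimately have "countable (sh -` bad)" by (meson countable_image countable_subset)
    hence "countable (E \<union> sh -` bad)" using discrete_imp_countable[OF assms(2)] by (rule countable_Un[rotated])
    \<comment> \<open>Any uncountable set of nonnegative t would serve.\<close>
    moreover have "uncountable {0<..<1::real}" by (simp add: uncountable_open_interval)
    ultimately have "\<not> {0<..<1} \<subseteq> E \<union> sh -` bad" using countable_subset by blast
    then obtain t where t: "t \<in> {0<..<1}" "t \<notin> E" "sh t \<notin> bad" by blast
    have "((\<lambda>X. f_trunc X t) \<longlongrightarrow> f t) at_top" using assms(4) t by auto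
    from zeta_zero_shift[OF this zero \<rho>] t(3) \<rho>(1) show False
      by (auto simp: sh_def bad_def zeta_nonzero_region_def)
  qed
  show ?thesis
    unfolding riemann_hypothesis_def
  proof (intro allI impI)
    fix s assume s: "nontrivial_zeta_zero s"
    hence "s \<noteq> 1" "riemann_zeta s = 0" by (auto simp: nontrivial_zeta_zero_def)
    hence "\<not> Re s > 1 / 2" using no_zero by blast
    moreover have "\<not> Re s < 1 / 2"
    proof
      assume less: "Re s < 1 / 2"
      \<comment> \<open>Needed for 1 - s \<noteq> 1: at 1 the value 0 of \<open>riemann_zeta\<close>
        is a convention and contradicts nothing.\<close>
      have "s \<noteq> 0" using \<open>riemann_zeta s = 0\<close> riemann_zeta_0 by auto
      thus False using no_zero[of "1 - s"] nontrivial_zeta_zero_reflect[OF s less] less by simp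
    qed
    ultimately show "Re s = 1 / 2" by linarith
  qed
qed

end
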